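(* Let $d'\geq 4$ and $n\geq 3$ be integers with $4\mid d'$, and let $A_1,\ldots,A_n$ be $n$ nontrivial partitions of $3d'$ of the form $$A_1=[3a_{11},\ldots,3a_{1r_1}],\quad A_2=[3a_{21},\ldots,3a_{2r_2}],\quad A_3=[2a_{31},\ldots,2a_{3r_3}],$$ $$A_k=[a_{k1},\ldots,a_{kr_k}]\quad (4\leq k\leq n),$$ where all $a_{kl}\geq 1$ are integers, satisfying $\sum_{k=1}^{n}r_k=3(n-2)d'+2$. Then the following are equivalent: (1) There exists a branched cover $f:S^2\to S^2$ of degree $3d'$ with branching data $\mathcal{D}=\{A_1,\ldots,A_n\}$. (2) There exist - a decomposition of $[a_{31},\ldots,a_{3r_3}]$ into six partitions of $d'/4$, - a decomposition of each of $[a_{11},\ldots,a_{1r_1}]$ and $[a_{21},\ldots,a_{2r_2}]$ into $4$ partitions of $d'/4$, - a decomposition of each $A_k$ ($4\leq k\leq n$) into $12$ partitions of $d'/4$, such that there exists a branched cover $g:S^2\to S^2$ of degree $d'/4$ whose branching data consists of all the partitions of $d'/4$ occurring in these decompositions.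
   Context: A branched cover $f:Y\to X$ between compact, connected, orientable surfaces is a surjective map that is locally modeled on the power maps $\mathbb{C}\ni z\mapsto z^m\in\mathbb{C}$ for positive integers $m$; $m$ is the local degree at the preimage point corresponding to $0$. A point of $X$ having a preimage of local degree greater than $1$ is a branch point; there are finitely many of them. Removing the branch points and their preimages gives a genuine covering map, whose degree $d$ is called the degree of $f$. A partition of $d$ is a multiset $[b_1,\ldots,b_r]$ of positive integers with sum $d$; it is nontrivial if at least one part is greater than $1$. The local degrees at the preimages of each branch point form a nontrivial partition of $d$. If $f$ has $n$ branch points, with corresponding partitions $A_1,\ldots,A_n$, then $\{A_1,\ldots,A_n\}$ (counted with multiplicity) is the branching data of $f$. When a list of partitions prescribing branching data contains trivial partitions $[1,\ldots,1]$, these correspond to non-branch points and are disregarded. Decomposing a partition $A$ of $md$ into $m$ partitions of $d$ means writing the multiset $A$ as the multiset union of $m$ multisets, each with sum $d$. *)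

theory Defs
  imports "HOL-Analysis.Analysis" "HOL-Library.Multiset"
begin

section \<open>Branched covers\<close>

text \<open>
  The definitions below are made for a map \<open>f\<close> from a subset \<open>Y\<close> to a subset \<open>X\<close> of topological
  spaces, both with the subspace topology. They are meant for compact, connected, orientable
  surfaces \<open>Y\<close> and \<open>X\<close>; these conditions are not built in, since they hold for the sphere,
  the only surface to which the definitions are applied.
\<close>

text \<open>Around \<open>y\<close> the map \<open>f\<close> looks, in coordinates centred at \<open>y\<close> and \<open>f y\<close>, like the power map
  \<open>z \<mapsto> z ^ m\<close> from the complex plane to itself.\<close>

definition power_model_at ::
  "'a::topological_space set \<Rightarrow> 'b::topological_space set \<Rightarrow> ('a \<Rightarrow> 'b) \<Rightarrow> 'a \<Rightarrow> nat \<Rightarrow> bool" where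
  "power_model_at Y X f y m \<longleftrightarrow> m \<ge> 1 \<and>
     (\<exists>U V \<phi> \<phi>' \<psi> \<psi>'.
        openin (top_of_set Y) U \<and> y \<in> U \<and>
        openin (top_of_set X) V \<and> f ` U \<subseteq> V \<and>
        homeomorphism U (UNIV :: complex set) \<phi> \<phi>' \<and> \<phi> y = 0 \<and>
        homeomorphism V (UNIV :: complex set) \<psi> \<psi>' \<and> \<psi> (f y) = 0 \<and>
        (\<forall>u\<in>U. \<psi> (f u) = \<phi> u ^ m))"

definition branched_cover ::
  "'a::topological_space set \<Rightarrow> 'b::topological_space set \<Rightarrow> ('a \<Rightarrow> 'b) \<Rightarrow> bool" where
  "branched_cover Y X f \<longleftrightarrow>
     continuous_on Y f \<and> f ` Y = X \<and> (\<forall>y\<in>Y. \<exists>m. power_model_at Y X f y m)"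

text \<open>The exponent is unique: it is the number of preimages near \<open>y\<close> of the points
  near, but different from, \<open>f y\<close>.\<close>

definition local_degree ::
  "'a::topological_space set \<Rightarrow> 'b::topological_space set \<Rightarrow> ('a \<Rightarrow> 'b) \<Rightarrow> 'a \<Rightarrow> nat" where
  "local_degree Y X f y = (THE m. power_model_at Y X f y m)"

definition branch_points ::
  "'a::topological_space set \<Rightarrow> 'b::topological_space set \<Rightarrow> ('a \<Rightarrow> 'b) \<Rightarrow> 'b set" where
  "branch_points Y X f = {x \<in> X. \<exists>y\<in>Y. f y = x \<and> local_degree Y X f y > 1}"

text \<open>The degree is the number of sheets of the covering map obtained by removing the branch
  points and their preimages.\<close>

definition has_cover_degree ::
  "'a::topological_space set \<Rightarrow> 'b::topological_space set \<Rightarrow> ('a \<Rightarrow> 'b) \<Rightarrow> nat \<Rightarrow> bool" where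
  "has_cover_degree Y X f d \<longleftrightarrow>
     (\<forall>x \<in> X - branch_points Y X f. finite {y \<in> Y. f y = x} \<and> card {y \<in> Y. f y = x} = d)"

text \<open>The operator \<^const>\<open>mset_set\<close> yields the empty multiset on infinite sets. For a branched
  cover of compact surfaces this does not matter: the fibres and the set of branch points are
  finite.\<close>

definition local_degrees ::
  "'a::topological_space set \<Rightarrow> 'b::topological_space set \<Rightarrow> ('a \<Rightarrow> 'b) \<Rightarrow> 'b \<Rightarrow> nat multiset" where
  "local_degrees Y X f x = image_mset (local_degree Y X f) (mset_set {y \<in> Y. f y = x})"

definition branching_data ::
  "'a::topological_space set \<Rightarrow> 'b::topological_space set \<Rightarrow> ('a \<Rightarrow> 'b) \<Rightarrow> nat multiset multiset"
  where
  "branching_data Y X f = image_mset (local_degrees Y X f) (mset_set (branch_points Y X f))"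

section \<open>Partitions\<close>

definition is_partition :: "nat \<Rightarrow> nat multiset \<Rightarrow> bool" where
  "is_partition d A \<longleftrightarrow> (\<forall>b\<in>#A. b \<ge> 1) \<and> sum_mset A = d"

definition nontrivial :: "nat multiset \<Rightarrow> bool" where
  "nontrivial A \<longleftrightarrow> (\<exists>b\<in>#A. b > 1)"

definition decomposes_into :: "nat multiset \<Rightarrow> nat \<Rightarrow> nat \<Rightarrow> nat multiset multiset \<Rightarrow> bool" where
  "decomposes_into A m d P \<longleftrightarrow> size P = m \<and> (\<forall>B\<in>#P. is_partition d B) \<and> \<Sum>\<^sub># P = A"

section \<open>Branched covers of the sphere with prescribed branching data\<close>

abbreviation S2 :: "(real ^ 3) set" where
  "S2 \<equiv> sphere 0 1"

text \<open>Trivial partitions in the prescribed data \<open>D\<close> correspond to non-branch points and are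
  disregarded.\<close>

definition sphere_cover_with_data ::
  "(real ^ 3 \<Rightarrow> real ^ 3) \<Rightarrow> nat \<Rightarrow> nat multiset multiset \<Rightarrow> bool" where
  "sphere_cover_with_data f d D \<longleftrightarrow>
     branched_cover S2 S2 f \<and> has_cover_degree S2 S2 f d \<and>
     branching_data S2 S2 f = filter_mset nontrivial D"

end

theory Submission
  imports Defs "HOL-Complex_Analysis.Conformal_Mappings"
begin

text \<open>A finite group of rotations of the sphere isomorphic to the alternating group \<open>A\<^sub>4\<close> has a
quotient map from the sphere to the sphere of degree 12, whose three branch points have all local
degrees 3, 3 and 2. If all local degrees of \<open>f\<close> over three points are divisible by 3, 3 and 2,
then near every point of its domain \<open>f\<close> lifts through this quotient map; the sphere is simply
connected, so the local lifts fit together and \<open>f\<close> is the composite of some \<open>g\<close> with the quotient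
map. The fibre of the quotient map has 4, 4 and 6 points over the branch points and 12 points
elsewhere. The branching data of \<open>g\<close> is therefore obtained by decomposing the partitions of \<open>f\<close>,
divided by 3, 3 and 2, into 4, 4 and 6 parts, and the others into 12 parts. Conversely, the branch
points of a given \<open>g\<close> can be moved by a homeomorphism to any prescribed position, and composing
with the quotient map gives \<open>f\<close>.

The group \<open>A\<^sub>4\<close> is solvable, and the proof uses its composition series with factors of orders
3, 2 and 2 in place of the group: up to homeomorphisms the quotient map is a composite of three power
maps \<open>z \<mapsto> z ^ 3\<close>, \<open>z \<mapsto> z ^ 2\<close>, \<open>z \<mapsto> z ^ 2\<close> of the Riemann sphere. A power map \<open>z \<mapsto> z ^ p\<close> is totally branched over
two points and unbranched elsewhere. Its effect on branching data is the content of
\<open>realizable_power_imp\<close> and \<open>realizable_power_if\<close>: two partitions are divided by \<open>p\<close>, and each of the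
others is decomposed into \<open>p\<close> partitions. The cube is used first and is branched over the first two
points; the third partition breaks into three pieces with even entries. The first square is
branched over two of these pieces and breaks the third into two pieces with even entries, over
which the second square is branched. This is \<open>realizable_tetrahedral\<close>.

Four topological facts carry the argument. A power model may be read in any prescribed chart of
the target (\<open>power_model_in_chart\<close>); this rests on taking \<open>m\<close>-th roots of homeomorphisms of the
plane (\<open>power_root_chart\<close>) and gives uniqueness, multiplicativity and divisibility of local degrees. The
number of preimages, counted with local degrees, does not depend on the point
(\<open>weight_constant\<close>). Lifts through a power map exist as soon as they exist locally
(\<open>lift_exists\<close>). Finitely many points of the sphere can be moved at will
(\<open>homeomorphism_moving_points_S2\<close>), so that branching data can be realized at prescribed points
(\<open>data_imp_located\<close>).\<close>

section \<open>Roots of local homeomorphisms of the plane\<close>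

text \<open>A homeomorphism from the disc of radius \<open>r ^ m\<close> onto the plane that only changes absolute values. The
\<open>m\<close>-th root in the denominator makes it compatible with the power map: the homeomorphisms for
exponents \<open>1\<close> and \<open>m\<close> conjugate \<open>z \<mapsto> z ^ m\<close> between discs to \<open>z \<mapsto> z ^ m\<close> between planes. Hence
power models on discs are as good as power models on the whole plane.\<close>

definition radial :: "nat \<Rightarrow> real \<Rightarrow> complex \<Rightarrow> complex" where
  "radial m r w = w / of_real ((r - root m (norm w)) ^ m)"

definition radial_inv :: "nat \<Rightarrow> real \<Rightarrow> complex \<Rightarrow> complex" where
  "radial_inv m r w = w * of_real ((r / (1 + root m (norm w))) ^ m)"

lemma radial_power:
  assumes "m \<ge> 1"
  shows "radial m r (z ^ m) = radial 1 r z ^ m"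
  using assms by (simp add: radial_def norm_power power_divide real_root_power_cancel)

lemma norm_less_power_iff:
  "m \<ge> 1 \<Longrightarrow> r > 0 \<Longrightarrow> norm (w::complex) < r ^ m \<longleftrightarrow> root m (norm w) < r"
  by (metis Suc_le_eq One_nat_def less_le real_root_less_iff real_root_pos2)

lemma homeomorphism_radial:
  assumes m: "m \<ge> 1" and r: "r > 0"
  shows "homeomorphism (ball 0 (r ^ m)) UNIV (radial m r) (radial_inv m r)"
proof (rule homeomorphismI)
  have pos: "r - root m (norm w) > 0" if "w \<in> ball 0 (r ^ m)" for w :: complex
    using norm_less_power_iff[OF m r, of w] that by simp
  have pos': "1 + root m (norm w) > 0" for w :: complex
    by (simp add: add_pos_nonneg real_root_ge_zero)
  show "continuous_on (ball 0 (r ^ m)) (radial m r)"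
    unfolding radial_def using pos by (intro continuous_intros) force+
  show "continuous_on UNIV (radial_inv m r)"
    unfolding radial_inv_def using pos' by (intro continuous_intros) (metis less_irrefl)
  have rt: "root m (x ^ m) = x" if "x \<ge> 0" for x
    using m that by (simp add: real_root_power_cancel)
  have rt': "root m x ^ m = x" if "x \<ge> 0" for x
    using m that by (simp add: real_root_pow_pos2)
  have A: "root m (norm (radial m r w)) = root m (norm w) / (r - root m (norm w))" if "w \<in> ball 0 (r ^ m)" for w
  proof -
    have "norm (of_real (r - root m (norm w)) :: complex) = r - root m (norm w)"
      using pos[OF that] by (simp only: norm_of_real abs_of_pos)
    then show ?thesis
      using pos[OF that] m by (simp add: radial_def norm_divide norm_power real_root_divide rt)
  qed
  have B: "root m (norm (radial_inv m r w)) = root m (norm w) * (r / (1 + root m (norm w)))" for w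
    using pos'[of w] m r norm_of_real[of "1 + root m (norm w)", where 'a=complex]
    by (simp add: radial_inv_def norm_mult norm_divide norm_power real_root_mult real_root_divide rt power_divide)
  show "radial_inv m r (radial m r w) = w" if w: "w \<in> ball 0 (r ^ m)" for w
  proof -
    define x where "x = root m (norm w)"
    have "x < r" using pos[OF w] x_def by simp
    have "r / (1 + x / (r - x)) = r - x" using \<open>x < r\<close> r by (simp add: field_simps)
    then show ?thesis using \<open>x < r\<close> A[OF w] unfolding radial_inv_def
      by (simp add: x_def radial_def)
  qed
  show "radial m r (radial_inv m r w) = w" for w
  proof -
    define x where "x = root m (norm w)"
    have x: "1 + x > 0" using pos' x_def by simp
    have "r - x * (r / (1 + x)) = r / (1 + x)" using x by (simp add: field_simps)
    moreover have "1 + of_real x \<noteq> (0::complex)"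
      using x by (metis less_irrefl of_real_1 of_real_add of_real_eq_0_iff)
    ultimately show ?thesis using x r B[of w] unfolding radial_def
      by (simp add: x_def radial_inv_def)
  qed
  show "radial_inv m r ` UNIV \<subseteq> ball 0 (r ^ m)"
  proof clarsimp
    fix w show "norm (radial_inv m r w) < r ^ m"
    proof -
      have "x * (r / (1 + x)) < r" if "1 + x > 0" for x :: real
        using r that by (simp add: field_simps)
      then show ?thesis using norm_less_power_iff[OF m r] B[of w] pos'[of w] by simp
    qed
  qed
qed auto

lemma exp_eq_int: "exp w = exp z \<longleftrightarrow> (\<exists>n::int. w = z + of_int n * (2 * of_real pi * \<i>))"
  using exp_eq[of w z] by (simp add: algebra_simps)

lemma integer_valued_continuous_constant:
  fixes q :: "'a::topological_space \<Rightarrow> complex"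
  assumes "connected H" "continuous_on H q" and qint: "\<And>w. w \<in> H \<Longrightarrow> q w \<in> \<int>"
  shows "q constant_on H"
proof (rule continuous_discrete_range_constant[OF assms(1,2)])
    fix x assume "x \<in> H"
    show "\<exists>e>0. \<forall>y. y \<in> H \<and> q y \<noteq> q x \<longrightarrow> e \<le> norm (q y - q x)"
    proof (intro exI[of _ 1] conjI allI impI)
      fix y assume y: "y \<in> H \<and> q y \<noteq> q x"
      then obtain a b :: int where "q y = of_int a" "q x = of_int b" using qint \<open>x \<in> H\<close> by (metis Ints_cases)
      then have "a \<noteq> b" and "q y - q x = of_int (a - b)" using y by auto
      then show "1 \<le> norm (q y - q x)"
        by (simp only: norm_of_int)
    qed simp
qed

text \<open>In logarithmic coordinates \<open>z = exp w\<close> the punctured disc becomes a half-plane, which is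
contractible, so \<open>\<theta>\<close> has a logarithm there. The integer \<open>n\<close> is the winding number around 0 of the images of
small circles.\<close>

lemma lifted_logarithm:
  fixes \<theta> :: "complex \<Rightarrow> complex"
  assumes R: "R > 0" and cont: "continuous_on (ball 0 R) \<theta>" and nz: "\<And>z. z \<in> ball 0 R \<Longrightarrow> z \<noteq> 0 \<Longrightarrow> \<theta> z \<noteq> 0"
  obtains L and n :: int where "continuous_on {w. exp w \<in> ball 0 R} L"
    "\<And>w. exp w \<in> ball 0 R \<Longrightarrow> exp (L w) = \<theta> (exp w)"
    "\<And>w k. exp w \<in> ball 0 R \<Longrightarrow> L (w + of_int k * (2 * of_real pi * \<i>)) = L w + of_int (n * k) * (2 * of_real pi * \<i>)"
proof -
  define H where "H = {w::complex. exp w \<in> ball 0 R}"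
  have Heq: "H = {w. Re w < ln R}"
    unfolding H_def using R by (auto simp: norm_exp_eq_Re) (metis exp_ln exp_less_cancel_iff)+
  have "convex H" unfolding Heq using convex_halfspace_Re_lt by blast
  have oH: "open H" unfolding Heq using open_halfspace_Re_lt by blast
  have "continuous_on H (\<lambda>w. \<theta> (exp w))"
    by (rule continuous_on_compose2[OF cont]) (auto simp: H_def intro!: continuous_intros)
  then obtain L where L: "continuous_on H L" "\<And>w. w \<in> H \<Longrightarrow> \<theta> (exp w) = exp (L w)"
    using continuous_logarithm_on_contractible[of H "\<lambda>w. \<theta> (exp w)"] \<open>convex H\<close> convex_imp_contractible nz
    by (metis H_def exp_not_eq_zero mem_Collect_eq)
  let ?p = "2 * of_real pi * \<i> :: complex"
  have inH: "w + of_int k * ?p \<in> H \<longleftrightarrow> w \<in> H" for w k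
    by (simp add: Heq)
  have per: "exp (w + of_int k * ?p) = exp w" for w k
    by (metis exp_eq_int)
  \<comment> \<open>The increment of \<open>L\<close> over one period, which is an integer and hence constant.\<close>
  define q where "q w = (L (w + ?p) - L w) / ?p" for w
  have qint: "q w \<in> \<int>" if "w \<in> H" for w
  proof -
    have "exp (L (w + ?p)) = exp (L w)"
      using L(2)[of w] L(2)[of "w + ?p"] inH[of w 1] per[of w 1] that by simp
    then obtain n::int where "L (w + ?p) = L w + of_int n * ?p" using exp_eq_int by blast
    then have "q w = of_int n" by (simp add: q_def)
    then show ?thesis by simp
  qed
  have qc: "continuous_on H q"
    unfolding q_def
    by (intro continuous_intros L(1) continuous_on_compose2[OF L(1)]) (use inH[of _ 1] in auto)
  have "q constant_on H"
    by (rule integer_valued_continuous_constant[OF convex_connected[OF \<open>convex H\<close>] qc qint])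
  then obtain c where c: "\<And>w. w \<in> H \<Longrightarrow> q w = c" unfolding constant_on_def by blast
  have "\<exists>n::int. \<forall>w\<in>H. q w = of_int n"
  proof (cases "H = {}")
    case False
    then obtain w where "w \<in> H" by blast
    then show ?thesis using c qint by (metis Ints_cases)
  qed simp
  then obtain n :: int where n: "\<And>w. w \<in> H \<Longrightarrow> q w = of_int n" by blast
  have step: "L (w + ?p) = L w + of_int n * ?p" if "w \<in> H" for w
    using n[OF that] by (simp add: q_def field_simps)
  have nat: "L (w + of_nat k * ?p) = L w + of_nat k * of_int n * ?p" if "w \<in> H" for w k
  proof (induction k)
    case (Suc k)
    have "L (w + of_nat (Suc k) * ?p) = L ((w + of_nat k * ?p) + ?p)" by (simp add: algebra_simps)
    also have "\<dots> = L (w + of_nat k * ?p) + of_int n * ?p"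
      using step[of "w + of_nat k * ?p"] inH[of w "int k"] that by simp
    finally show ?case using Suc by (simp add: algebra_simps)
  qed simp
  have int: "L (w + of_int k * ?p) = L w + of_int (n * k) * ?p" if "w \<in> H" for w k
  proof (cases k rule: int_cases2)
    case (nonneg j)
    then show ?thesis using nat[OF that, of j] by (simp add: algebra_simps)
  next
    case (nonpos j)
    then show ?thesis using nat[of "w + of_int k * ?p" j] inH[of w k] that
      by (simp add: algebra_simps)
  qed
  show ?thesis
    by (rule that[of L n]) (use L int in \<open>auto simp: H_def\<close>)
qed

lemma exp_surjective: "z \<noteq> 0 \<Longrightarrow> \<exists>w. exp w = (z::complex)"
  by (metis exp_Ln)

text \<open>An injective map has winding number \<open>\<plusminus>1\<close>. Its local inverse also has a lifted logarithm, with some period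
\<open>m\<close>. The composite of the two lifts differs from the identity by a constant, so \<open>m * n = 1\<close>.\<close>

lemma lifted_logarithm_period_unit:
  fixes \<theta> :: "complex \<Rightarrow> complex"
  assumes R: "R > 0" and cont: "continuous_on (ball 0 R) \<theta>" and inj: "inj_on \<theta> (ball 0 R)" and zero: "\<theta> 0 = 0"
    and L: "continuous_on {w. exp w \<in> ball 0 R} L"
    "\<And>w. exp w \<in> ball 0 R \<Longrightarrow> exp (L w) = \<theta> (exp w)"
    "\<And>w k. exp w \<in> ball 0 R \<Longrightarrow> L (w + of_int k * (2 * of_real pi * \<i>)) = L w + of_int (n * k) * (2 * of_real pi * \<i>)"
  shows "n = 1 \<or> n = -1"
proof -
  let ?p = "2 * of_real pi * \<i> :: complex"
  have op: "open (\<theta> ` ball 0 R)" by (rule invariance_of_domain[OF cont _ inj]) simp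
  obtain g where g: "homeomorphism (ball 0 R) (\<theta> ` ball 0 R) \<theta> g"
    using invariance_of_domain_homeomorphism[OF _ cont _ inj] by auto
  have "0 \<in> \<theta> ` ball 0 R" using R zero by force
  then obtain Q where Q: "Q > 0" "ball 0 Q \<subseteq> \<theta> ` ball 0 R" using op open_contains_ball by blast
  have gz: "g 0 = 0" using homeomorphism_apply1[OF g, of 0] zero R by simp
  have gnz: "g z \<noteq> 0" if "z \<in> ball 0 Q" "z \<noteq> 0" for z
    using homeomorphism_apply2[OF g, of z] Q(2) that zero by auto
  have gc: "continuous_on (ball 0 Q) g"
    using g Q unfolding homeomorphism_def by (meson continuous_on_subset)
  obtain M and m :: int where M: "continuous_on {w. exp w \<in> ball 0 Q} M"
    "\<And>w. exp w \<in> ball 0 Q \<Longrightarrow> exp (M w) = g (exp w)"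
    "\<And>w k. exp w \<in> ball 0 Q \<Longrightarrow> M (w + of_int k * ?p) = M w + of_int (m * k) * ?p"
    using lifted_logarithm[OF Q(1) gc gnz] by metis
  have "isCont \<theta> 0" using cont R by (simp add: continuous_on_eq_continuous_at)
  then obtain \<delta> where \<delta>: "\<delta> > 0" "\<And>z. norm z < \<delta> \<Longrightarrow> norm (\<theta> z) < Q"
    using Q(1) zero unfolding continuous_at_eps_delta by (auto simp: dist_norm)
  \<comment> \<open>On the disc of radius \<open>c\<close> both \<open>\<theta>\<close> and the lift of its inverse after it are defined.\<close>
  define c where "c = min \<delta> R"
  have c: "c > 0" using \<delta> R by (simp add: c_def)
  define H where "H = {w::complex. exp w \<in> ball 0 c}"
  have Heq: "H = {w. Re w < ln c}"
    unfolding H_def using c by (auto simp: norm_exp_eq_Re) (metis exp_ln exp_less_cancel_iff)+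
  have cH: "connected H" unfolding Heq using convex_halfspace_Re_lt convex_connected by blast
  have HR: "exp w \<in> ball 0 R" and HQ: "exp (L w) \<in> ball 0 Q" if "w \<in> H" for w
    using that L(2)[of w] \<delta>(2)[of "exp w"] by (auto simp: H_def c_def)
  define q where "q w = (M (L w) - w) / ?p" for w
  have qint: "q w \<in> \<int>" if "w \<in> H" for w
  proof -
    have "exp (M (L w)) = exp w"
      using M(2)[OF HQ[OF that]] L(2)[OF HR[OF that]] HR[OF that] g unfolding homeomorphism_def by simp
    then obtain n::int where "M (L w) = w + of_int n * ?p" using exp_eq_int by blast
    then have "q w = of_int n" by (simp add: q_def)
    then show ?thesis by simp
  qed
  have qc: "continuous_on H q"
    unfolding q_def
    by (intro continuous_intros continuous_on_compose2[OF M(1)] continuous_on_subset[OF L(1)])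
      (use HR HQ in auto)
  have "q constant_on H"
    by (rule integer_valued_continuous_constant[OF cH qc qint])
  then obtain k where k: "\<And>w. w \<in> H \<Longrightarrow> q w = k" unfolding constant_on_def by blast
  define w where "w = complex_of_real (ln c - 1)"
  have w: "w \<in> H" "w + ?p \<in> H" by (auto simp: Heq w_def)
  have "M (L (w + ?p)) = M (L w) + of_int (m * n) * ?p"
    using L(3)[OF HR[OF w(1)], of 1] M(3)[OF HQ[OF w(1)], of n] by simp
  moreover have "M (L (w + ?p)) - (w + ?p) = M (L w) - w"
  proof -
    have "?p \<noteq> 0" by simp
    moreover have "q (w + ?p) = q w" using k w by simp
    ultimately show ?thesis unfolding q_def by (simp only: divide_cancel_right) blast
  qed
  ultimately have "of_int (m * n) * ?p = ?p" by (simp add: algebra_simps)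
  then have "of_int (m * n) = (1::complex)" by simp
  then have "m * n = 1" using of_int_eq_1_iff by blast
  then show ?thesis using zmult_eq_1_iff by blast
qed

text \<open>The map \<open>\<Theta>\<close> is the \<open>m\<close>-th root of \<open>\<theta> (z ^ m)\<close>, namely \<open>exp (L (m * log z) / m)\<close> with the lifted
logarithm \<open>L\<close> of \<open>\<theta>\<close>. Changing the branch of \<open>log z\<close> by one period changes the exponent by \<open>n\<close> periods, so the formula is well
defined. It is injective because \<open>n\<close> is a unit.\<close>

lemma power_root_chart:
  fixes \<theta> :: "complex \<Rightarrow> complex"
  assumes m: "m \<ge> 1" and s: "s > 0" and cont: "continuous_on (ball 0 (s ^ m)) \<theta>"
    and inj: "inj_on \<theta> (ball 0 (s ^ m))" and zero: "\<theta> 0 = 0"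
  obtains \<Theta> where "continuous_on (ball 0 s) \<Theta>" "inj_on \<Theta> (ball 0 s)" "\<Theta> 0 = 0"
    "\<And>z. z \<in> ball 0 s \<Longrightarrow> \<Theta> z ^ m = \<theta> (z ^ m)"
proof -
  let ?p = "2 * of_real pi * \<i> :: complex"
  have R: "s ^ m > 0" using s by simp
  have nz: "\<theta> z \<noteq> 0" if "z \<in> ball 0 (s ^ m)" "z \<noteq> 0" for z
    using inj that zero R by (metis centre_in_ball inj_onD)
  obtain L and n :: int where L: "continuous_on {w. exp w \<in> ball 0 (s ^ m)} L"
    "\<And>w. exp w \<in> ball 0 (s ^ m) \<Longrightarrow> exp (L w) = \<theta> (exp w)"
    "\<And>w k. exp w \<in> ball 0 (s ^ m) \<Longrightarrow> L (w + of_int k * ?p) = L w + of_int (n * k) * ?p"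
    using lifted_logarithm[OF R cont nz] by metis
  have n: "n = 1 \<or> n = -1" by (rule lifted_logarithm_period_unit[OF R cont inj zero L])
  define \<Theta> where "\<Theta> z = (if z = 0 then 0 else exp (L (of_nat m * Ln z) / of_nat m))" for z
  have ball: "exp (of_nat m * w) \<in> ball 0 (s ^ m)" if "exp w \<in> ball 0 s" for w :: complex
    using that m s by (auto simp: exp_of_nat_mult norm_power power_strict_mono)
  have shift: "exp (L (of_nat m * (w + of_int k * ?p)) / of_nat m) = exp (of_int (n * k) * ?p) * exp (L (of_nat m * w) / of_nat m)"
    if "exp w \<in> ball 0 s" for w k
  proof -
    have "of_nat m * (w + of_int k * ?p) = of_nat m * w + of_int (int m * k) * ?p" by (simp add: algebra_simps)
    then have "L (of_nat m * (w + of_int k * ?p)) = L (of_nat m * w) + of_int (n * (int m * k)) * ?p"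
      using L(3)[OF ball[OF that], of "int m * k"] by simp
    then have "L (of_nat m * (w + of_int k * ?p)) / of_nat m = L (of_nat m * w) / of_nat m + of_int (n * k) * ?p"
      using m by (simp add: field_simps)
    then show ?thesis by (simp add: exp_add)
  qed
  have per: "exp (of_int k * ?p) = 1" for k :: int
    using exp_eq_int[of "of_int k * ?p" 0] by auto
  have \<Theta>: "\<Theta> (exp w) = exp (L (of_nat m * w) / of_nat m)" if "exp w \<in> ball 0 s" for w
  proof -
    have "exp (Ln (exp w)) = exp w" by simp
    then obtain k :: int where k: "Ln (exp w) = w + of_int k * ?p" using exp_eq_int by blast
    show ?thesis using shift[OF that, of k] per[of "n * k"] k by (simp add: \<Theta>_def)
  qed
  have pw: "\<Theta> z ^ m = \<theta> (z ^ m)" if "z \<in> ball 0 s" for z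
  proof (cases "z = 0")
    case True then show ?thesis using m zero by (simp add: \<Theta>_def power_0_left)
  next
    case False
    then obtain w where w: "z = exp w" using exp_surjective by metis
    have "\<Theta> z ^ m = exp (L (of_nat m * w))"
      using \<Theta>[of w] that w m by (simp flip: exp_of_nat_mult)
    also have "\<dots> = \<theta> (z ^ m)" using L(2)[OF ball[of w]] that w by (simp add: exp_of_nat_mult)
    finally show ?thesis .
  qed
  show ?thesis
  proof (rule that[of \<Theta>])
    show "\<Theta> 0 = 0" by (simp add: \<Theta>_def)
    show "\<And>z. z \<in> ball 0 s \<Longrightarrow> \<Theta> z ^ m = \<theta> (z ^ m)" by (fact pw)
    show "inj_on \<Theta> (ball 0 s)"
    proof (rule inj_onI)
      fix y z assume y: "y \<in> ball 0 s" and z: "z \<in> ball 0 s" and eq: "\<Theta> y = \<Theta> z"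
      have bb: "x ^ m \<in> ball 0 (s ^ m)" if "x \<in> ball 0 s" for x :: complex
        using that m s by (simp add: norm_power power_strict_mono)
      have yz: "y ^ m = z ^ m" using pw[OF y] pw[OF z] eq inj bb[OF y] bb[OF z] by (metis inj_onD)
      show "y = z"
      proof (cases "y = 0 \<or> z = 0")
        case True then show ?thesis using yz m by (auto simp: power_0_left)
      next
        case False
        then obtain v where v: "y = exp v" using exp_surjective by metis
        from False obtain w where w: "z = exp w" using exp_surjective by metis
        have "exp (of_nat m * v) = exp (of_nat m * w)" using yz v w by (simp add: exp_of_nat_mult)
        then obtain j :: int where j: "of_nat m * v = of_nat m * w + of_int j * ?p" using exp_eq_int by blast
        have "exp (L (of_nat m * v) / of_nat m) = exp (L (of_nat m * w) / of_nat m)"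
          using eq \<Theta>[of v] \<Theta>[of w] y z v w by simp
        moreover have "L (of_nat m * v) = L (of_nat m * w) + of_int (n * j) * ?p"
          using L(3)[OF ball[of w], of j] z w j by simp
        ultimately obtain i :: int where i: "(L (of_nat m * w) + of_int (n * j) * ?p) / of_nat m = L (of_nat m * w) / of_nat m + of_int i * ?p"
          using exp_eq_int by auto
        then have "of_int (n * j) * ?p = of_int (int m * i) * ?p" using m by (simp add: field_simps)
        then have "of_int (n * j) = (of_int (int m * i) :: complex)" by (simp only: mult_cancel_right) simp
        then have "n * j = int m * i" by (simp only: of_int_eq_iff)
        then have "j = int m * (n * i)" using n by auto
        then have "of_nat m * v = of_nat m * (w + of_int (n * i) * ?p)" using j by (simp add: algebra_simps)
        then have "v = w + of_int (n * i) * ?p" using m by simp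
        then show ?thesis using v w exp_eq_int by metis
      qed
    qed
    show "continuous_on (ball 0 s) \<Theta>"
    proof -
      have "isCont \<Theta> z" if z: "z \<in> ball 0 s" for z
      proof (cases "z = 0")
        case False
        then obtain w where w: "z = exp w" using exp_surjective by metis
        define g where "g x = w + Ln (x / z)" for x
        have gexp: "exp (g x) = x" if "x \<noteq> 0" for x using that False w by (simp add: g_def exp_add)
        define U where "U = ball 0 s \<inter> {x. Re (x / z) > 0}"
        have oU: "open U" unfolding U_def by (intro open_Int open_ball open_Collect_less continuous_intros) (use False in auto)
        have zU: "z \<in> U" using z False by (simp add: U_def)
        have nz: "x \<noteq> 0" "x / z \<notin> \<real>\<^sub>\<le>\<^sub>0" if "x \<in> U" for x
          using that by (auto simp: U_def complex_nonpos_Reals_iff)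
        have "continuous_on U (\<lambda>x. exp (L (of_nat m * g x) / of_nat m))"
        proof -
          have "continuous_on U g" unfolding g_def by (intro continuous_intros) (use False nz in auto)
          then have "continuous_on U (\<lambda>x. of_nat m * g x)" by (intro continuous_intros)
          moreover have "(\<lambda>x. of_nat m * g x) ` U \<subseteq> {w. exp w \<in> ball 0 (s ^ m)}"
          proof
            fix v assume "v \<in> (\<lambda>x. of_nat m * g x) ` U"
            then obtain x where x: "x \<in> U" "v = of_nat m * g x" by blast
            then have "exp (g x) \<in> ball 0 s" using gexp[OF nz(1)] by (simp add: U_def)
            then show "v \<in> {w. exp w \<in> ball 0 (s ^ m)}" using ball x by simp
          qed
          ultimately have "continuous_on U (\<lambda>x. L (of_nat m * g x))"
            by (rule continuous_on_compose2[OF L(1)])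
          then show ?thesis by (intro continuous_intros) (use m in auto)
        qed
        moreover have "exp (L (of_nat m * g x) / of_nat m) = \<Theta> x" if "x \<in> U" for x
          using \<Theta>[of "g x"] gexp[of x] nz[OF that] that by (simp add: U_def)
        ultimately have "continuous_on U \<Theta>" by (simp cong: continuous_on_cong)
        then show ?thesis using oU zU continuous_on_eq_continuous_at by blast
      next
        case True
        have "isCont (\<lambda>z. root m (norm (\<theta> (z ^ m)))) 0"
        proof (intro isCont_o2[where g = "\<lambda>x. root m (norm x)" and f = "\<lambda>z. \<theta> (z ^ m)"])
          have "isCont \<theta> 0" using cont R by (simp add: continuous_on_eq_continuous_at)
          then show "isCont (\<lambda>z. \<theta> (z ^ m)) 0"
            by (intro isCont_o2[where g = \<theta> and f = "\<lambda>z. z ^ m"] continuous_intros) (use m in \<open>simp add: power_0_left\<close>)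
        qed (intro continuous_intros)
        then have "((\<lambda>z. root m (norm (\<theta> (z ^ m)))) \<longlongrightarrow> 0) (at 0)"
          using m zero by (simp add: isCont_def power_0_left)
        moreover have "eventually (\<lambda>z. root m (norm (\<theta> (z ^ m))) = norm (\<Theta> z)) (at 0)"
        proof -
          have "eventually (\<lambda>z. z \<in> ball 0 s) (at (0::complex))"
            using s by (intro eventually_at_in_open') auto
          then show ?thesis
          proof eventually_elim
            case (elim z)
            then show ?case using m by (simp add: pw[symmetric] norm_power real_root_power_cancel)
          qed
        qed
        ultimately have "((\<lambda>z. norm (\<Theta> z)) \<longlongrightarrow> 0) (at 0)" by (rule Lim_transform_eventually)
        then have "(\<Theta> \<longlongrightarrow> 0) (at 0)" by (rule tendsto_norm_zero_cancel)
        then show ?thesis using True by (simp add: isCont_def \<Theta>_def)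
      qed
      then show ?thesis by (simp add: continuous_at_imp_continuous_on)
    qed
  qed
qed

lemma power_locally_injective:
  assumes "(z::complex) \<noteq> 0" "m \<ge> 1"
  obtains \<delta> where "\<delta> > 0" "inj_on (\<lambda>w. w ^ m) (ball z \<delta>)"
proof -
  have "deriv (\<lambda>w. w ^ m) z = of_nat m * z ^ (m - 1)"
    by (rule DERIV_imp_deriv) (auto intro!: derivative_eq_intros)
  then have "deriv (\<lambda>w. w ^ m) z \<noteq> 0" using assms by simp
  moreover have "(\<lambda>w. w ^ m) holomorphic_on UNIV" by (intro holomorphic_intros)
  ultimately show ?thesis using has_complex_derivative_locally_injective[of "\<lambda>w. w ^ m" UNIV z] that by auto
qed

section \<open>Charts and power models\<close>

lemma homeomorphism_injD:
  "homeomorphism S T f g \<Longrightarrow> x \<in> S \<Longrightarrow> y \<in> S \<Longrightarrow> f x = f y \<Longrightarrow> x = y"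
  by (metis homeomorphism_apply1)

text \<open>A chart onto a disc. Together with its variant onto the whole plane it splits the data in a
power model into a source chart and a target chart that can be changed separately.\<close>

definition disc_chart :: "'a::topological_space set \<Rightarrow> 'a \<Rightarrow> 'a set \<Rightarrow> ('a \<Rightarrow> complex) \<Rightarrow> (complex \<Rightarrow> 'a) \<Rightarrow> real \<Rightarrow> bool"
  where
  "disc_chart X x U \<phi> \<phi>' r \<longleftrightarrow> r > 0 \<and> openin (top_of_set X) U \<and> x \<in> U \<and>
     homeomorphism U (ball 0 r) \<phi> \<phi>' \<and> \<phi> x = 0"

definition plane_chart :: "'a::topological_space set \<Rightarrow> 'a \<Rightarrow> 'a set \<Rightarrow> ('a \<Rightarrow> complex) \<Rightarrow> (complex \<Rightarrow> 'a) \<Rightarrow> bool"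
  where
  "plane_chart X x V \<psi> \<psi>' \<longleftrightarrow> openin (top_of_set X) V \<and> x \<in> V \<and>
     homeomorphism V UNIV \<psi> \<psi>' \<and> \<psi> x = 0"

lemma power_model_at_iff:
  "power_model_at Y X f y m \<longleftrightarrow> m \<ge> 1 \<and> (\<exists>U V \<phi> \<phi>' \<psi> \<psi>'. plane_chart Y y U \<phi> \<phi>' \<and>
     plane_chart X (f y) V \<psi> \<psi>' \<and> f ` U \<subseteq> V \<and> (\<forall>u\<in>U. \<psi> (f u) = \<phi> u ^ m))"
  unfolding power_model_at_def plane_chart_def
  by (rule conj_cong[OF refl], (rule ex_cong1)+) blast

lemma power_model_atE:
  assumes "power_model_at Y X f y m"
  obtains U V \<phi> \<phi>' \<psi> \<psi>' where "m \<ge> 1" "plane_chart Y y U \<phi> \<phi>'" "plane_chart X (f y) V \<psi> \<psi>'"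
    "f ` U \<subseteq> V" "\<forall>u\<in>U. \<psi> (f u) = \<phi> u ^ m"
  using assms[unfolded power_model_at_iff] by (elim conjE exE) (rule that)

lemma power_model_atI:
  assumes "m \<ge> 1" "plane_chart Y y U \<phi> \<phi>'" "plane_chart X (f y) V \<psi> \<psi>'"
    "f ` U \<subseteq> V" "\<And>u. u \<in> U \<Longrightarrow> \<psi> (f u) = \<phi> u ^ m"
  shows "power_model_at Y X f y m"
proof -
  have "\<forall>u\<in>U. \<psi> (f u) = \<phi> u ^ m" using assms(5) by blast
  then have "plane_chart Y y U \<phi> \<phi>' \<and> plane_chart X (f y) V \<psi> \<psi>' \<and> f ` U \<subseteq> V \<and> (\<forall>u\<in>U. \<psi> (f u) = \<phi> u ^ m)"
    using assms(2-4) by simp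
  then show ?thesis unfolding power_model_at_iff
    by (intro conjI[OF assms(1)]) (rule exI[of _ U], rule exI[of _ V], rule exI[of _ \<phi>], rule exI[of _ \<phi>'],
      rule exI[of _ \<psi>], rule exI[of _ \<psi>'])
qed

lemma power_model_at_domain:
  assumes "power_model_at Y X f y m"
  shows "m \<ge> 1" "y \<in> Y" "f y \<in> X"
  using assms openin_imp_subset unfolding power_model_at_def by blast+

lemma plane_chart_ball:
  assumes "plane_chart X x V \<psi> \<psi>'" "r > 0"
  shows "disc_chart X x (\<psi>' ` ball 0 r) \<psi> \<psi>' r"
proof -
  have h: "homeomorphism V UNIV \<psi> \<psi>'" using assms plane_chart_def by blast
  have "homeomorphism (\<psi>' ` ball 0 r) (ball 0 r) \<psi> \<psi>'"
    using h by (intro homeomorphism_of_subsets[OF h]) (auto simp: homeomorphism_def image_image)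
  moreover have "openin (top_of_set V) (\<psi>' ` ball 0 r)"
    by (rule homeomorphism_imp_open_map[OF homeomorphism_symD[OF h]]) simp
  moreover have "x \<in> \<psi>' ` ball 0 r"
    using assms h unfolding plane_chart_def by (metis centre_in_ball homeomorphism_apply1 image_eqI)
  ultimately show ?thesis
    using assms unfolding plane_chart_def disc_chart_def by (auto intro: openin_trans)
qed

lemma disc_chart_radial:
  assumes "disc_chart X x U \<phi> \<phi>' (r ^ m)" "m \<ge> 1" "r > 0"
  shows "plane_chart X x U (radial m r \<circ> \<phi>) (\<phi>' \<circ> radial_inv m r)"
  using assms homeomorphism_compose[OF _ homeomorphism_radial[of m r]]
  unfolding plane_chart_def disc_chart_def by (auto simp: radial_def)

lemma power_model_of_disc_charts:
  assumes U: "disc_chart Y y U \<phi> \<phi>' r" and V: "disc_chart X (f y) V \<psi> \<psi>' (r ^ m)" and m: "m \<ge> 1"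
    and "f ` U \<subseteq> V" and eq: "\<And>u. u \<in> U \<Longrightarrow> \<psi> (f u) = \<phi> u ^ m"
  shows "power_model_at Y X f y m"
proof -
  have r: "r > 0" using U by (simp add: disc_chart_def)
  have "plane_chart Y y U (radial 1 r \<circ> \<phi>) (\<phi>' \<circ> radial_inv 1 r)"
    using disc_chart_radial[of Y y U \<phi> \<phi>' r 1] U r by simp
  moreover have "plane_chart X (f y) V (radial m r \<circ> \<psi>) (\<psi>' \<circ> radial_inv m r)"
    using disc_chart_radial[OF V m r] .
  moreover have "\<forall>u\<in>U. (radial m r \<circ> \<psi>) (f u) = (radial 1 r \<circ> \<phi>) u ^ m"
    using eq radial_power[OF m] by simp
  ultimately show ?thesis unfolding power_model_at_iff using m assms(4) by blast
qed

text \<open>Here the target chart covers the whole plane; it is restricted to the disc that matches the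
source chart.\<close>

lemma power_model_of_disc_chart:
  assumes U: "disc_chart Y y U \<phi> \<phi>' r" and V: "plane_chart X (f y) V \<psi> \<psi>'" and m: "m \<ge> 1"
    and fU: "f ` U \<subseteq> V" and eq: "\<And>u. u \<in> U \<Longrightarrow> \<psi> (f u) = \<phi> u ^ m"
  shows "power_model_at Y X f y m"
proof (rule power_model_of_disc_charts[OF U plane_chart_ball[OF V] m _ eq])
  show "r ^ m > 0" using U by (simp add: disc_chart_def)
  show "f ` U \<subseteq> \<psi>' ` ball 0 (r ^ m)"
  proof clarify
    fix u assume u: "u \<in> U"
    then have "norm (\<phi> u) < r" using U unfolding disc_chart_def homeomorphism_def by force
    then have "norm (\<phi> u ^ m) < r ^ m" using m by (simp add: norm_power power_strict_mono)
    moreover have "\<psi>' (\<phi> u ^ m) = f u"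
      using eq[OF u] V fU u unfolding plane_chart_def by (metis homeomorphism_apply1 image_subset_iff)
    ultimately show "f u \<in> \<psi>' ` ball 0 (r ^ m)" by (metis image_eqI mem_ball_0)
  qed
qed

text \<open>The change of target charts is a local homeomorphism \<open>\<theta>\<close> of the plane fixing 0. By
\<open>power_root_chart\<close> it lifts to a local homeomorphism \<open>\<Theta>\<close> with \<open>\<Theta> z ^ m = \<theta> (z ^ m)\<close>, and composing
the source chart with \<open>\<Theta>\<close> absorbs the change. The neighbourhood can be taken inside any given \<open>W\<close>.\<close>

lemma power_model_in_chart:
  assumes pm: "power_model_at Y X f y m" and V: "plane_chart X (f y) V \<psi> \<psi>'"
    and W: "openin (top_of_set Y) W" "y \<in> W"
  obtains U \<phi> \<phi>' r where "disc_chart Y y U \<phi> \<phi>' r" "U \<subseteq> W" "f ` U \<subseteq> V" "\<forall>u\<in>U. \<psi> (f u) = \<phi> u ^ m"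
proof -
  obtain U0 V0 \<phi>0 \<phi>0' \<psi>0 \<psi>0' where m: "m \<ge> 1" and U0: "plane_chart Y y U0 \<phi>0 \<phi>0'"
    and V0: "plane_chart X (f y) V0 \<psi>0 \<psi>0'" and fU0: "f ` U0 \<subseteq> V0" and eq0: "\<forall>u\<in>U0. \<psi>0 (f u) = \<phi>0 u ^ m"
    by (rule power_model_atE[OF pm]) (rule that, assumption+)
  note defs = U0[unfolded plane_chart_def] V0[unfolded plane_chart_def] V[unfolded plane_chart_def]
  have hU0: "homeomorphism U0 UNIV \<phi>0 \<phi>0'" and hV0: "homeomorphism V0 UNIV \<psi>0 \<psi>0'" and hV: "homeomorphism V UNIV \<psi> \<psi>'"
    using defs by auto
  define T0 where "T0 = \<psi>0 ` (V0 \<inter> V)"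
  have "openin (top_of_set V0) (V0 \<inter> V)"
    using defs by (meson inf.cobounded1 openin_Int openin_subset_trans openin_imp_subset)
  then have "open T0"
    using homeomorphism_imp_open_map[OF hV0] unfolding T0_def by fastforce
  moreover have "0 \<in> T0" using defs unfolding T0_def by force
  ultimately obtain R0 where R0: "R0 > 0" "ball 0 R0 \<subseteq> T0" using open_contains_ball by blast
  \<comment> \<open>Since \<open>s \<le> 1\<close>, also \<open>s ^ m \<le> s\<close>.\<close>
  define s where "s = min 1 R0"
  have s: "s > 0" "s ^ m \<le> R0"
    using R0(1) m power_decreasing[of 1 m s] by (auto simp: s_def)
  then have bT0: "ball 0 (s ^ m) \<subseteq> T0" using R0(2) by auto
  have T0V: "\<psi>0' z \<in> V" if "z \<in> T0" for z
    using that hV0 unfolding T0_def by (auto simp: homeomorphism_apply1)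
  define \<theta> where "\<theta> = \<psi> \<circ> \<psi>0'"
  have "continuous_on (ball 0 (s ^ m)) \<theta>"
    unfolding \<theta>_def
  proof (rule continuous_on_compose)
    show "continuous_on (ball 0 (s ^ m)) \<psi>0'" using hV0 unfolding homeomorphism_def using continuous_on_subset by blast
    have "continuous_on V \<psi>" using hV homeomorphism_def by blast
    then show "continuous_on (\<psi>0' ` ball 0 (s ^ m)) \<psi>" by (rule continuous_on_subset) (use bT0 T0V in blast)
  qed
  moreover have "inj_on \<theta> (ball 0 (s ^ m))"
  proof (rule inj_onI)
    fix a b assume a: "a \<in> ball 0 (s ^ m)" and b: "b \<in> ball 0 (s ^ m)" and "\<theta> a = \<theta> b"
    then have "\<psi>0' a = \<psi>0' b" using T0V bT0 hV unfolding \<theta>_def by (metis comp_apply homeomorphism_apply1 subsetD)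
    then show "a = b" using hV0 by (metis UNIV_I homeomorphism_apply2)
  qed
  moreover have "\<psi>0' 0 = f y" using defs by (metis homeomorphism_apply1)
  then have "\<theta> 0 = 0" using defs by (simp add: \<theta>_def)
  ultimately obtain \<Theta> where T: "continuous_on (ball 0 s) \<Theta>" "inj_on \<Theta> (ball 0 s)" "\<Theta> 0 = 0"
    "\<And>z. z \<in> ball 0 s \<Longrightarrow> \<Theta> z ^ m = \<theta> (z ^ m)"
    using power_root_chart[OF m s(1)] by metis
  have "openin (top_of_set U0) (U0 \<inter> W)"
    using defs W by (meson inf.cobounded1 openin_Int openin_subset_trans openin_imp_subset)
  then have "open (\<phi>0 ` (U0 \<inter> W))"
    using homeomorphism_imp_open_map[OF hU0] by fastforce
  moreover have "0 \<in> \<phi>0 ` (U0 \<inter> W)" using defs W by force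
  ultimately obtain s1 where s1: "s1 > 0" "ball 0 s1 \<subseteq> \<phi>0 ` (U0 \<inter> W)" using open_contains_ball by blast
  define t where "t = min s s1"
  have t: "t > 0" "ball 0 t \<subseteq> ball 0 s" "ball 0 t \<subseteq> ball 0 s1" using s s1 by (auto simp: t_def)
  have ct: "continuous_on (ball 0 t) \<Theta>" and it: "inj_on \<Theta> (ball 0 t)"
    using T t by (auto intro: continuous_on_subset inj_on_subset)
  have oT: "open (\<Theta> ` ball 0 t)" by (rule invariance_of_domain[OF ct _ it]) simp
  obtain \<Theta>' where hT: "homeomorphism (ball 0 t) (\<Theta> ` ball 0 t) \<Theta> \<Theta>'"
    using invariance_of_domain_homeomorphism[OF _ ct _ it] by auto
  have "0 \<in> \<Theta> ` ball 0 t" using t T(3) by force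
  then obtain r where r: "r > 0" "ball 0 r \<subseteq> \<Theta> ` ball 0 t" using oT open_contains_ball by blast
  define D where "D = \<Theta>' ` ball 0 r"
  have Dt: "D \<subseteq> ball 0 t" using homeomorphism_image2[OF hT] r unfolding D_def by (metis image_mono)
  have hD: "homeomorphism D (ball 0 r) \<Theta> \<Theta>'"
    unfolding D_def
    by (rule homeomorphism_symD, rule homeomorphism_of_subsets[OF homeomorphism_symD[OF hT] r(2) order_refl]) simp
  have "openin (top_of_set (\<Theta> ` ball 0 t)) (ball 0 r)" using r by (simp add: open_subset)
  then have "openin (top_of_set (ball 0 t)) D"
    unfolding D_def by (rule homeomorphism_imp_open_map[OF homeomorphism_symD[OF hT]])
  then have oD: "open D" by (simp add: openin_open_eq)
  define U where "U = \<phi>0' ` D"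
  have hU: "homeomorphism U D \<phi>0 \<phi>0'"
    unfolding U_def
    by (rule homeomorphism_symD, rule homeomorphism_of_subsets[OF homeomorphism_symD[OF hU0] _ order_refl]) auto
  have UU0: "U \<subseteq> U0" using homeomorphism_image2[OF hU0] unfolding U_def by auto
  have oU: "openin (top_of_set Y) U"
  proof -
    have "openin (top_of_set U0) U" unfolding U_def
      by (rule homeomorphism_imp_open_map[OF homeomorphism_symD[OF hU0]]) (use oD in simp)
    then show ?thesis using defs by (meson openin_trans)
  qed
  have hC: "homeomorphism U (ball 0 r) (\<Theta> \<circ> \<phi>0) (\<phi>0' \<circ> \<Theta>')"
    by (rule homeomorphism_compose[OF hU hD])
  have "0 \<in> D"
  proof -
    have "\<Theta>' 0 = 0" using homeomorphism_apply1[OF hT, of 0] T(3) t by simp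
    then show ?thesis unfolding D_def using r by force
  qed
  then have yU: "y \<in> U" unfolding U_def using defs by (metis homeomorphism_apply1 image_eqI)
  have UW: "U \<subseteq> W"
  proof
    fix u assume u: "u \<in> U"
    then have "\<phi>0 u \<in> D" using homeomorphism_image1[OF hU] by blast
    then have "\<phi>0 u \<in> \<phi>0 ` (U0 \<inter> W)" using Dt t s1 by blast
    then obtain u' where u': "\<phi>0 u = \<phi>0 u'" "u' \<in> U0" "u' \<in> W" by (elim imageE) auto
    have "u = u'"
      using u'(1) homeomorphism_apply1[OF hU0 u'(2)] homeomorphism_apply1[OF hU0, of u] u UU0 by auto
    then show "u \<in> W" using u' by simp
  qed
  have key: "f u \<in> V \<and> \<psi> (f u) = (\<Theta> \<circ> \<phi>0) u ^ m" if u: "u \<in> U" for u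
  proof -
    have b: "\<phi>0 u \<in> ball 0 s" using u homeomorphism_image1[OF hU] Dt t by blast
    have "\<phi>0 u ^ m \<in> ball 0 (s ^ m)" using b m by (simp add: norm_power power_strict_mono)
    then have "\<psi>0' (\<phi>0 u ^ m) \<in> V" using T0V bT0 by blast
    moreover have "\<psi>0' (\<phi>0 u ^ m) = f u"
    proof -
      have "f u \<in> V0" "\<psi>0 (f u) = \<phi>0 u ^ m" using u UU0 fU0 eq0 by auto
      then show ?thesis using homeomorphism_apply1[OF hV0, of "f u"] by simp
    qed
    ultimately show ?thesis using T(4)[OF b] by (simp add: \<theta>_def)
  qed
  show ?thesis
    by (rule that[of U "\<Theta> \<circ> \<phi>0" "\<phi>0' \<circ> \<Theta>'" r])
      (use key UW hC oU yU r T(3) defs in \<open>auto simp: disc_chart_def\<close>)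
qed

lemma power_model_cong:
  assumes "power_model_at Y X f y m" "\<And>u. u \<in> Y \<Longrightarrow> f' u = f u"
  shows "power_model_at Y X f' y m"
proof -
  obtain U V \<phi> \<phi>' \<psi> \<psi>' where 1: "m \<ge> 1" "plane_chart Y y U \<phi> \<phi>'" "plane_chart X (f y) V \<psi> \<psi>'"
    "f ` U \<subseteq> V" "\<forall>u\<in>U. \<psi> (f u) = \<phi> u ^ m"
    by (rule power_model_atE[OF assms(1)]) (rule that, assumption+)
  have UY: "U \<subseteq> Y" using 1(2) openin_imp_subset unfolding plane_chart_def by blast
  have "f' y = f y" using assms(2) power_model_at_domain(2)[OF assms(1)] by blast
  then show ?thesis
    by (intro power_model_atI[where f = f', OF 1(1,2)]) (use 1 UY assms(2) in \<open>auto simp: image_subset_iff subset_iff\<close>)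
qed

lemma disc_fibre:
  assumes U: "disc_chart Y y U \<phi> \<phi>' r" and m: "m \<ge> 1" and c: "c \<noteq> 0" "norm c < r ^ m"
  shows "finite {u \<in> U. \<phi> u ^ m = c}" "card {u \<in> U. \<phi> u ^ m = c} = m"
proof -
  have h: "homeomorphism U (ball 0 r) \<phi> \<phi>'" and r: "r > 0" using U by (auto simp: disc_chart_def)
  have "bij_betw \<phi> {u \<in> U. \<phi> u ^ m = c} {z. z ^ m = c}"
  proof (rule bij_betw_byWitness[where f' = \<phi>'])
    have "norm z < r" if "z ^ m = c" for z
      using that c(2) r m by (metis norm_power norm_ge_zero power_less_imp_less_base less_imp_le)
    then show "\<forall>z\<in>{z. z ^ m = c}. \<phi> (\<phi>' z) = z" "\<phi>' ` {z. z ^ m = c} \<subseteq> {u \<in> U. \<phi> u ^ m = c}"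
      using h unfolding homeomorphism_def by (auto simp: subset_iff)
  qed (use h in \<open>auto simp: homeomorphism_def\<close>)
  moreover have "card {z. z ^ m = c} = m" using card_nth_roots[OF c(1)] m by simp
  ultimately show "card {u \<in> U. \<phi> u ^ m = c} = m" using bij_betw_same_card by metis
  then show "finite {u \<in> U. \<phi> u ^ m = c}" using m by (intro card_ge_0_finite) simp
qed

text \<open>In a common target chart and nested discs, a value close to but different from the centre has
exactly \<open>m'\<close> preimages in the inner disc and exactly \<open>m\<close> in the outer one.\<close>

lemma power_model_le:
  assumes "power_model_at Y X f y m" "power_model_at Y X f y m'"
  shows "m' \<le> m"
proof -
  have m: "m \<ge> 1" "m' \<ge> 1" using assms[THEN power_model_at_domain(1)] by auto
  obtain V \<psi> \<psi>' where V: "plane_chart X (f y) V \<psi> \<psi>'"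
    by (rule power_model_atE[OF assms(1)]) (rule that)
  have YY: "openin (top_of_set Y) Y" "y \<in> Y"
    using power_model_at_domain[OF assms(1)] by auto
  obtain U \<phi> \<phi>' r where U: "disc_chart Y y U \<phi> \<phi>' r" "U \<subseteq> Y" "f ` U \<subseteq> V" "\<forall>u\<in>U. \<psi> (f u) = \<phi> u ^ m"
    by (rule power_model_in_chart[OF assms(1) V YY]) (rule that, assumption+)
  have oU: "openin (top_of_set Y) U" "y \<in> U" using U by (auto simp: disc_chart_def)
  obtain U' \<mu> \<mu>' r' where U': "disc_chart Y y U' \<mu> \<mu>' r'" "U' \<subseteq> U" "f ` U' \<subseteq> V" "\<forall>u\<in>U'. \<psi> (f u) = \<mu> u ^ m'"
    by (rule power_model_in_chart[OF assms(2) V oU]) (rule that, assumption+)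
  have rr: "r > 0" "r' > 0" using U U' by (auto simp: disc_chart_def)
  \<comment> \<open>A nonzero value that is taken in both discs.\<close>
  define c where "c = complex_of_real (min (r ^ m) (r' ^ m') / 2)"
  have p: "min (r ^ m) (r' ^ m') > 0" using rr by simp
  then have c: "c \<noteq> 0" "norm c = min (r ^ m) (r' ^ m') / 2" unfolding c_def norm_of_real by auto
  then have c': "norm c < r ^ m" "norm c < r' ^ m'" using p by linarith+
  have "{u \<in> U'. \<mu> u ^ m' = c} \<subseteq> {u \<in> U. \<phi> u ^ m = c}"
  proof clarify
    fix u assume u: "u \<in> U'" "c = \<mu> u ^ m'"
    have "\<psi> (f u) = \<mu> u ^ m'" using u(1) U'(4) by blast
    moreover have "u \<in> U" using u(1) U'(2) by blast
    moreover from this have "\<psi> (f u) = \<phi> u ^ m" using U(4) by blast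
    ultimately show "u \<in> U \<and> \<phi> u ^ m = \<mu> u ^ m'" by simp
  qed
  then show ?thesis
    using disc_fibre[OF U(1) m(1) c(1) c'(1)] disc_fibre[OF U'(1) m(2) c(1) c'(2)] card_mono by metis
qed

lemma power_model_unique:
  "power_model_at Y X f y m \<Longrightarrow> power_model_at Y X f y m' \<Longrightarrow> m = m'"
  by (meson power_model_le le_antisym)

lemma local_degree_eq:
  "power_model_at Y X f y m \<Longrightarrow> local_degree Y X f y = m"
  unfolding local_degree_def using power_model_unique by blast

text \<open>The source chart of \<open>h\<close> is prescribed as the target chart of \<open>g\<close>, and then exponents multiply.\<close>

lemma power_model_compose:
  assumes g: "power_model_at Y X g y m" and h: "power_model_at X Z h (g y) k"
  shows "power_model_at Y Z (\<lambda>u. h (g u)) y (m * k)"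
proof -
  have mk: "m \<ge> 1" "k \<ge> 1" using power_model_at_domain(1)[OF g] power_model_at_domain(1)[OF h] by auto
  obtain U1 V1 \<phi>1 \<phi>1' \<psi>1 \<psi>1' where 1: "plane_chart X (g y) U1 \<phi>1 \<phi>1'" "plane_chart Z (h (g y)) V1 \<psi>1 \<psi>1'"
    "h ` U1 \<subseteq> V1" "\<forall>u\<in>U1. \<psi>1 (h u) = \<phi>1 u ^ k"
    by (rule power_model_atE[OF h]) (rule that, assumption+)
  have YY: "openin (top_of_set Y) Y" "y \<in> Y"
    using power_model_at_domain[OF g] by auto
  obtain U \<phi> \<phi>' r where U: "disc_chart Y y U \<phi> \<phi>' r" "U \<subseteq> Y" "g ` U \<subseteq> U1" "\<forall>u\<in>U. \<phi>1 (g u) = \<phi> u ^ m"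
    by (rule power_model_in_chart[OF g 1(1) YY]) (rule that, assumption+)
  show ?thesis
    by (rule power_model_of_disc_chart[where f = "\<lambda>u. h (g u)", OF U(1) 1(2)])
      (use 1(3,4) U(3,4) mk in \<open>auto simp: power_mult image_subset_iff\<close>)
qed

text \<open>By invariance of domain \<open>f\<close> is a local homeomorphism, so it transports the chart at \<open>y\<close> to a chart at
\<open>f y\<close> in which it is the identity.\<close>

lemma power_model_injective:
  assumes A: "plane_chart Y y A \<alpha> \<alpha>'" and B: "plane_chart X (f y) B \<beta> \<beta>'"
    and N: "openin (top_of_set Y) N" "y \<in> N" and f: "continuous_on N f" "inj_on f N" "f ` N \<subseteq> X"
  shows "power_model_at Y X f y 1"
proof -
  note defs = A[unfolded plane_chart_def] B[unfolded plane_chart_def]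
  have hA: "homeomorphism A UNIV \<alpha> \<alpha>'" and hB: "homeomorphism B UNIV \<beta> \<beta>'" using defs by auto
  define N' where "N' = N \<inter> f -` B \<inter> A"
  have "openin (top_of_set N) (N \<inter> f -` B)"
    using f defs by (metis continuous_openin_preimage image_subset_iff_funcset)
  then have "openin (top_of_set Y) N'"
    unfolding N'_def using N(1) defs by (blast intro: openin_Int openin_trans)
  then have "openin (top_of_set A) N'"
    using defs unfolding N'_def by (meson inf.cobounded2 openin_subset_trans openin_imp_subset)
  then have "open (\<alpha> ` N')" using homeomorphism_imp_open_map[OF hA] by fastforce
  moreover have "0 \<in> \<alpha> ` N'" using defs N unfolding N'_def by force
  ultimately obtain r where r: "r > 0" "ball 0 r \<subseteq> \<alpha> ` N'" using open_contains_ball by blast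
  have inN: "\<alpha>' z \<in> N'" if "z \<in> ball 0 r" for z
    using that r hA unfolding N'_def by (fastforce simp: homeomorphism_apply1)
  define \<theta> where "\<theta> z = \<beta> (f (\<alpha>' z))" for z
  have ct: "continuous_on (ball 0 r) \<theta>"
    unfolding \<theta>_def
  proof (rule continuous_on_compose2[where g = \<beta> and t = B])
    show "continuous_on B \<beta>" using hB homeomorphism_def by blast
    show "continuous_on (ball 0 r) (\<lambda>z. f (\<alpha>' z))"
      by (rule continuous_on_compose2[OF f(1)])
        (use hA inN in \<open>auto simp: homeomorphism_def N'_def intro: continuous_on_subset\<close>)
  qed (use inN in \<open>auto simp: N'_def\<close>)
  have it: "inj_on \<theta> (ball 0 r)"
  proof (rule inj_onI)
    fix a b assume a: "a \<in> ball 0 r" and b: "b \<in> ball 0 r" and e: "\<theta> a = \<theta> b"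
    have "f (\<alpha>' a) = f (\<alpha>' b)"
      using e inN[OF a] inN[OF b] hB unfolding \<theta>_def N'_def by (metis IntE homeomorphism_apply1 vimageE)
    then have "\<alpha>' a = \<alpha>' b" using f(2) inN[OF a] inN[OF b] unfolding N'_def by (auto dest: inj_onD)
    then show "a = b" using hA by (metis UNIV_I homeomorphism_apply2)
  qed
  have oT: "open (\<theta> ` ball 0 r)" by (rule invariance_of_domain[OF ct _ it]) simp
  obtain \<theta>' where hT: "homeomorphism (ball 0 r) (\<theta> ` ball 0 r) \<theta> \<theta>'"
    using invariance_of_domain_homeomorphism[OF _ ct _ it] by auto
  define V where "V = \<beta>' ` \<theta> ` ball 0 r"
  have hV: "homeomorphism V (\<theta> ` ball 0 r) \<beta> \<beta>'"
    unfolding V_def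
    by (rule homeomorphism_symD, rule homeomorphism_of_subsets[OF homeomorphism_symD[OF hB] _ order_refl]) auto
  have "openin (top_of_set B) V" unfolding V_def
    by (rule homeomorphism_imp_open_map[OF homeomorphism_symD[OF hB]]) (use oT in simp)
  then have oV: "openin (top_of_set X) V" using defs by (meson openin_trans)
  have U: "disc_chart Y y (\<alpha>' ` ball 0 r) \<alpha> \<alpha>' r" by (rule plane_chart_ball[OF A r(1)])
  have fV: "f u \<in> V" "\<theta>' (\<beta> (f u)) = \<alpha> u" if u: "u \<in> \<alpha>' ` ball 0 r" for u
  proof -
    obtain z where z: "z \<in> ball 0 r" "u = \<alpha>' z" using u by blast
    have "f u \<in> B" using inN z unfolding N'_def by blast
    then have "f u = \<beta>' (\<theta> z)" using hB z by (simp add: \<theta>_def homeomorphism_apply1)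
    then show "f u \<in> V" using z unfolding V_def by blast
    show "\<theta>' (\<beta> (f u)) = \<alpha> u"
      using z homeomorphism_apply1[OF hT z(1)] homeomorphism_apply2[OF hA, of z] by (simp add: \<theta>_def)
  qed
  have "disc_chart X (f y) V (\<theta>' \<circ> \<beta>) (\<beta>' \<circ> \<theta>) (r ^ 1)"
    unfolding disc_chart_def
    using fV[of y] U oV r(1) defs homeomorphism_compose[OF hV homeomorphism_symD[OF hT]]
    by (auto simp: disc_chart_def)
  show ?thesis
    by (rule power_model_of_disc_charts[where f = f, OF U \<open>disc_chart X (f y) V (\<theta>' \<circ> \<beta>) (\<beta>' \<circ> \<theta>) (r ^ 1)\<close>]) (use fV in auto)
qed

text \<open>In suitable charts \<open>g\<close> satisfies \<open>g ^ k = (z ^ m) ^ k\<close>, so \<open>g\<close> is \<open>z ^ m\<close> times a \<open>k\<close>-th root of unity. This root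
of unity is constant on the connected punctured disc and is absorbed into the chart.\<close>

lemma power_model_divide:
  assumes f: "power_model_at Y Z f y (m * k)" and h: "power_model_at X Z h (g y) k"
    and N: "openin (top_of_set Y) N" "y \<in> N" and g: "continuous_on N g" "g ` N \<subseteq> X" and eq: "\<And>u. u \<in> N \<Longrightarrow> h (g u) = f u"
  shows "power_model_at Y X g y m"
proof -
  have mk: "m \<ge> 1" "k \<ge> 1" using power_model_at_domain(1)[OF f] by (auto simp: Suc_le_eq)
  obtain U1 V1 \<phi>1 \<phi>1' \<psi>1 \<psi>1' where 1: "plane_chart X (g y) U1 \<phi>1 \<phi>1'" "plane_chart Z (h (g y)) V1 \<psi>1 \<psi>1'"
    "h ` U1 \<subseteq> V1" "\<forall>u\<in>U1. \<psi>1 (h u) = \<phi>1 u ^ k"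
    by (rule power_model_atE[OF h]) (rule that, assumption+)
  have 1: "plane_chart X (g y) U1 \<phi>1 \<phi>1'" "plane_chart Z (f y) V1 \<psi>1 \<psi>1'"
    "h ` U1 \<subseteq> V1" "\<And>u. u \<in> U1 \<Longrightarrow> \<psi>1 (h u) = \<phi>1 u ^ k" using 1 eq[OF N(2)] by auto
  note d1 = 1(1)[unfolded plane_chart_def]
  have "openin (top_of_set N) (N \<inter> g -` U1)"
    using g d1 by (metis continuous_openin_preimage image_subset_iff_funcset)
  then have o: "openin (top_of_set Y) (N \<inter> g -` U1)" using N(1) openin_trans by blast
  have "y \<in> N \<inter> g -` U1" using N d1 by auto
  obtain U \<phi> \<phi>' r where U: "disc_chart Y y U \<phi> \<phi>' r" "U \<subseteq> N \<inter> g -` U1" "f ` U \<subseteq> V1" "\<forall>u\<in>U. \<psi>1 (f u) = \<phi> u ^ (m * k)"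
    using \<open>y \<in> N \<inter> g -` U1\<close> by (rule power_model_in_chart[OF f 1(2) o]) (rule that, assumption+)
  note dU = U(1)[unfolded disc_chart_def]
  have hU: "homeomorphism U (ball 0 r) \<phi> \<phi>'" using dU by blast
  have pw: "\<phi>1 (g u) ^ k = (\<phi> u ^ m) ^ k" if "u \<in> U" for u
  proof -
    have "g u \<in> U1" "h (g u) = f u" using U(2) that eq by auto
    moreover from this have "\<psi>1 (f u) = \<phi>1 (g u) ^ k" using 1(4) by force
    moreover have "\<psi>1 (f u) = \<phi> u ^ (m * k)" using U(4) that by blast
    ultimately show ?thesis by (simp add: power_mult)
  qed
  have nz: "\<phi> u \<noteq> 0" if "u \<in> U - {y}" for u
    using that dU by (metis Diff_iff homeomorphism_apply1 singletonI)
  define q where "q u = \<phi>1 (g u) / \<phi> u ^ m" for u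
  have qk: "q u ^ k = 1" if "u \<in> U - {y}" for u
    using pw[of u] nz[OF that] that by (simp add: q_def power_divide)
  have "q constant_on (U - {y})"
  proof (rule continuous_finite_range_constant)
    have "\<phi>' ` (ball 0 r - {0}) = U - {y}"
    proof -
      have "\<phi>' 0 = y" using dU by (metis homeomorphism_apply1)
      moreover have "inj_on \<phi>' (ball 0 r)" using hU by (metis homeomorphism_apply2 inj_on_inverseI)
      ultimately show ?thesis using hU dU unfolding homeomorphism_def
        by (subst inj_on_image_set_diff[where C = "ball 0 r"]) auto
    qed
    moreover have "connected (ball (0::complex) r - {0})" by (simp add: connected_punctured_ball)
    moreover have "continuous_on (ball 0 r - {0}) \<phi>'"
      using hU unfolding homeomorphism_def by (meson Diff_subset continuous_on_subset)
    ultimately show "connected (U - {y})" by (metis connected_continuous_image)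
    have "continuous_on (U - {y}) (\<lambda>u. \<phi>1 (g u))"
    proof (rule continuous_on_compose2[where g = \<phi>1 and t = U1])
      show "continuous_on U1 \<phi>1" using d1 homeomorphism_def by blast
      show "continuous_on (U - {y}) g" using g(1) U(2) by (meson Diff_subset continuous_on_subset le_infE)
    qed (use U in auto)
    moreover have "continuous_on (U - {y}) \<phi>"
      using hU unfolding homeomorphism_def by (meson Diff_subset continuous_on_subset)
    ultimately show "continuous_on (U - {y}) q"
      unfolding q_def by (intro continuous_intros) (use nz in auto)
    have "finite {z::complex. z ^ k = 1}" using mk by (intro finite_nth_roots) auto
    then show "finite (q ` (U - {y}))" by (rule finite_subset[rotated]) (use qk in auto)
  qed
  then obtain \<zeta>0 where \<zeta>0: "\<And>u. u \<in> U - {y} \<Longrightarrow> q u = \<zeta>0" unfolding constant_on_def by blast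
  obtain \<zeta> where \<zeta>: "\<And>u. u \<in> U - {y} \<Longrightarrow> q u = \<zeta>" "norm \<zeta> = 1"
  proof (cases "U - {y} = {}")
    case True then show ?thesis using that[of 1] by auto
  next
    case False
    then obtain u where u: "u \<in> U - {y}" by blast
    then have "\<zeta>0 ^ k = 1" using qk \<zeta>0 by metis
    then have "norm \<zeta>0 = 1" using mk by (metis Suc_le_eq One_nat_def norm_ge_zero norm_one norm_power power_eq_1_iff less_numeral_extra(3))
    then show ?thesis using that \<zeta>0 by blast
  qed
  have m0: "m > 0" using mk by simp
  obtain \<omega> where \<omega>: "\<omega> ^ m = \<zeta>" using exists_complex_root[of m \<zeta>] m0 by auto
  have n\<omega>: "norm \<omega> = 1"
  proof -
    have "norm \<omega> ^ m = 1 ^ m" using \<omega> \<zeta>(2) by (simp flip: norm_power)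
    then show ?thesis by (rule power_eq_imp_eq_base) (use m0 in auto)
  qed
  have hrot: "homeomorphism (ball 0 r) (ball 0 r) (\<lambda>z. \<omega> * z) (\<lambda>z. z / \<omega>)"
    using n\<omega> by (intro homeomorphismI continuous_intros) (auto simp: norm_mult norm_divide)
  have "disc_chart Y y U ((\<lambda>z. \<omega> * z) \<circ> \<phi>) (\<phi>' \<circ> (\<lambda>z. z / \<omega>)) r"
    using dU homeomorphism_compose[OF hU hrot] unfolding disc_chart_def by auto
  then show ?thesis
  proof (rule power_model_of_disc_chart[where f = g, OF _ 1(1) mk(1)])
    show "g ` U \<subseteq> U1" using U by auto
    fix u assume u: "u \<in> U"
    show "\<phi>1 (g u) = ((\<lambda>z. \<omega> * z) \<circ> \<phi>) u ^ m"
    proof (cases "u = y")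
      case True then show ?thesis using d1 dU m0 by simp
    next
      case False
      then have "q u = \<omega> ^ m" "\<phi> u \<noteq> 0" using u \<zeta>(1)[of u] nz[of u] \<omega> by auto
      then show ?thesis by (simp add: q_def field_simps power_mult_distrib)
    qed
  qed
qed

section \<open>The sphere and its power maps\<close>

definition north :: "real ^ 3" where "north = axis 3 1"

text \<open>Inverse stereographic projection from the north pole.\<close>

definition of_plane :: "complex \<Rightarrow> real ^ 3" where
  "of_plane z = (\<chi> i. if i = 1 then 2 * Re z / ((norm z)\<^sup>2 + 1)
     else if i = 2 then 2 * Im z / ((norm z)\<^sup>2 + 1) else ((norm z)\<^sup>2 - 1) / ((norm z)\<^sup>2 + 1))"

abbreviation south :: "real ^ 3" where "south \<equiv> of_plane 0"

definition to_plane :: "real ^ 3 \<Rightarrow> complex" where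
  "to_plane v = Complex (v $ 1 / (1 - v $ 3)) (v $ 2 / (1 - v $ 3))"

text \<open>In stereographic coordinates this is \<open>z \<mapsto> 1 / z\<close>; it provides the chart around the north pole.\<close>

definition half_turn :: "real ^ 3 \<Rightarrow> real ^ 3" where
  "half_turn v = (\<chi> i. if i = 1 then v $ 1 else - v $ i)"

lemma norm_eq_1_iff_coords: "norm (v :: real ^ 3) = 1 \<longleftrightarrow> (v $ 1)\<^sup>2 + (v $ 2)\<^sup>2 + (v $ 3)\<^sup>2 = (1::real)"
  by (simp add: norm_eq_1 inner_vec_def sum_3 power2_eq_square)

lemma vec3_eq_iff: "(v::real ^ 3) = w \<longleftrightarrow> v $ 1 = w $ 1 \<and> v $ 2 = w $ 2 \<and> v $ 3 = w $ 3"
  by (simp add: vec_eq_iff forall_3)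

lemma of_plane_coords [simp]:
  "of_plane z $ 1 = 2 * Re z / ((norm z)\<^sup>2 + 1)" "of_plane z $ 2 = 2 * Im z / ((norm z)\<^sup>2 + 1)"
  "of_plane z $ 3 = ((norm z)\<^sup>2 - 1) / ((norm z)\<^sup>2 + 1)"
  by (simp_all add: of_plane_def)

lemma north_coords [simp]: "north $ 1 = 0" "north $ 2 = 0" "north $ 3 = 1"
  by (simp_all add: north_def axis_def)

lemma half_turn_coords [simp]: "half_turn v $ 1 = v $ 1" "half_turn v $ 2 = - v $ 2" "half_turn v $ 3 = - v $ 3"
  by (simp_all add: half_turn_def)

lemma denom_pos: "(norm (z::complex))\<^sup>2 + 1 > 0" by (simp add: add_nonneg_pos)

lemma north_iff: "v \<in> S2 \<Longrightarrow> v = north \<longleftrightarrow> v $ 3 = 1"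
  by (auto simp: norm_eq_1_iff_coords vec3_eq_iff add_nonneg_eq_0_iff)

lemma of_plane_S2: "of_plane z \<in> S2 - {north}"
proof -
  define D where "D = (norm z)\<^sup>2 + 1"
  have D: "D > 0" "(norm z)\<^sup>2 = D - 1" using denom_pos D_def by auto
  have "D = (Re z)\<^sup>2 + (Im z)\<^sup>2 + 1" by (simp add: D_def cmod_power2)
  then have "(2 * Re z)\<^sup>2 + (2 * Im z)\<^sup>2 + (D - 2)\<^sup>2 = D\<^sup>2"
    by (simp only:) (simp add: power2_eq_square algebra_simps)
  then have "(2 * Re z / D)\<^sup>2 + (2 * Im z / D)\<^sup>2 + ((D - 2) / D)\<^sup>2 = 1"
    using D(1) by (simp add: power_divide flip: add_divide_distrib)
  then have "of_plane z \<in> S2" by (simp add: norm_eq_1_iff_coords D_def)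
  moreover have "of_plane z $ 3 \<noteq> 1" using denom_pos[of z] by (simp add: field_simps)
  ultimately show ?thesis using north_iff by blast
qed

lemma to_plane_of_plane: "to_plane (of_plane z) = z"
proof -
  define D where "D = (norm z)\<^sup>2 + 1"
  have D: "D > 0" using denom_pos D_def by auto
  have "1 - of_plane z $ 3 = 2 / D" using D by (simp add: D_def field_simps)
  then show ?thesis using D by (simp add: to_plane_def complex_eq_iff flip: D_def)
qed

lemma of_plane_to_plane:
  assumes "v \<in> S2 - {north}" shows "of_plane (to_plane v) = v"
proof -
  define t where "t = 1 - v $ 3"
  have s: "(v $ 1)\<^sup>2 + (v $ 2)\<^sup>2 = 2 * t - t\<^sup>2" and t: "t \<noteq> 0"
    using assms norm_eq_1_iff_coords[of v] north_iff[of v] by (auto simp: t_def power2_eq_square algebra_simps)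
  have n: "(norm (to_plane v))\<^sup>2 = (2 - t) / t"
  proof -
    have "(norm (to_plane v))\<^sup>2 = (2 * t - t\<^sup>2) / t\<^sup>2"
      by (simp add: to_plane_def cmod_power2 power_divide s flip: t_def add_divide_distrib)
    also have "\<dots> = (2 - t) / t" using t by (simp add: field_simps power2_eq_square)
    finally show ?thesis .
  qed
  have "(norm (to_plane v))\<^sup>2 + 1 = 2 / t" "(norm (to_plane v))\<^sup>2 - 1 = 2 * (1 - t) / t" using n t by (simp_all add: field_simps)
  then show ?thesis using t
    by (simp add: vec3_eq_iff) (simp add: to_plane_def flip: t_def, simp add: t_def)
qed

lemma homeomorphism_of_plane: "homeomorphism UNIV (S2 - {north}) of_plane to_plane"
proof (rule homeomorphismI)
  show "continuous_on UNIV of_plane"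
    unfolding of_plane_def
  proof (intro continuous_on_vec_lambda)
    fix i :: 3
    have "(norm (z::complex))\<^sup>2 + 1 \<noteq> 0" for z using denom_pos[of z] by simp
    then show "continuous_on UNIV (\<lambda>z. if i = 1 then 2 * Re z / ((norm z)\<^sup>2 + 1)
        else if i = 2 then 2 * Im z / ((norm z)\<^sup>2 + 1) else ((norm z)\<^sup>2 - 1) / ((norm z)\<^sup>2 + 1))"
      by (cases "i = 1"; cases "i = 2") (auto intro!: continuous_intros)
  qed
  show "continuous_on (S2 - {north}) to_plane"
    unfolding to_plane_def Complex_eq
    by (intro continuous_intros) (use north_iff in auto)
qed (use of_plane_S2 to_plane_of_plane of_plane_to_plane in auto)

lemma half_turn_half_turn [simp]: "half_turn (half_turn v) = v" by (simp add: vec3_eq_iff)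

lemma half_turn_S2: "v \<in> S2 \<Longrightarrow> half_turn v \<in> S2" by (simp add: norm_eq_1_iff_coords)

lemma homeomorphism_half_turn: "homeomorphism S2 S2 half_turn half_turn"
proof (rule homeomorphismI)
  have "continuous_on UNIV (\<lambda>v. \<chi> i. if i = 1 then v $ 1 else - v $ i :: real ^ 3)"
  proof (intro continuous_on_vec_lambda)
    fix i :: 3
    show "continuous_on UNIV (\<lambda>v. if i = 1 then v $ 1 else - v $ i :: real)"
      by (cases "i = 1") (auto intro!: continuous_intros)
  qed
  then show "continuous_on S2 half_turn" "continuous_on S2 half_turn"
    unfolding half_turn_def by (auto intro: continuous_on_subset)
qed (use half_turn_S2 in auto)

lemma half_turn_north: "half_turn north = south" by (simp add: vec3_eq_iff)

lemma half_turn_of_plane: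
  assumes "z \<noteq> 0" shows "half_turn (of_plane z) = of_plane (inverse z)"
proof -
  define N where "N = (norm z)\<^sup>2"
  have N: "N > 0" using assms by (simp add: N_def)
  have A: "(norm (inverse z))\<^sup>2 = 1 / N" by (simp add: norm_inverse power_inverse N_def divide_inverse)
  have R: "Re (inverse z) = Re z / N" and I: "Im (inverse z) = - Im z / N"
    by (simp_all add: N_def cmod_power2)
  have P: "1 / N + 1 = (N + 1) / N" and M: "1 / N - 1 = (1 - N) / N" using N by (simp_all add: field_simps)
  have "- ((N - 1) / (N + 1)) = (1 - N) / (N + 1)" by (simp add: minus_divide_left)
  then show ?thesis using N
    unfolding vec3_eq_iff half_turn_coords of_plane_coords N_def[symmetric] A R I P M by simp
qed

lemma S2_cases:
  assumes "v \<in> S2"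
  obtains "v = north" | z where "v = of_plane z"
  using assms of_plane_to_plane[of v] by (cases "v = north") (auto, metis)

lemma of_plane_inject [simp]: "of_plane z = of_plane w \<longleftrightarrow> z = w"
  by (metis to_plane_of_plane)

lemma of_plane_not_north [simp]: "of_plane z \<noteq> north" "north \<noteq> of_plane z"
  using of_plane_S2[of z] by auto

lemma half_turn_eq_north_iff [simp]: "half_turn v = north \<longleftrightarrow> v = south"
  by (metis half_turn_half_turn half_turn_north)

lemma half_turn_eq_south_iff [simp]: "half_turn v = south \<longleftrightarrow> v = north"
  by (metis half_turn_half_turn half_turn_north)

lemma half_turn_south [simp]: "half_turn south = north"
  by simp

lemma norm_of_plane [simp]: "norm (of_plane z) = 1"
  using of_plane_S2[of z] by simp

lemma norm_north [simp]: "norm north = 1"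
  by (simp add: norm_eq_1_iff_coords)

lemma north_S2: "north \<in> S2" by (simp add: norm_eq_1_iff_coords)

lemma openin_S2_minus_finite: "finite F \<Longrightarrow> openin (top_of_set S2) (S2 - F)"
  unfolding Diff_eq by (intro openin_open_Int open_Compl finite_imp_closed)

lemma plane_chart_of_plane:
  "plane_chart S2 (of_plane z0) (S2 - {north}) (\<lambda>v. to_plane v - z0) (\<lambda>w. of_plane (w + z0))"
proof -
  have "homeomorphism UNIV UNIV (\<lambda>z. z - z0) (\<lambda>w. w + z0)"
    by (intro homeomorphismI continuous_intros) auto
  from homeomorphism_compose[OF homeomorphism_symD[OF homeomorphism_of_plane] this]
  show ?thesis unfolding plane_chart_def o_def
    using of_plane_S2[of z0] openin_S2_minus_finite[of "{north}"] by (auto simp: to_plane_of_plane)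
qed

lemma plane_chart_north:
  "plane_chart S2 north (S2 - {south}) (to_plane \<circ> half_turn) (half_turn \<circ> of_plane)"
proof -
  have "v \<in> half_turn ` (S2 - {south})" if "v \<in> S2 - {north}" for v
    using that half_turn_S2[of v] by (intro image_eqI[of v half_turn "half_turn v"]) auto
  then have "half_turn ` (S2 - {south}) = S2 - {north}"
  proof (intro equalityI subsetI)
    show "v \<in> S2 - {north}" if "v \<in> half_turn ` (S2 - {south})" for v
      using that half_turn_S2 by auto
  qed simp
  then have "homeomorphism (S2 - {south}) (S2 - {north}) half_turn half_turn"
    by (intro homeomorphism_of_subsets[OF homeomorphism_half_turn]) auto
  from homeomorphism_compose[OF this homeomorphism_symD[OF homeomorphism_of_plane]]
  show ?thesis unfolding plane_chart_def
    using openin_S2_minus_finite[of "{south}"] north_S2 by (auto simp: half_turn_north to_plane_of_plane)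
qed

lemma plane_chart_S2:
  assumes "x \<in> S2" obtains V \<psi> \<psi>' where "plane_chart S2 x V \<psi> \<psi>'"
proof (cases rule: S2_cases[OF assms])
  case 1 then show ?thesis using that plane_chart_north by simp
next
  case (2 z) then show ?thesis using that[OF plane_chart_of_plane[of z, folded 2]] by simp
qed

text \<open>The power map of the Riemann sphere, in stereographic coordinates.\<close>

definition sphere_power :: "nat \<Rightarrow> real ^ 3 \<Rightarrow> real ^ 3" where
  "sphere_power p v = (if v = north then north else of_plane (to_plane v ^ p))"

lemma sphere_power_north [simp]: "sphere_power p north = north" by (simp add: sphere_power_def)
lemma sphere_power_of_plane [simp]: "sphere_power p (of_plane z) = of_plane (z ^ p)"
  by (simp add: sphere_power_def to_plane_of_plane)

lemma sphere_power_S2: "v \<in> S2 \<Longrightarrow> sphere_power p v \<in> S2"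
  by (simp add: sphere_power_def)

text \<open>Since \<open>z \<mapsto> z ^ p\<close> commutes with \<open>z \<mapsto> 1 / z\<close>, facts about the power map at the north pole
follow from those at the south pole.\<close>

lemma sphere_power_half_turn:
  assumes "p \<ge> 1" "v \<in> S2" shows "half_turn (sphere_power p v) = sphere_power p (half_turn v)"
  using assms(2)
proof (cases rule: S2_cases)
  case 1 then show ?thesis using assms by (simp add: half_turn_north power_0_left)
next
  case (2 z)
  show ?thesis
  proof (cases "z = 0")
    case True
    then show ?thesis using True 2 assms by (simp add: power_0_left)
  next
    case False
    then show ?thesis using 2 by (simp add: half_turn_of_plane power_inverse)
  qed
qed

lemma continuous_on_sphere_power:
  assumes p: "p \<ge> 1" shows "continuous_on S2 (sphere_power p)"
proof -
  have A: "continuous_on (S2 - {north}) (sphere_power p)"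
  proof -
    have "continuous_on (S2 - {north}) (\<lambda>v. of_plane (to_plane v ^ p))"
    proof -
      have "continuous_on (S2 - {north}) (\<lambda>v. to_plane v ^ p)"
        using homeomorphism_cont2[OF homeomorphism_of_plane] by (rule continuous_on_power)
      from continuous_on_compose2[OF homeomorphism_cont1[OF homeomorphism_of_plane] this]
      show ?thesis by simp
    qed
    then show ?thesis by (rule continuous_on_eq) (auto simp: sphere_power_def)
  qed
  have B: "continuous_on (S2 - {south}) (sphere_power p)"
  proof -
    have ca: "continuous_on S2 half_turn" by (rule homeomorphism_cont1[OF homeomorphism_half_turn])
    have "continuous_on (S2 - {south}) (\<lambda>v. half_turn (sphere_power p (half_turn v)))"
    proof (rule continuous_on_compose2[OF ca])
      show "continuous_on (S2 - {south}) (\<lambda>v. sphere_power p (half_turn v))"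
      proof (rule continuous_on_compose2[OF A])
        show "continuous_on (S2 - {south}) half_turn" using ca by (rule continuous_on_subset) auto
        show "half_turn ` (S2 - {south}) \<subseteq> S2 - {north}"
          using half_turn_S2 by auto
      qed
    qed (use sphere_power_S2 half_turn_S2 in auto)
    then show ?thesis by (rule continuous_on_eq) (use sphere_power_half_turn[OF p half_turn_S2] in auto)
  qed
  have "(S2 - {north}) \<union> (S2 - {south}) = S2" by auto
  then show ?thesis
    using continuous_on_cases_local_open[of "S2 - {north}" "S2 - {south}" "sphere_power p" "sphere_power p" "\<lambda>_. True"]
      openin_S2_minus_finite A B by simp
qed

lemma power_model_sphere_power:
  assumes p: "p \<ge> 1" and v: "v \<in> S2"
  shows "power_model_at S2 S2 (sphere_power p) v (if v = north \<or> v = south then p else 1)"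
proof -
  have z: "power_model_at S2 S2 (sphere_power p) south p"
  proof (rule power_model_atI[where f = "sphere_power p"])
    show "plane_chart S2 south (S2 - {north}) (\<lambda>v. to_plane v - 0) (\<lambda>w. of_plane (w + 0))"
      by (rule plane_chart_of_plane)
    show "plane_chart S2 (sphere_power p south) (S2 - {north}) (\<lambda>v. to_plane v - 0) (\<lambda>w. of_plane (w + 0))"
      using plane_chart_of_plane[of 0] p by (simp add: power_0_left)
  qed (use p of_plane_S2 in \<open>auto simp: sphere_power_def to_plane_of_plane\<close>)
  have n: "power_model_at S2 S2 (sphere_power p) north p"
  proof (rule power_model_atI[where f = "sphere_power p"])
    show "plane_chart S2 north (S2 - {south}) (to_plane \<circ> half_turn) (half_turn \<circ> of_plane)"
      by (rule plane_chart_north)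
    show "plane_chart S2 (sphere_power p north) (S2 - {south}) (to_plane \<circ> half_turn) (half_turn \<circ> of_plane)"
      using plane_chart_north by simp
    show "sphere_power p ` (S2 - {south}) \<subseteq> S2 - {south}"
      using p by (auto elim!: S2_cases simp del: mem_sphere_0)
    show "(to_plane \<circ> half_turn) (sphere_power p u) = (to_plane \<circ> half_turn) u ^ p" if u: "u \<in> S2 - {south}" for u
    proof -
      from u have "half_turn u \<noteq> north" by auto
      then show "(to_plane \<circ> half_turn) (sphere_power p u) = (to_plane \<circ> half_turn) u ^ p"
        using u by (simp add: sphere_power_half_turn[OF p] to_plane_of_plane sphere_power_def[of p "half_turn u"])
    qed
  qed (use p in auto)
  have o: "power_model_at S2 S2 (sphere_power p) v 1" if nz: "v \<noteq> north" "v \<noteq> south"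
  proof -
    obtain z where z: "v = of_plane z" using nz by (cases rule: S2_cases[OF v]) auto
    then have "z \<noteq> 0" using nz by auto
    then obtain \<delta> where \<delta>: "\<delta> > 0" "inj_on (\<lambda>w. w ^ p) (ball z \<delta>)"
      by (rule power_locally_injective[OF _ p])
    define N where "N = of_plane ` ball z \<delta>"
    have "openin (top_of_set (S2 - {north})) N" unfolding N_def
      by (rule homeomorphism_imp_open_map[OF homeomorphism_of_plane]) simp
    then have oN: "openin (top_of_set S2) N" using openin_S2_minus_finite[of "{north}"] openin_trans by blast
    show ?thesis
    proof (rule power_model_injective[where f = "sphere_power p" and N = N])
      show "plane_chart S2 v (S2 - {north}) (\<lambda>v. to_plane v - z) (\<lambda>w. of_plane (w + z))"
        using plane_chart_of_plane z by simp
      show "plane_chart S2 (sphere_power p v) (S2 - {north}) (\<lambda>v. to_plane v - z ^ p) (\<lambda>w. of_plane (w + z ^ p))"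
        using plane_chart_of_plane z by simp
      show "openin (top_of_set S2) N" by (fact oN)
      show "v \<in> N" using z \<delta> by (simp add: N_def)
      show "continuous_on N (sphere_power p)"
        using continuous_on_sphere_power[OF p] openin_imp_subset[OF oN] continuous_on_subset by blast
      show "inj_on (sphere_power p) N" using \<delta>(2) unfolding N_def inj_on_def by auto
      show "sphere_power p ` N \<subseteq> S2" using sphere_power_S2 openin_imp_subset[OF oN] by blast
    qed
  qed
  show ?thesis using z n o by auto
qed

section \<open>Fibres of branched covers of the sphere\<close>

abbreviation ldeg :: "(real ^ 3 \<Rightarrow> real ^ 3) \<Rightarrow> real ^ 3 \<Rightarrow> nat" where
  "ldeg \<equiv> local_degree S2 S2"

text \<open>A branched cover of the sphere up to surjectivity, which turns out to be automatic
(\<open>branched_cover_iff\<close>).\<close>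

definition locally_power :: "(real ^ 3 \<Rightarrow> real ^ 3) \<Rightarrow> bool" where
  "locally_power f \<longleftrightarrow> continuous_on S2 f \<and> f ` S2 \<subseteq> S2 \<and> (\<forall>y\<in>S2. \<exists>m. power_model_at S2 S2 f y m)"

text \<open>The degree of the cover, computed over the point \<open>x\<close>; it does not depend on \<open>x\<close> by
\<open>weight_constant\<close>.\<close>

definition weight :: "(real ^ 3 \<Rightarrow> real ^ 3) \<Rightarrow> real ^ 3 \<Rightarrow> nat" where
  "weight f x = (\<Sum>y\<in>{y \<in> S2. f y = x}. ldeg f y)"

lemma locally_power_ldeg:
  assumes "locally_power f" "y \<in> S2"
  shows "power_model_at S2 S2 f y (ldeg f y)" "ldeg f y \<ge> 1"
proof -
  obtain m where m: "power_model_at S2 S2 f y m" using assms locally_power_def by blast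
  then show *: "power_model_at S2 S2 f y (ldeg f y)" by (simp add: local_degree_eq)
  show "ldeg f y \<ge> 1" by (rule power_model_at_domain(1)[OF *])
qed

lemma locally_power_S2: "locally_power f \<Longrightarrow> y \<in> S2 \<Longrightarrow> f y \<in> S2"
  unfolding locally_power_def by blast

text \<open>The first-order content of a power model: near \<open>y\<close>, values close to but different from \<open>f y\<close> have exactly
\<open>ldeg f y\<close> preimages, all of local degree one. A bound \<open>r\<close> and a neighbourhood \<open>U\<close> are all that
remains of the charts of the source.\<close>

lemma local_sheets:
  assumes f: "locally_power f" and y: "y \<in> S2" and V: "plane_chart S2 (f y) V \<psi> \<psi>'"
    and W: "openin (top_of_set S2) W" "y \<in> W"
  obtains U r where "openin (top_of_set S2) U" "y \<in> U" "U \<subseteq> W" "f ` U \<subseteq> V" "r > 0"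
    "\<forall>c. c \<noteq> 0 \<and> norm c < r \<longrightarrow> finite {u \<in> U. \<psi> (f u) = c} \<and> card {u \<in> U. \<psi> (f u) = c} = ldeg f y"
    "\<forall>u\<in>U. u \<noteq> y \<longrightarrow> \<psi> (f u) \<noteq> 0 \<and> ldeg f u = 1"
proof -
  let ?m = "ldeg f y"
  have m: "?m \<ge> 1" by (rule locally_power_ldeg(2)[OF f y])
  obtain U \<phi> \<phi>' r where U: "disc_chart S2 y U \<phi> \<phi>' r" "U \<subseteq> W" "f ` U \<subseteq> V" and eq: "\<forall>u\<in>U. \<psi> (f u) = \<phi> u ^ ?m"
    by (rule power_model_in_chart[OF locally_power_ldeg(1)[OF f y] V W]) (rule that, assumption+)
  note dU = U(1)[unfolded disc_chart_def]
  have hU: "homeomorphism U (ball 0 r) \<phi> \<phi>'" and r: "r > 0" and oU: "openin (top_of_set S2) U" using dU by auto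
  have US: "U \<subseteq> S2" using oU openin_imp_subset by blast
  have \<phi>nz: "\<phi> u \<noteq> 0" if u: "u \<in> U" "u \<noteq> y" for u
    using homeomorphism_apply1[OF hU u(1)] homeomorphism_apply1[OF hU, of y] dU u(2) by auto
  show ?thesis
  proof (rule that[of U "r ^ ?m"])
    show "\<forall>c. c \<noteq> 0 \<and> norm c < r ^ ?m \<longrightarrow> finite {u \<in> U. \<psi> (f u) = c} \<and> card {u \<in> U. \<psi> (f u) = c} = ?m"
    proof (intro allI impI)
      fix c :: complex assume c: "c \<noteq> 0 \<and> norm c < r ^ ?m"
      have "{u \<in> U. \<psi> (f u) = c} = {u \<in> U. \<phi> u ^ ?m = c}" using eq by auto
      then show "finite {u \<in> U. \<psi> (f u) = c} \<and> card {u \<in> U. \<psi> (f u) = c} = ?m"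
        using disc_fibre[OF U(1) m] c by simp
    qed
    show "\<forall>u\<in>U. u \<noteq> y \<longrightarrow> \<psi> (f u) \<noteq> 0 \<and> ldeg f u = 1"
    proof (intro ballI impI conjI)
      fix u assume u: "u \<in> U" "u \<noteq> y"
      show "\<psi> (f u) \<noteq> 0" using eq u \<phi>nz by simp
      obtain \<delta> where \<delta>: "\<delta> > 0" "inj_on (\<lambda>w. w ^ ?m) (ball (\<phi> u) \<delta>)"
        by (rule power_locally_injective[OF \<phi>nz[OF u] m])
      define N where "N = U \<inter> \<phi> -` ball (\<phi> u) \<delta>"
      have "openin (top_of_set U) N" unfolding N_def
        by (rule continuous_openin_preimage_gen[OF homeomorphism_cont1[OF hU]]) simp
      then have oN: "openin (top_of_set S2) N" using oU openin_trans by blast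
      obtain A \<alpha> \<alpha>' where A: "plane_chart S2 u A \<alpha> \<alpha>'"
        by (rule plane_chart_S2[of u]) (use u US in auto)
      obtain B \<beta> \<beta>' where B: "plane_chart S2 (f u) B \<beta> \<beta>'"
        by (rule plane_chart_S2[OF locally_power_S2[OF f]]) (use u US in auto)
      have "power_model_at S2 S2 f u 1"
      proof (rule power_model_injective[where f = f, OF A B oN])
        show "u \<in> N" using u \<delta> by (simp add: N_def)
        have NS: "N \<subseteq> S2" using oN openin_imp_subset by blast
        show "continuous_on N f" using f NS unfolding locally_power_def by (meson continuous_on_subset)
        show "f ` N \<subseteq> S2" using f NS unfolding locally_power_def by blast
        show "inj_on f N"
        proof (rule inj_onI)
          fix a b assume a: "a \<in> N" and b: "b \<in> N" and e: "f a = f b"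
          have "\<phi> a ^ ?m = \<phi> b ^ ?m" using a b e eq unfolding N_def by (metis IntD1)
          then have "\<phi> a = \<phi> b" using a b inj_onD[OF \<delta>(2), of "\<phi> a" "\<phi> b"] unfolding N_def by auto
          then show "a = b"
            using a b unfolding N_def by (intro homeomorphism_injD[OF hU]) auto
        qed
      qed
      then show "ldeg f u = 1" by (rule local_degree_eq)
    qed
  qed (use U dU r in auto)
qed

lemma finite_fibre:
  assumes f: "locally_power f" and x: "x \<in> S2"
  shows "finite {y \<in> S2. f y = x}"
proof -
  define F where "F = {y \<in> S2. f y = x}"
  obtain V \<psi> \<psi>' where V: "plane_chart S2 x V \<psi> \<psi>'" using x by (rule plane_chart_S2)
  have cF: "closed F"
    using continuous_closed_preimage_constant[of S2 f x] f unfolding F_def locally_power_def by auto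
  have "finite (S2 \<inter> F)"
  proof (rule finite_not_islimpt_in_compact)
    fix z assume z: "z \<in> S2"
    show "\<not> z islimpt F"
    proof
      assume lim: "z islimpt F"
      then have "z \<in> F" using cF closed_limpt by blast
      then have fz: "f z = x" by (simp add: F_def)
      obtain U r where U: "openin (top_of_set S2) U" "z \<in> U" "\<forall>u\<in>U. u \<noteq> z \<longrightarrow> \<psi> (f u) \<noteq> 0 \<and> ldeg f u = 1"
        by (rule local_sheets[OF f z V[folded fz] openin_subtopology_self z[unfolded]]) (rule that)
      obtain T where T: "open T" "U = S2 \<inter> T" using U(1) openin_open by blast
      then obtain u where u: "u \<in> F" "u \<in> T" "u \<noteq> z" using lim U(2) by (metis IntD2 islimptE)
      then have "u \<in> U" "\<psi> (f u) = 0" using T V unfolding F_def plane_chart_def by auto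
      then show False using U(3) u by blast
    qed
  qed simp
  then show ?thesis by (simp add: F_def Int_def)
qed

lemma finite_separated:
  fixes F :: "'a::metric_space set"
  assumes "finite F"
  obtains e where "e > 0" "\<forall>a\<in>F. \<forall>b\<in>F. a \<noteq> b \<longrightarrow> 2 * e \<le> dist a b"
proof -
  define D where "D = (\<lambda>(a, b). dist a b) ` {(a, b). a \<in> F \<and> b \<in> F \<and> a \<noteq> b}"
  have "finite {(a, b). a \<in> F \<and> b \<in> F \<and> a \<noteq> b}"
    by (rule finite_subset[OF _ finite_cartesian_product[OF assms assms]]) auto
  then have D: "finite (insert 1 D)" by (simp add: D_def)
  have "Min (insert 1 D) > 0" using D by (subst Min_gr_iff) (auto simp: D_def)
  moreover have "Min (insert 1 D) \<le> dist a b" if "a \<in> F" "b \<in> F" "a \<noteq> b" for a b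
    using that by (intro Min_le[OF D]) (auto simp: D_def image_iff)
  ultimately show ?thesis using that[of "Min (insert 1 D) / 2"] by auto
qed

text \<open>Around the finitely many points over \<open>x\<close> choose disjoint sheets. The complement of the sheets is compact and its
image misses \<open>x\<close>, so all points over a value near \<open>x\<close> lie in the sheets, where \<open>local_sheets\<close>
counts them.\<close>

lemma fibre_neighbourhood:
  assumes f: "locally_power f" and x: "x \<in> S2"
  obtains N where "openin (top_of_set S2) N" "x \<in> N"
    "\<And>x'. x' \<in> N \<Longrightarrow> weight f x' = weight f x"
    "\<And>x' y. x' \<in> N \<Longrightarrow> x' \<noteq> x \<Longrightarrow> y \<in> S2 \<Longrightarrow> f y = x' \<Longrightarrow> ldeg f y = 1"
proof -
  define F where "F = {y \<in> S2. f y = x}"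
  have finF: "finite F" unfolding F_def by (rule finite_fibre[OF f x])
  obtain e where e: "e > 0" "\<forall>a\<in>F. \<forall>b\<in>F. a \<noteq> b \<longrightarrow> 2 * e \<le> dist a b"
    by (rule finite_separated[OF finF])
  obtain V \<psi> \<psi>' where V: "plane_chart S2 x V \<psi> \<psi>'" using x by (rule plane_chart_S2)
  note dV = V[unfolded plane_chart_def]
  have hV: "homeomorphism V UNIV \<psi> \<psi>'" using dV by blast
  define P where "P y U r \<longleftrightarrow> openin (top_of_set S2) U \<and> y \<in> U \<and> U \<subseteq> S2 \<inter> ball y e \<and> f ` U \<subseteq> V \<and> r > 0 \<and>
    (\<forall>c. c \<noteq> 0 \<and> norm c < r \<longrightarrow> finite {u \<in> U. \<psi> (f u) = c} \<and> card {u \<in> U. \<psi> (f u) = c} = ldeg f y) \<and>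
    (\<forall>u\<in>U. u \<noteq> y \<longrightarrow> \<psi> (f u) \<noteq> 0 \<and> ldeg f u = 1)" for y U r
  have "\<exists>U r. P y U r" if y: "y \<in> F" for y
  proof -
    have yS: "y \<in> S2" and fy: "f y = x" using y F_def by auto
    have W: "openin (top_of_set S2) (S2 \<inter> ball y e)" "y \<in> S2 \<inter> ball y e" using e yS by auto
    show ?thesis
      by (rule local_sheets[OF f yS V[folded fy] W], rule exI, rule exI, unfold P_def, intro conjI)
  qed
  then obtain U r where P0: "\<And>y. y \<in> F \<Longrightarrow> P y (U y) (r y)" by metis
  note P = P0[unfolded P_def]
  define K where "K = S2 - (\<Union>y\<in>F. U y)"
  have oUn: "openin (top_of_set S2) (\<Union>y\<in>F. U y)" using P by (intro openin_Union) auto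
  have "closedin (top_of_set S2) K" unfolding K_def using oUn by (simp add: closedin_diff)
  then have cK: "compact K" by (metis closedin_compact compact_sphere)
  have KS: "K \<subseteq> S2" by (auto simp: K_def)
  have "continuous_on K f" using f KS unfolding locally_power_def by (meson continuous_on_subset)
  then have cfK: "closed (f ` K)" using cK compact_continuous_image compact_imp_closed by blast
  have fKS: "f ` K \<subseteq> S2" using f KS unfolding locally_power_def by blast
  define \<rho> where "\<rho> = Min (insert 1 (r ` F))"
  have \<rho>: "\<rho> > 0" unfolding \<rho>_def using finF P by (subst Min_gr_iff) auto
  have \<rho>r: "\<rho> \<le> r y" if "y \<in> F" for y unfolding \<rho>_def using finF that by (intro Min_le) auto
  define N where "N = \<psi>' ` ball 0 \<rho> - f ` K"
  have dN: "disc_chart S2 x (\<psi>' ` ball 0 \<rho>) \<psi> \<psi>' \<rho>" by (rule plane_chart_ball[OF V \<rho>])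
  have oN: "openin (top_of_set S2) N" unfolding N_def
    using dN cfK fKS by (intro openin_diff) (auto simp: disc_chart_def intro: closed_subset)
  have xK: "x \<notin> f ` K"
  proof
    assume "x \<in> f ` K"
    then obtain y where "y \<in> K" "f y = x" by blast
    then have "y \<in> F" "y \<notin> (\<Union>y\<in>F. U y)" unfolding K_def F_def by auto
    then show False using P by blast
  qed
  have xN: "x \<in> N" using dN xK by (auto simp: N_def disc_chart_def)
  have main: "weight f x' = weight f x \<and> (\<forall>y\<in>S2. f y = x' \<longrightarrow> ldeg f y = 1)" if x': "x' \<in> N" "x' \<noteq> x" for x'
  proof -
    define c where "c = \<psi> x'"
    obtain w where w: "w \<in> ball 0 \<rho>" "x' = \<psi>' w" using x' unfolding N_def by blast
    have x'V: "x' \<in> V" using w homeomorphism_image2[OF hV] by blast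
    have cw: "c = w" unfolding c_def w(2) by (rule homeomorphism_apply2[OF hV]) simp
    have cnz: "c \<noteq> 0"
    proof
      assume "c = 0"
      then have "\<psi> x' = \<psi> x" using dV c_def by simp
      then show False using homeomorphism_injD[OF hV x'V] dV x'(2) by blast
    qed
    define G where "G y = {u \<in> U y. \<psi> (f u) = c}" for y
    have G: "finite (G y)" "card (G y) = ldeg f y" if "y \<in> F" for y
      using P[OF that] cnz w(1) cw \<rho>r[OF that] unfolding G_def by auto
    have fib: "{y \<in> S2. f y = x'} = (\<Union>y\<in>F. G y)"
    proof (intro equalityI subsetI)
      fix u assume u: "u \<in> {y \<in> S2. f y = x'}"
      then have "u \<notin> K" using x'(1) unfolding N_def by blast
      then obtain y where "y \<in> F" "u \<in> U y" using u unfolding K_def by blast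
      then show "u \<in> (\<Union>y\<in>F. G y)" using u unfolding G_def c_def by auto
    next
      fix u assume "u \<in> (\<Union>y\<in>F. G y)"
      then obtain y where y: "y \<in> F" "u \<in> U y" "\<psi> (f u) = \<psi> x'" unfolding G_def c_def by blast
      have "f u \<in> V" "u \<in> S2" using P[OF y(1)] y(2) by auto
      moreover have "f u = x'"
        by (rule homeomorphism_injD[OF hV \<open>f u \<in> V\<close> x'V y(3)])
      ultimately show "u \<in> {y \<in> S2. f y = x'}" by simp
    qed
    have one: "ldeg f u = 1" if "u \<in> S2" "f u = x'" for u
    proof -
      have "u \<in> (\<Union>y\<in>F. G y)" unfolding fib[symmetric] using that by simp
      then obtain y where y: "y \<in> F" "u \<in> G y" by blast
      then have "u \<noteq> y" using that x'(2) unfolding F_def by auto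
      then show ?thesis using P[OF y(1)] y(2) unfolding G_def by auto
    qed
    have disj: "G a \<inter> G b = {}" if "a \<in> F" "b \<in> F" "a \<noteq> b" for a b
    proof -
      have "ball a e \<inter> ball b e = {}" using e(2) that by (intro disjoint_ballI) simp
      then show ?thesis using P[OF that(1)] P[OF that(2)] unfolding G_def by blast
    qed
    have "weight f x' = (\<Sum>u\<in>(\<Union>y\<in>F. G y). ldeg f u)" unfolding weight_def fib ..
    also have "\<dots> = (\<Sum>u\<in>(\<Union>y\<in>F. G y). 1)" by (rule sum.cong) (use one fib in auto)
    also have "\<dots> = card (\<Union>y\<in>F. G y)" by simp
    also have "\<dots> = (\<Sum>y\<in>F. card (G y))" by (rule card_UN_disjoint) (use finF G disj in auto)
    also have "\<dots> = (\<Sum>y\<in>F. ldeg f y)" by (rule sum.cong) (use G in auto)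
    also have "\<dots> = weight f x" by (simp add: weight_def F_def)
    finally show ?thesis using one by blast
  qed
  show ?thesis
  proof (rule that[OF oN xN])
    show "weight f x' = weight f x" if "x' \<in> N" for x' using main that by (cases "x' = x") auto
    show "ldeg f y = 1" if "x' \<in> N" "x' \<noteq> x" "y \<in> S2" "f y = x'" for x' y using main that by blast
  qed
qed

lemma connected_S2: "connected S2"
  by (rule connected_sphere) simp

lemma weight_constant:
  assumes "locally_power f" "x \<in> S2" "x' \<in> S2"
  shows "weight f x = weight f x'"
proof -
  have "weight f constant_on S2"
  proof (rule locally_constant_imp_constant[OF connected_S2])
    fix a assume "a \<in> S2"
    then obtain N where "openin (top_of_set S2) N" "a \<in> N" "\<And>x'. x' \<in> N \<Longrightarrow> weight f x' = weight f a"
      using fibre_neighbourhood[OF assms(1)] by metis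
    then show "\<exists>T. openin (top_of_set S2) T \<and> a \<in> T \<and> (\<forall>x\<in>T. weight f x = weight f a)" by blast
  qed
  then show ?thesis using assms unfolding constant_on_def by metis
qed

lemma weight_pos_iff:
  assumes "locally_power f" "x \<in> S2"
  shows "weight f x > 0 \<longleftrightarrow> (\<exists>y\<in>S2. f y = x)"
proof
  assume "weight f x > 0"
  then have "{y \<in> S2. f y = x} \<noteq> {}" unfolding weight_def by (metis less_irrefl sum.empty)
  then show "\<exists>y\<in>S2. f y = x" by blast
next
  assume "\<exists>y\<in>S2. f y = x"
  then obtain y where y: "y \<in> S2" "f y = x" by blast
  have "ldeg f y \<le> weight f x"
    unfolding weight_def by (rule member_le_sum) (use finite_fibre[OF assms] y in auto)
  then show "weight f x > 0" using locally_power_ldeg(2)[OF assms(1) y(1)] by simp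
qed

text \<open>Preimages counted with local degrees are equally many over all points, and some point has one.\<close>

lemma locally_power_onto:
  assumes "locally_power f"
  shows "f ` S2 = S2"
proof
  show "f ` S2 \<subseteq> S2" using assms locally_power_def by blast
  have "f north \<in> S2" using assms north_S2 unfolding locally_power_def by blast
  then have "weight f (f north) > 0" using weight_pos_iff[OF assms] north_S2 by blast
  then show "S2 \<subseteq> f ` S2"
    using weight_constant[OF assms \<open>f north \<in> S2\<close>] weight_pos_iff[OF assms] by fastforce
qed

lemma branched_cover_iff: "branched_cover S2 S2 f \<longleftrightarrow> locally_power f"
  using locally_power_onto unfolding branched_cover_def locally_power_def by auto

lemma finite_branch_points:
  assumes f: "locally_power f"
  shows "finite (branch_points S2 S2 f)"
proof -
  have "finite (S2 \<inter> branch_points S2 S2 f)"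
  proof (rule finite_not_islimpt_in_compact)
    fix x assume x: "x \<in> S2"
    show "\<not> x islimpt branch_points S2 S2 f"
    proof
      assume lim: "x islimpt branch_points S2 S2 f"
      obtain N where N: "openin (top_of_set S2) N" "x \<in> N"
        "\<And>x' y. x' \<in> N \<Longrightarrow> x' \<noteq> x \<Longrightarrow> y \<in> S2 \<Longrightarrow> f y = x' \<Longrightarrow> ldeg f y = 1"
        using fibre_neighbourhood[OF f x] by metis
      obtain T where T: "open T" "N = S2 \<inter> T" using N(1) openin_open by blast
      then obtain x' where x': "x' \<in> branch_points S2 S2 f" "x' \<in> T" "x' \<noteq> x"
        using lim N(2) by (metis IntD2 islimptE)
      then show False using N(3)[of x'] T unfolding branch_points_def by auto
    qed
  qed simp
  moreover have "S2 \<inter> branch_points S2 S2 f = branch_points S2 S2 f" by (auto simp: branch_points_def)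
  ultimately show ?thesis by simp
qed

lemma infinite_S2: "infinite S2"
proof
  assume "finite S2"
  then have "finite (range of_plane)" by (rule finite_subset[rotated]) auto
  moreover have "inj of_plane" by (simp add: inj_def)
  ultimately show False using finite_imageD infinite_UNIV_char_0 by blast
qed

text \<open>Over a point that is not a branch point all local degrees are one, so the weight counts
preimages; such points exist because there are only finitely many branch points.\<close>

lemma has_cover_degree_iff:
  assumes f: "locally_power f"
  shows "has_cover_degree S2 S2 f d \<longleftrightarrow> (\<forall>x\<in>S2. weight f x = d)"
proof -
  have card: "weight f x = card {y \<in> S2. f y = x}" if "x \<in> S2 - branch_points S2 S2 f" for x
  proof -
    have "ldeg f y = 1" if "y \<in> S2" "f y = x" for y
      using locally_power_ldeg(2)[OF f that(1)] that \<open>x \<in> S2 - branch_points S2 S2 f\<close>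
      unfolding branch_points_def by force
    then have "weight f x = (\<Sum>y\<in>{y \<in> S2. f y = x}. 1)" unfolding weight_def by (intro sum.cong) auto
    then show ?thesis by simp
  qed
  have "infinite (S2 - branch_points S2 S2 f)"
    by (rule Diff_infinite_finite[OF finite_branch_points[OF f] infinite_S2])
  then obtain x0 where x0: "x0 \<in> S2 - branch_points S2 S2 f"
    using infinite_imp_nonempty by blast
  show ?thesis
  proof
    assume "has_cover_degree S2 S2 f d"
    then have "card {y \<in> S2. f y = x0} = d" using x0 unfolding has_cover_degree_def by blast
    then have "weight f x0 = d" by (simp only: card[OF x0])
    then show "\<forall>x\<in>S2. weight f x = d" using weight_constant[OF f, of x0] x0 by auto
  next
    assume "\<forall>x\<in>S2. weight f x = d"
    then show "has_cover_degree S2 S2 f d" unfolding has_cover_degree_def using card finite_fibre[OF f] by auto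
  qed
qed

lemma sum_local_degrees: "sum_mset (local_degrees S2 S2 f x) = weight f x"
  unfolding local_degrees_def weight_def by (simp add: sum_unfold_sum_mset)

section \<open>Lifting through a power map\<close>

text \<open>Rotation about the polar axis, which is multiplication by \<open>\<zeta>\<close> in stereographic coordinates. For \<open>p\<close>-th
roots of unity \<open>\<zeta>\<close> these are the deck transformations of the power map.\<close>

definition turn :: "complex \<Rightarrow> real ^ 3 \<Rightarrow> real ^ 3" where
  "turn \<zeta> v = (\<chi> i. if i = 1 then Re \<zeta> * v $ 1 - Im \<zeta> * v $ 2
     else if i = 2 then Re \<zeta> * v $ 2 + Im \<zeta> * v $ 1 else v $ 3)"

lemma turn_coords [simp]:
  "turn \<zeta> v $ 1 = Re \<zeta> * v $ 1 - Im \<zeta> * v $ 2"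
  "turn \<zeta> v $ 2 = Re \<zeta> * v $ 2 + Im \<zeta> * v $ 1"
  "turn \<zeta> v $ 3 = v $ 3"
  by (simp_all add: turn_def)

lemma continuous_on_turn: "continuous_on S (turn \<zeta>)"
proof -
  have "continuous_on S (\<lambda>v. \<chi> i. if i = 1 then Re \<zeta> * v $ 1 - Im \<zeta> * v $ 2
     else if i = 2 then Re \<zeta> * v $ 2 + Im \<zeta> * v $ 1 else v $ 3 :: real ^ 3)"
  proof (intro continuous_on_vec_lambda)
    fix i :: 3
    show "continuous_on S (\<lambda>v. if i = 1 then Re \<zeta> * v $ 1 - Im \<zeta> * v $ 2
     else if i = 2 then Re \<zeta> * v $ 2 + Im \<zeta> * v $ 1 else v $ 3)"
      by (cases "i = 1"; cases "i = 2") (auto intro!: continuous_intros)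
  qed
  then show ?thesis unfolding turn_def .
qed

lemma turn_north [simp]: "turn \<zeta> north = north" by (simp add: vec3_eq_iff)

lemma turn_of_plane:
  assumes "norm \<zeta> = 1" shows "turn \<zeta> (of_plane z) = of_plane (\<zeta> * z)"
proof -
  have n: "norm (\<zeta> * z) = norm z" using assms by (simp add: norm_mult)
  show ?thesis
    unfolding vec3_eq_iff turn_coords of_plane_coords n
    by (simp add: diff_divide_distrib add_divide_distrib algebra_simps)
qed

lemma sphere_power_eq_north_iff:
  "v \<in> S2 \<Longrightarrow> sphere_power p v = north \<longleftrightarrow> v = north"
  by (simp add: sphere_power_def)

lemma sphere_power_eq_south_iff:
  assumes "p \<ge> 1" "v \<in> S2" shows "sphere_power p v = south \<longleftrightarrow> v = south"
  using assms(2) by (cases rule: S2_cases) (use assms(1) in auto)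

text \<open>Existence of a lift over \<open>U\<close>, without naming it: the lifts over two sets are adjusted by a rotation before they are
glued, so only their existence can be carried along.\<close>

definition lifts :: "nat \<Rightarrow> (real ^ 3 \<Rightarrow> real ^ 3) \<Rightarrow> (real ^ 3) set \<Rightarrow> bool" where
  "lifts p f U \<longleftrightarrow> (\<exists>g. continuous_on U g \<and> (\<forall>u\<in>U. g u \<in> S2 \<and> sphere_power p (g u) = f u))"

lemma lifts_subset: "lifts p f U \<Longrightarrow> U' \<subseteq> U \<Longrightarrow> lifts p f U'"
  unfolding lifts_def by (meson continuous_on_subset subsetD)

lemma continuous_of_plane: "continuous_on S g \<Longrightarrow> continuous_on S (\<lambda>u. of_plane (g u))"
  by (rule continuous_on_compose2[OF homeomorphism_cont1[OF homeomorphism_of_plane]]) auto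

lemma continuous_half_turn:
  assumes "continuous_on S g" "\<And>u. u \<in> S \<Longrightarrow> g u \<in> S2" shows "continuous_on S (\<lambda>u. half_turn (g u))"
  by (rule continuous_on_compose2[OF homeomorphism_cont1[OF homeomorphism_half_turn] assms(1)])
    (intro image_subsetI assms(2))

lemma continuous_to_plane:
  assumes "continuous_on S g" "\<And>u. u \<in> S \<Longrightarrow> g u \<in> S2 - {north}" shows "continuous_on S (\<lambda>u. to_plane (g u))"
  by (rule continuous_on_compose2[OF homeomorphism_cont2[OF homeomorphism_of_plane] assms(1)])
    (intro image_subsetI assms(2))

lemma openin_of_plane: "open E \<Longrightarrow> openin (top_of_set S2) (of_plane ` E)"
  using homeomorphism_imp_open_map[OF homeomorphism_of_plane, of E] openin_S2_minus_finite[of "{north}"]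
    openin_trans by auto

text \<open>Over the poles \<open>f\<close> is \<open>z ^ (p * k)\<close> in a suitable source chart and the given target chart, and \<open>z ^ k\<close> is a lift;
elsewhere a branch of the \<open>p\<close>-th root exists near \<open>f y\<close>.\<close>

lemma local_lift:
  assumes f: "locally_power f" and p: "p \<ge> 1" and y: "y \<in> S2"
    and dv: "f y = north \<or> f y = south \<Longrightarrow> p dvd ldeg f y"
  obtains U where "openin (top_of_set S2) U" "y \<in> U" "lifts p f U"
proof -
  note pm = locally_power_ldeg(1)[OF f y]
  have SS: "openin (top_of_set S2) S2" by simp
  consider "f y = north" | "f y = south" | z where "f y = of_plane z" "z \<noteq> 0"
    using locally_power_S2[OF f y] by (cases rule: S2_cases) auto
  then show ?thesis
  proof cases
    case 1
    then obtain k where k: "ldeg f y = p * k" using dv by (auto elim: dvdE)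
    obtain U \<phi> \<phi>' r where U: "disc_chart S2 y U \<phi> \<phi>' r" "f ` U \<subseteq> S2 - {south}"
      and eq: "\<forall>u\<in>U. (to_plane \<circ> half_turn) (f u) = \<phi> u ^ ldeg f y"
      by (rule power_model_in_chart[OF pm plane_chart_north[folded 1] SS y]) (rule that, assumption+)
    have c: "continuous_on U \<phi>" using U(1) unfolding disc_chart_def homeomorphism_def by blast
    have "lifts p f U"
      unfolding lifts_def
    proof (intro exI[of _ "\<lambda>u. half_turn (of_plane (\<phi> u ^ k))"] conjI ballI)
      show "continuous_on U (\<lambda>u. half_turn (of_plane (\<phi> u ^ k)))"
        by (intro continuous_half_turn continuous_of_plane continuous_on_power c) auto
      fix u assume u: "u \<in> U"
      show "half_turn (of_plane (\<phi> u ^ k)) \<in> S2" by (intro half_turn_S2) simp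
      have fu: "f u \<in> S2 - {south}" using U u by blast
      then have "half_turn (f u) \<in> S2 - {north}" using half_turn_S2 by auto
      then have "of_plane (to_plane (half_turn (f u))) = half_turn (f u)" by (rule of_plane_to_plane)
      moreover have "to_plane (half_turn (f u)) = (\<phi> u ^ k) ^ p" using eq u k by (simp add: power_mult mult.commute)
      ultimately have "sphere_power p (of_plane (\<phi> u ^ k)) = half_turn (f u)" by simp
      then show "sphere_power p (half_turn (of_plane (\<phi> u ^ k))) = f u"
        using sphere_power_half_turn[OF p, of "of_plane (\<phi> u ^ k)"] by simp
    qed
    then show ?thesis using U(1) that unfolding disc_chart_def by blast
  next
    case 2
    then obtain k where k: "ldeg f y = p * k" using dv by (auto elim: dvdE)
    obtain U \<phi> \<phi>' r where U: "disc_chart S2 y U \<phi> \<phi>' r" "f ` U \<subseteq> S2 - {north}"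
      and eq: "\<forall>u\<in>U. to_plane (f u) - 0 = \<phi> u ^ ldeg f y"
      by (rule power_model_in_chart[OF pm plane_chart_of_plane[of 0, folded 2] SS y]) (rule that, assumption+)
    have c: "continuous_on U \<phi>" using U(1) unfolding disc_chart_def homeomorphism_def by blast
    have "lifts p f U"
      unfolding lifts_def
    proof (intro exI[of _ "\<lambda>u. of_plane (\<phi> u ^ k)"] conjI ballI)
      show "continuous_on U (\<lambda>u. of_plane (\<phi> u ^ k))"
        by (intro continuous_of_plane continuous_on_power c)
      fix u assume u: "u \<in> U"
      show "of_plane (\<phi> u ^ k) \<in> S2" by simp
      have fu: "f u \<in> S2 - {north}" using U u by blast
      then have "of_plane (to_plane (f u)) = f u" by (rule of_plane_to_plane)
      moreover have "to_plane (f u) = (\<phi> u ^ k) ^ p" using eq u k by (simp add: power_mult mult.commute)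
      ultimately show "sphere_power p (of_plane (\<phi> u ^ k)) = f u" by simp
    qed
    then show ?thesis using U(1) that unfolding disc_chart_def by blast
  next
    case (3 z)
    define E where "E = {w. Re (w / z) > 0}"
    have oE: "open E" unfolding E_def by (intro open_Collect_less continuous_intros) (use 3 in auto)
    have "z \<in> E" using 3 by (simp add: E_def)
    define U where "U = S2 \<inter> f -` (of_plane ` E)"
    have fc: "continuous_on S2 f" and fS: "f \<in> S2 \<rightarrow> S2" using f unfolding locally_power_def by auto
    have oU: "openin (top_of_set S2) U" unfolding U_def
      by (rule continuous_openin_preimage[OF fc fS openin_of_plane[OF oE]])
    have yU: "y \<in> U" using 3 y \<open>z \<in> E\<close> unfolding U_def by auto
    obtain \<zeta> where \<zeta>: "\<zeta> ^ p = z" using exists_complex_root[of p z] p by auto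
    define q where "q u = exp (Ln (to_plane (f u) / z) / of_nat p) * \<zeta>" for u
    have fU: "f u \<in> S2 - {north}" "to_plane (f u) / z \<notin> \<real>\<^sub>\<le>\<^sub>0" if "u \<in> U" for u
      using that unfolding U_def E_def by (auto simp: to_plane_of_plane complex_nonpos_Reals_iff)
    have "continuous_on U f" using fc by (rule continuous_on_subset) (simp add: U_def)
    then have ct: "continuous_on U (\<lambda>u. to_plane (f u))" using fU by (intro continuous_to_plane)
    have "lifts p f U"
      unfolding lifts_def
    proof (intro exI[of _ "\<lambda>u. of_plane (q u)"] conjI ballI)
      have "continuous_on U (\<lambda>u. Ln (to_plane (f u) / z))"
        by (intro continuous_on_Ln' continuous_on_divide ct continuous_on_const) (use fU(2) 3 in auto)
      then have "continuous_on U q" unfolding q_def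
        by (intro continuous_on_mult continuous_on_exp continuous_on_divide continuous_on_const) (use p in auto)
      then show "continuous_on U (\<lambda>u. of_plane (q u))" by (rule continuous_of_plane)
      fix u assume u: "u \<in> U"
      show "of_plane (q u) \<in> S2" by simp
      have nz: "to_plane (f u) / z \<noteq> 0" using fU(2)[OF u] by auto
      have "q u ^ p = exp (Ln (to_plane (f u) / z)) * z"
        unfolding q_def power_mult_distrib \<zeta> using p by (simp flip: exp_of_nat_mult)
      also have "\<dots> = to_plane (f u)" using nz 3 by (simp add: exp_Ln)
      finally show "sphere_power p (of_plane (q u)) = f u"
        using of_plane_to_plane[OF fU(1)[OF u]] by simp
    qed
    then show ?thesis using oU yU that by blast
  qed
qed

text \<open>Over the overlap without the finitely many points mapped to the poles, two lifts differ by a \<open>p\<close>-th root of unity, which is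
constant because this set is connected. Rotating one of the lifts makes them agree.\<close>

lemma lifts_glue:
  assumes p: "p \<ge> 1" and fin: "finite {y \<in> S2. f y = north \<or> f y = south}"
    and U: "openin (top_of_set S2) U1" "openin (top_of_set S2) U2"
    and l: "lifts p f U1" "lifts p f U2"
    and A: "U1 \<inter> U2 = of_plane ` A" "open A" "connected A" "A \<noteq> {}"
  shows "lifts p f (U1 \<union> U2)"
proof -
  obtain g1 where g1: "continuous_on U1 g1" "\<And>u. u \<in> U1 \<Longrightarrow> g1 u \<in> S2" "\<And>u. u \<in> U1 \<Longrightarrow> sphere_power p (g1 u) = f u"
    using l(1) unfolding lifts_def by blast
  obtain g2 where g2: "continuous_on U2 g2" "\<And>u. u \<in> U2 \<Longrightarrow> g2 u \<in> S2" "\<And>u. u \<in> U2 \<Longrightarrow> sphere_power p (g2 u) = f u"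
    using l(2) unfolding lifts_def by blast
  define B where "B = {y \<in> S2. f y = north \<or> f y = south}"
  \<comment> \<open>At the north pole \<open>to_plane\<close> has the default value 0; the pole is not in the image of \<open>A\<close> anyway.\<close>
  define B' where "B' = to_plane ` (B - {north})"
  have "finite B'" using fin by (simp add: B'_def B_def)
  define C where "C = of_plane ` (A - B')"
  have CU: "C \<subseteq> U1 \<inter> U2" unfolding C_def A(1) by blast
  have CB: "u \<notin> B" if uC: "u \<in> C" for u
  proof
    assume "u \<in> B"
    moreover obtain z where z: "z \<notin> B'" "u = of_plane z" using uC unfolding C_def by blast
    ultimately have "to_plane u \<in> B'" unfolding B'_def by (intro imageI) simp
    then show False using z by (simp add: to_plane_of_plane)
  qed
  have BC: "u \<in> C" if "u \<in> U1 \<inter> U2" "u \<notin> B" for u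
  proof -
    have "u \<in> of_plane ` A" using that(1) unfolding A(1) .
    then obtain z where z: "z \<in> A" "u = of_plane z" by blast
    have "z \<notin> B'"
    proof
      assume "z \<in> B'"
      then obtain b where b: "b \<in> B" "b \<noteq> north" "z = to_plane b" by (auto simp: B'_def)
      then have "u = b" using of_plane_to_plane[of b] z by (auto simp: B_def)
      then show False using b that by blast
    qed
    then show ?thesis using z unfolding C_def by blast
  qed
  have "connected (A - B')" by (rule connected_open_delete_finite) (use A \<open>finite B'\<close> in auto)
  then have cC: "connected C" unfolding C_def
    by (intro connected_continuous_image continuous_on_subset[OF homeomorphism_cont1[OF homeomorphism_of_plane]]) auto
  have "infinite A" using A(2,4) finite_imp_not_open by blast
  then have "A - B' \<noteq> {}" using Diff_infinite_finite[OF \<open>finite B'\<close>] infinite_imp_nonempty by blast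
  then obtain u0 where u0: "u0 \<in> C" unfolding C_def by blast
  have US: "U1 \<subseteq> S2" "U2 \<subseteq> S2" using U openin_imp_subset by blast+
  have nb: "f u \<noteq> north \<and> f u \<noteq> south" if "u \<in> C" for u
    using CB[OF that] CU US that unfolding B_def by blast
  have a1: "g1 u \<noteq> north \<and> g1 u \<noteq> south" if "u \<in> C" for u
    using nb[OF that] g1(2,3)[of u] CU that sphere_power_eq_north_iff[of "g1 u" p] sphere_power_eq_south_iff[OF p, of "g1 u"] by auto
  have a2: "g2 u \<noteq> north \<and> g2 u \<noteq> south" if "u \<in> C" for u
    using nb[OF that] g2(2,3)[of u] CU that sphere_power_eq_north_iff[of "g2 u" p] sphere_power_eq_south_iff[OF p, of "g2 u"] by auto
  \<comment> \<open>The ratio of the two lifts is a \<open>p\<close>-th root of unity.\<close>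
  define q where "q u = to_plane (g2 u) / to_plane (g1 u)" for u
  have nz: "to_plane (g1 u) \<noteq> 0" if "u \<in> C" for u
  proof
    assume "to_plane (g1 u) = 0"
    then have "g1 u = south" using of_plane_to_plane[of "g1 u"] a1[OF that] g1(2)[of u] CU that by auto
    then show False using a1[OF that] by simp
  qed
  have eqp: "to_plane (g2 u) ^ p = to_plane (g1 u) ^ p" if "u \<in> C" for u
  proof -
    have "sphere_power p (g2 u) = sphere_power p (g1 u)" 
    proof -
      have "u \<in> U1" "u \<in> U2" using CU that by auto
      then show ?thesis using g1(3)[of u] g2(3)[of u] by simp
    qed
    then show ?thesis using a1[OF that] a2[OF that] unfolding sphere_power_def by simp
  qed
  have qp: "q u ^ p = 1" if "u \<in> C" for u
    using eqp[OF that] nz[OF that] by (simp add: q_def power_divide)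
  have "q constant_on C"
  proof (rule continuous_finite_range_constant[OF cC])
    have "continuous_on C (\<lambda>u. to_plane (g1 u))"
      by (rule continuous_to_plane) (use g1 a1 CU in \<open>auto intro: continuous_on_subset\<close>)
    moreover have "continuous_on C (\<lambda>u. to_plane (g2 u))"
      by (rule continuous_to_plane) (use g2 a2 CU in \<open>auto intro: continuous_on_subset\<close>)
    ultimately show "continuous_on C q" unfolding q_def by (intro continuous_intros) (use nz in auto)
    have "finite {z::complex. z ^ p = 1}" using p by (intro finite_nth_roots) auto
    then show "finite (q ` C)" by (rule finite_subset[rotated]) (use qp in auto)
  qed
  then obtain \<zeta> where \<zeta>: "\<And>u. u \<in> C \<Longrightarrow> q u = \<zeta>" unfolding constant_on_def by blast
  have \<zeta>p: "\<zeta> ^ p = 1" using qp[OF u0] \<zeta>[OF u0] by simp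
  then have "norm \<zeta> ^ p = 1 ^ p" by (simp flip: norm_power)
  then have n\<zeta>: "norm \<zeta> = 1" by (rule power_eq_imp_eq_base) (use p in auto)
  then have \<zeta>0: "\<zeta> \<noteq> 0" by auto
  define g where "g u = turn (inverse \<zeta>) (g2 u)" for u
  have n\<zeta>': "norm (inverse \<zeta>) = 1" using n\<zeta> by (simp add: norm_inverse)
  have tS: "turn (inverse \<zeta>) v \<in> S2 \<and> sphere_power p (turn (inverse \<zeta>) v) = sphere_power p v" if "v \<in> S2" for v
    using that
  proof (cases rule: S2_cases)
    case 1 then show ?thesis by simp
  next
    case (2 z)
    have "(inverse \<zeta> * z) ^ p = z ^ p" using \<zeta>p by (simp add: power_mult_distrib power_inverse)
    then show ?thesis using 2 by (simp add: turn_of_plane[OF n\<zeta>'])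
  qed
  have gc: "continuous_on U2 g" unfolding g_def
    by (rule continuous_on_compose2[OF continuous_on_turn g2(1) subset_UNIV])
  have gl: "g u \<in> S2" "sphere_power p (g u) = f u" if "u \<in> U2" for u
    using tS[OF g2(2)[OF that]] g2(3)[OF that] by (auto simp: g_def)
  have agree: "g1 u = g u" if u: "u \<in> U1 \<inter> U2" for u
  proof (cases "u \<in> B")
    case True
    then consider "f u = north" | "f u = south" unfolding B_def by blast
    then show ?thesis
    proof cases
      case 1
      then show ?thesis using u g1(2,3)[of u] gl[of u] sphere_power_eq_north_iff[of "g1 u" p] sphere_power_eq_north_iff[of "g u" p] by auto
    next
      case 2
      then show ?thesis using u g1(2,3)[of u] gl[of u] sphere_power_eq_south_iff[OF p, of "g1 u"] sphere_power_eq_south_iff[OF p, of "g u"] by auto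
    qed
  next
    case False
    then have uC: "u \<in> C" using BC u by blast
    have "g2 u = of_plane (to_plane (g2 u))"
      using of_plane_to_plane[of "g2 u"] g2(2)[of u] u a2[OF uC] by simp
    then have "g u = of_plane (inverse \<zeta> * to_plane (g2 u))" unfolding g_def by (metis turn_of_plane[OF n\<zeta>'])
    moreover have "to_plane (g2 u) = \<zeta> * to_plane (g1 u)" using \<zeta>[OF uC] nz[OF uC] by (simp add: q_def field_simps)
    ultimately have "g u = of_plane (to_plane (g1 u))" using \<zeta>0 by simp
    then show ?thesis using of_plane_to_plane[of "g1 u"] g1(2)[of u] u a1[OF uC] by simp
  qed
  have o: "openin (top_of_set (U1 \<union> U2)) U1" "openin (top_of_set (U1 \<union> U2)) U2"
    using U US by (auto intro: openin_subset_trans)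
  have "continuous_on (U1 \<union> U2) (\<lambda>u. if u \<in> U1 then g1 u else g u)"
    by (rule continuous_on_cases_local_open[OF o g1(1) gc]) (use agree in auto)
  then show ?thesis unfolding lifts_def
    by (intro exI[of _ "\<lambda>u. if u \<in> U1 then g1 u else g u"]) (use g1 gl in auto)
qed

abbreviation rect :: "real \<Rightarrow> real \<Rightarrow> real \<Rightarrow> real \<Rightarrow> complex set" where
  "rect a b c d \<equiv> box (Complex a c) (Complex b d)"

lemma lifts_plane_glue:
  assumes p: "p \<ge> 1" and fin: "finite {y \<in> S2. f y = north \<or> f y = south}"
    and E: "open E1" "open E2" "lifts p f (of_plane ` E1)" "lifts p f (of_plane ` E2)"
    and c: "connected (E1 \<inter> E2)" "E1 \<inter> E2 \<noteq> {}"
  shows "lifts p f (of_plane ` (E1 \<union> E2))"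
proof -
  have "of_plane ` E1 \<inter> of_plane ` E2 = of_plane ` (E1 \<inter> E2)" by auto
  from lifts_glue[OF p fin openin_of_plane[OF E(1)] openin_of_plane[OF E(2)] E(3,4) this open_Int[OF E(1,2)] c]
  show ?thesis by (simp add: image_Un)
qed

text \<open>Local lifts are glued first over small rectangles stacked into a column, then over columns put side by side to a
large rectangle, and finally with a lift near the north pole, the overlap being an annulus. All overlaps are
open and connected, as \<open>lifts_glue\<close> requires. This replaces the appeal to simple
connectivity, which would need a covering space built from the germs of lifts. The lift is again
locally a power map by \<open>power_model_divide\<close>.\<close>

lemma lift_exists:
  assumes f: "locally_power f" and p: "p \<ge> 1"
    and dv: "\<And>y. y \<in> S2 \<Longrightarrow> f y = north \<or> f y = south \<Longrightarrow> p dvd ldeg f y"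
  obtains g where "locally_power g" "\<And>y. y \<in> S2 \<Longrightarrow> sphere_power p (g y) = f y"
proof -
  have fin: "finite {y \<in> S2. f y = north \<or> f y = south}"
  proof -
    have "{y \<in> S2. f y = north \<or> f y = south} = {y \<in> S2. f y = north} \<union> {y \<in> S2. f y = south}" by blast
    then show ?thesis using finite_fibre[OF f] north_S2 by simp
  qed
  have loc: "\<exists>U. openin (top_of_set S2) U \<and> y \<in> U \<and> lifts p f U" if "y \<in> S2" for y
    using local_lift[OF f p that dv[OF that]] by metis
  define PL where "PL E \<longleftrightarrow> lifts p f (of_plane ` E)" for E
  have PLmono: "PL E'" if "PL E" "E' \<subseteq> E" for E E'
    using that lifts_subset image_mono unfolding PL_def by metis
  have ploc: "\<exists>\<delta>>0. PL (ball z \<delta>)" for z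
  proof -
    have "of_plane z \<in> S2" by simp
    then obtain U where U: "openin (top_of_set S2) U" "of_plane z \<in> U" "lifts p f U" using loc by blast
    have "open (of_plane -` U)"
    proof -
      have "openin (top_of_set UNIV) (UNIV \<inter> of_plane -` U)"
        by (rule continuous_openin_preimage[OF homeomorphism_cont1[OF homeomorphism_of_plane] _ U(1)]) simp
      then show ?thesis by simp
    qed
    then obtain \<delta> where \<delta>: "\<delta> > 0" "ball z \<delta> \<subseteq> of_plane -` U" using U(2) open_contains_ball by (metis vimageI)
    then have "PL (ball z \<delta>)" unfolding PL_def using lifts_subset[OF U(3)] by blast
    then show ?thesis using \<delta>(1) by blast
  qed
  have glue: "PL (E1 \<union> E2)" if "open E1" "open E2" "PL E1" "PL E2" "connected (E1 \<inter> E2)" "E1 \<inter> E2 \<noteq> {}" for E1 E2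
    using lifts_plane_glue[OF p fin] that unfolding PL_def by blast
  \<comment> \<open>A lift over a neighbourhood of a vertical segment, by bisecting the segment.\<close>
  have col: "\<exists>\<epsilon>>0. PL (rect (x - \<epsilon>) (x + \<epsilon>) (y0 - \<epsilon>) (y1 + \<epsilon>))" if "y0 \<le> y1" for x y0 y1
    using that
  proof (induction rule: Bolzano)
    case (trans a b c)
    then obtain e1 e2 where e: "e1 > 0" "PL (rect (x - e1) (x + e1) (a - e1) (b + e1))"
      "e2 > 0" "PL (rect (x - e2) (x + e2) (b - e2) (c + e2))" by blast
    define e where "e = min e1 e2"
    have e0: "e > 0" "e \<le> e1" "e \<le> e2" using e by (auto simp: e_def)
    let ?E1 = "rect (x - e) (x + e) (a - e) (b + e)" and ?E2 = "rect (x - e) (x + e) (b - e) (c + e)"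
    have "PL ?E1" by (rule PLmono[OF e(2)]) (use e0 in \<open>auto simp: in_box_complex_iff\<close>)
    moreover have "PL ?E2" by (rule PLmono[OF e(4)]) (use e0 in \<open>auto simp: in_box_complex_iff\<close>)
    moreover have i: "?E1 \<inter> ?E2 = rect (x - e) (x + e) (b - e) (b + e)" using trans by (auto simp: in_box_complex_iff)
    moreover have "Complex x b \<in> rect (x - e) (x + e) (b - e) (b + e)" using e0 by (simp add: in_box_complex_iff)
    moreover have "?E1 \<union> ?E2 = rect (x - e) (x + e) (a - e) (c + e)" using trans e0 by (auto simp: in_box_complex_iff)
    ultimately show ?case using glue[of ?E1 ?E2] open_box convex_connected[OF convex_box(2)] e0(1) by (metis empty_iff)
  next
    case (local y)
    obtain \<delta> where \<delta>: "\<delta> > 0" "PL (ball (Complex x y) \<delta>)" using ploc by blast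
    show ?case
    proof (rule exI[of _ "\<delta> / 4"], intro conjI allI impI)
      fix a b assume ab: "a \<le> y \<and> y \<le> b \<and> b - a < \<delta> / 4"
      have "rect (x - \<delta> / 4) (x + \<delta> / 4) (a - \<delta> / 4) (b + \<delta> / 4) \<subseteq> ball (Complex x y) \<delta>"
      proof
        fix z assume "z \<in> rect (x - \<delta> / 4) (x + \<delta> / 4) (a - \<delta> / 4) (b + \<delta> / 4)"
        then have "\<bar>Re (Complex x y - z)\<bar> + \<bar>Im (Complex x y - z)\<bar> < \<delta>" using ab unfolding in_box_complex_iff by auto
        then show "z \<in> ball (Complex x y) \<delta>" using cmod_le[of "Complex x y - z"] by (simp add: dist_norm)
      qed
      then show "\<exists>\<epsilon>>0. PL (rect (x - \<epsilon>) (x + \<epsilon>) (a - \<epsilon>) (b + \<epsilon>))"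
        using PLmono[OF \<delta>(2)] \<delta>(1) by (intro exI[of _ "\<delta> / 4"]) auto
    qed (use \<delta> in auto)
  qed
  \<comment> \<open>A lift over a neighbourhood of a rectangle, by bisecting its base and using the columns.\<close>
  have sq: "\<exists>\<epsilon>>0. PL (rect (x0 - \<epsilon>) (x1 + \<epsilon>) (y0 - \<epsilon>) (y1 + \<epsilon>))" if yy: "y0 \<le> y1" and xx: "x0 \<le> x1" for x0 x1 y0 y1
    using xx
  proof (induction rule: Bolzano)
    case (trans a b c)
    then obtain e1 e2 where e: "e1 > 0" "PL (rect (a - e1) (b + e1) (y0 - e1) (y1 + e1))"
      "e2 > 0" "PL (rect (b - e2) (c + e2) (y0 - e2) (y1 + e2))" by blast
    define e where "e = min e1 e2"
    have e0: "e > 0" "e \<le> e1" "e \<le> e2" using e by (auto simp: e_def)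
    let ?E1 = "rect (a - e) (b + e) (y0 - e) (y1 + e)" and ?E2 = "rect (b - e) (c + e) (y0 - e) (y1 + e)"
    have "PL ?E1" by (rule PLmono[OF e(2)]) (use e0 in \<open>auto simp: in_box_complex_iff\<close>)
    moreover have "PL ?E2" by (rule PLmono[OF e(4)]) (use e0 in \<open>auto simp: in_box_complex_iff\<close>)
    moreover have i: "?E1 \<inter> ?E2 = rect (b - e) (b + e) (y0 - e) (y1 + e)" using trans by (auto simp: in_box_complex_iff)
    moreover have "Complex b y0 \<in> rect (b - e) (b + e) (y0 - e) (y1 + e)" using e0 yy by (simp add: in_box_complex_iff)
    moreover have "?E1 \<union> ?E2 = rect (a - e) (c + e) (y0 - e) (y1 + e)" using trans e0 by (auto simp: in_box_complex_iff)
    ultimately show ?case using glue[of ?E1 ?E2] open_box convex_connected[OF convex_box(2)] e0(1) by (metis empty_iff)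
  next
    case (local x)
    obtain \<delta> where \<delta>: "\<delta> > 0" "PL (rect (x - \<delta>) (x + \<delta>) (y0 - \<delta>) (y1 + \<delta>))" using col[OF yy] by blast
    show ?case
    proof (rule exI[of _ "\<delta> / 2"], intro conjI allI impI)
      fix a b assume ab: "a \<le> x \<and> x \<le> b \<and> b - a < \<delta> / 2"
      have "rect (a - \<delta> / 2) (b + \<delta> / 2) (y0 - \<delta> / 2) (y1 + \<delta> / 2) \<subseteq> rect (x - \<delta>) (x + \<delta>) (y0 - \<delta>) (y1 + \<delta>)"
        using ab \<delta>(1) by (auto simp: in_box_complex_iff)
      then show "\<exists>\<epsilon>>0. PL (rect (a - \<epsilon>) (b + \<epsilon>) (y0 - \<epsilon>) (y1 + \<epsilon>))"
        using PLmono[OF \<delta>(2)] \<delta>(1) by (intro exI[of _ "\<delta> / 2"]) auto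
    qed (use \<delta> in auto)
  qed
  have disc: "PL (ball 0 R)" for R
  proof (cases "R > 0")
    case True
    then obtain e where e: "e > 0" "PL (rect (- R - e) (R + e) (- R - e) (R + e))" using sq[of "- R" R "- R" R] by auto
    show ?thesis
    proof (rule PLmono[OF e(2)])
      show "ball 0 R \<subseteq> rect (- R - e) (R + e) (- R - e) (R + e)"
      proof
        fix z :: complex assume "z \<in> ball 0 R"
        then show "z \<in> rect (- R - e) (R + e) (- R - e) (R + e)"
          using abs_Re_le_cmod[of z] abs_Im_le_cmod[of z] e(1) by (auto simp: in_box_complex_iff)
      qed
    qed
  next
    case False
    then have "of_plane ` ball 0 R = {}" by simp
    then show ?thesis unfolding PL_def lifts_def by (simp only:) simp
  qed
  have "lifts p f S2"
  proof -
    obtain U where U: "openin (top_of_set S2) U" "north \<in> U" "lifts p f U" using loc north_S2 by blast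
    have "closedin (top_of_set S2) (S2 - U)" using U(1) by (simp add: closedin_diff)
    then have "compact (S2 - U)" by (metis closedin_compact compact_sphere)
    moreover have "continuous_on (S2 - U) to_plane"
      by (rule continuous_on_subset[OF homeomorphism_cont2[OF homeomorphism_of_plane]]) (use U(2) in auto)
    ultimately have "bounded (to_plane ` (S2 - U))" using compact_continuous_image compact_imp_bounded by blast
    then obtain \<rho> where \<rho>: "\<rho> > 0" "\<forall>z\<in>to_plane ` (S2 - U). norm z \<le> \<rho>" using bounded_pos by blast
    have far: "of_plane z \<in> U" if "norm z > \<rho>" for z
    proof (rule ccontr)
      assume "of_plane z \<notin> U"
      then have "of_plane z \<in> S2 - U" by simp
      then have "norm (to_plane (of_plane z)) \<le> \<rho>" using \<rho>(2) by blast
      then show False using that by (simp add: to_plane_of_plane)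
    qed
    \<comment> \<open>Two open sets that cover the sphere and meet in an annulus.\<close>
    define U1 where "U1 = of_plane ` ball 0 (\<rho> + 1)"
    define U2 where "U2 = U - of_plane ` cball 0 \<rho>"
    define A where "A = {z::complex. \<rho> < norm (z - 0) \<and> norm (z - 0) < \<rho> + 1}"
    have oU1: "openin (top_of_set S2) U1" unfolding U1_def by (rule openin_of_plane) simp
    have "compact (of_plane ` cball 0 \<rho>)"
      by (rule compact_continuous_image) (auto intro: continuous_on_subset[OF homeomorphism_cont1[OF homeomorphism_of_plane]])
    then have "closedin (top_of_set S2) (of_plane ` cball 0 \<rho>)" by (intro closed_subset compact_imp_closed) auto
    then have oU2: "openin (top_of_set S2) U2" unfolding U2_def by (rule openin_diff[OF U(1)])
    have l1: "lifts p f U1" using disc[of "\<rho> + 1"] by (simp add: PL_def U1_def)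
    have l2: "lifts p f U2" by (rule lifts_subset[OF U(3)]) (auto simp: U2_def)
    have int: "U1 \<inter> U2 = of_plane ` A"
    proof (intro equalityI subsetI)
      fix v assume v: "v \<in> U1 \<inter> U2"
      then obtain z where z: "z \<in> ball 0 (\<rho> + 1)" "v = of_plane z" unfolding U1_def by blast
      moreover have "z \<notin> cball 0 \<rho>" using v z(2) unfolding U2_def by blast
      ultimately have "z \<in> A" by (simp add: A_def)
      then show "v \<in> of_plane ` A" using z(2) by blast
    next
      fix v assume "v \<in> of_plane ` A"
      then obtain z where z: "z \<in> A" "v = of_plane z" by blast
      then have "z \<in> ball 0 (\<rho> + 1)" "z \<notin> cball 0 \<rho>" "v \<in> U" using far by (auto simp: A_def)
      then show "v \<in> U1 \<inter> U2" unfolding U1_def U2_def z(2) by auto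
    qed
    have oA: "open A" unfolding A_def by (intro open_Collect_conj open_Collect_less continuous_intros)
    have cA: "connected A" unfolding A_def by (rule connected_annulus) simp
    have "of_real (\<rho> + 1 / 2) \<in> A" using \<rho>(1) unfolding A_def by (simp add: norm_of_real del: of_real_add)
    then have "A \<noteq> {}" by blast
    then have "lifts p f (U1 \<union> U2)" by (rule lifts_glue[OF p fin oU1 oU2 l1 l2 int oA cA])
    moreover have "S2 \<subseteq> U1 \<union> U2"
    proof
      fix v assume "v \<in> S2"
      then show "v \<in> U1 \<union> U2"
      proof (cases rule: S2_cases)
        case 1 then show ?thesis using U(2) by (auto simp: U2_def)
      next
        case (2 z)
        then show ?thesis using far[of z] \<rho>(1) by (cases "norm z \<le> \<rho>") (auto simp: U1_def U2_def)
      qed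
    qed
    ultimately show ?thesis by (rule lifts_subset)
  qed
  then obtain g where g: "continuous_on S2 g" "\<And>u. u \<in> S2 \<Longrightarrow> g u \<in> S2" "\<And>u. u \<in> S2 \<Longrightarrow> sphere_power p (g u) = f u"
    unfolding lifts_def by blast
  have "\<exists>m. power_model_at S2 S2 g y m" if y: "y \<in> S2" for y
  proof -
    define k where "k = (if g y = north \<or> g y = south then p else 1)"
    have "k dvd ldeg f y"
    proof (cases "g y = north \<or> g y = south")
      case True
      then have "f y = north \<or> f y = south" using g(3)[OF y] p by (auto simp: power_0_left)
      then show ?thesis using dv[OF y] True by (simp add: k_def)
    qed (simp add: k_def)
    then obtain m where m: "ldeg f y = m * k" by (metis dvdE mult.commute)
    have "power_model_at S2 S2 g y m"
    proof (rule power_model_divide[where f = f and h = "sphere_power p" and k = k and N = S2])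
      show "power_model_at S2 S2 f y (m * k)" using locally_power_ldeg(1)[OF f y] m by simp
      show "power_model_at S2 S2 (sphere_power p) (g y) k"
        unfolding k_def by (rule power_model_sphere_power[OF p g(2)[OF y]])
    qed (use g y in auto)
    then show ?thesis by blast
  qed
  then have "locally_power g" unfolding locally_power_def using g by blast
  then show ?thesis using g(3) that by blast
qed

section \<open>Multisets as families of values\<close>

lemma image_mset_UN_disjoint:
  assumes "finite R" "\<And>v. v \<in> R \<Longrightarrow> finite (F v)" "\<And>v w. v \<in> R \<Longrightarrow> w \<in> R \<Longrightarrow> v \<noteq> w \<Longrightarrow> F v \<inter> F w = {}"
  shows "image_mset \<phi> (mset_set (\<Union>v\<in>R. F v)) = (\<Sum>v\<in>R. image_mset \<phi> (mset_set (F v)))"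
  using assms
proof (induction R rule: finite_induct)
  case (insert a R)
  have "F a \<inter> (\<Union>v\<in>R. F v) = {}" using insert by fastforce
  then have "mset_set (F a \<union> (\<Union>v\<in>R. F v)) = mset_set (F a) + mset_set (\<Union>v\<in>R. F v)"
    by (intro mset_set_Union) (use insert in auto)
  then show ?case using insert by simp
qed simp

text \<open>Unordered data \<open>M\<close> is spread out over distinct points of \<open>Z\<close>, so that it can be realized at these
points.\<close>

lemma mset_as_image:
  assumes "infinite Z"
  obtains X B where "finite X" "X \<subseteq> Z" "M = image_mset B (mset_set X)"
proof -
  have "\<exists>X B. finite X \<and> X \<subseteq> Z \<and> M = image_mset B (mset_set X)"
  proof (induction M)
    case empty
    show ?case by (intro exI[of _ "{}"]) auto
  next
    case (add a M)
    then obtain X B where X: "finite X" "X \<subseteq> Z" "M = image_mset B (mset_set X)" by blast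
    have "infinite (Z - X)" using Diff_infinite_finite[OF X(1) assms] .
    then obtain z where z: "z \<in> Z" "z \<notin> X" using infinite_imp_nonempty by blast
    have "image_mset (B(z := a)) (mset_set X) = image_mset B (mset_set X)"
      by (rule image_mset_cong) (use z X(1) in auto)
    then have "add_mset a M = image_mset (B(z := a)) (mset_set (insert z X))"
      using X z by (metis fun_upd_same image_mset_add_mset mset_set.insert)
    moreover have "finite (insert z X)" "insert z X \<subseteq> Z" using X z by auto
    ultimately show ?case by blast
  qed
  then show ?thesis using that by blast
qed

lemma mset_as_image_card:
  assumes "finite X" "card X = size M"
  shows "\<exists>B. image_mset B (mset_set X) = M"
  using assms
proof (induction M arbitrary: X)
  case empty
  then show ?case by simp
next
  case (add a M)
  then have "X \<noteq> {}" by auto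
  then obtain x where x: "x \<in> X" by blast
  obtain B where B: "image_mset B (mset_set (X - {x})) = M"
    using add.IH[of "X - {x}"] add.prems x by auto
  have "X = insert x (X - {x})" using x by blast
  then have "mset_set X = add_mset x (mset_set (X - {x}))" using add.prems(1) by (metis Diff_iff finite_Diff insertI1 mset_set.insert)
  moreover have "image_mset (B(x := a)) (mset_set (X - {x})) = image_mset B (mset_set (X - {x}))"
    by (rule image_mset_cong) (use add.prems in auto)
  ultimately have "image_mset (B(x := a)) (mset_set X) = add_mset a M" using B by (metis fun_upd_same image_mset_add_mset)
  then show ?case by blast
qed

lemma image_mset_eq_imp_bij:
  assumes "finite A" "finite C" "image_mset f (mset_set A) = image_mset g (mset_set C)"
  shows "\<exists>h. bij_betw h A C \<and> (\<forall>a\<in>A. f a = g (h a))"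
  using assms
proof (induction A arbitrary: C rule: finite_induct)
  case empty
  then have "C = {}" by (simp add: mset_set_empty_iff)
  then show ?case by (auto simp: bij_betw_def)
next
  case (insert a A)
  have "f a \<in># image_mset g (mset_set C)" using insert by (metis finite_insert image_eqI insertI1 finite_set_mset_mset_set set_image_mset)
  then obtain c where c: "c \<in> C" "g c = f a" using insert.prems(1) by auto
  have mC: "mset_set C = add_mset c (mset_set (C - {c}))"
    using c insert.prems(1) by (metis Diff_iff finite_Diff insertI1 insert_Diff mset_set.insert)
  have "image_mset f (mset_set A) = image_mset g (mset_set (C - {c}))"
    using insert.prems(2) insert.hyps mC c(2) by simp
  then obtain h where h: "bij_betw h A (C - {c})" "\<forall>x\<in>A. f x = g (h x)"
    using insert.IH[of "C - {c}"] insert.prems(1) by auto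
  have "bij_betw (h(a := c)) (insert a A) (insert c (C - {c}))"
    using h(1) insert.hyps(2) by (intro bij_betw_combine[of _ "{a}" "{c}", simplified] ) (auto simp: bij_betw_def inj_on_def)
  moreover have "insert c (C - {c}) = C" using c by blast
  moreover have "\<forall>x\<in>insert a A. f x = g ((h(a := c)) x)" using h(2) c(2) insert.hyps(2) by auto
  ultimately show ?case by metis
qed

section \<open>Prescribing the position of the branch points\<close>

definition plane_extension :: "(complex \<Rightarrow> complex) \<Rightarrow> real ^ 3 \<Rightarrow> real ^ 3" where
  "plane_extension F v = (if v = north then north else of_plane (F (to_plane v)))"

lemma continuous_plane_extension:
  assumes F: "continuous_on UNIV F" and far: "\<And>z. norm z > R \<Longrightarrow> F z = z"
  shows "continuous_on S2 (plane_extension F)"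
proof -
  define K where "K = of_plane ` cball 0 R"
  have A: "continuous_on (S2 - {north}) (plane_extension F)"
  proof -
    have "continuous_on (S2 - {north}) (\<lambda>v. F (to_plane v))"
      by (rule continuous_on_compose2[OF F homeomorphism_cont2[OF homeomorphism_of_plane] subset_UNIV])
    then have "continuous_on (S2 - {north}) (\<lambda>v. of_plane (F (to_plane v)))" by (rule continuous_of_plane)
    then show ?thesis by (rule continuous_on_eq) (auto simp: plane_extension_def)
  qed
  have B: "continuous_on (S2 - K) (plane_extension F)"
  proof (rule continuous_on_eq[OF continuous_on_id])
    fix v assume v: "v \<in> S2 - K"
    show "v = plane_extension F v"
    proof (cases "v = north")
      case False
      then have e: "of_plane (to_plane v) = v" using v by (intro of_plane_to_plane) auto
      have "to_plane v \<notin> cball 0 R" using v e unfolding K_def by (metis DiffD2 imageI)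
      then have "F (to_plane v) = to_plane v" using far by simp
      then show ?thesis using False e by (simp add: plane_extension_def)
    qed (simp add: plane_extension_def)
  qed
  have "compact K" unfolding K_def
    by (rule compact_continuous_image) (auto intro: continuous_on_subset[OF homeomorphism_cont1[OF homeomorphism_of_plane]])
  then have "closedin (top_of_set S2) K" by (intro closed_subset compact_imp_closed) (auto simp: K_def)
  then have oK: "openin (top_of_set S2) (S2 - K)" by (simp add: openin_diff)
  have "(S2 - {north}) \<union> (S2 - K) = S2" by (auto simp: K_def)
  then show ?thesis
    using continuous_on_cases_local_open[of "S2 - {north}" "S2 - K" "plane_extension F" "plane_extension F" "\<lambda>_. True"]
      openin_S2_minus_finite[of "{north}"] oK A B by simp
qed

lemma plane_extension_inverse:
  assumes "\<And>z. G (F z) = z" "v \<in> S2"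
  shows "plane_extension G (plane_extension F v) = v"
  using assms of_plane_to_plane[of v] by (auto simp: plane_extension_def to_plane_of_plane)

lemma plane_extension_S2: "v \<in> S2 \<Longrightarrow> plane_extension F v \<in> S2"
  by (simp add: plane_extension_def)

text \<open>In the plane finitely many points can be moved by a homeomorphism that is the identity outside a
bounded set, and such a homeomorphism extends to the sphere.\<close>

lemma homeomorphism_moving_off_north:
  assumes K: "finite K" and x: "inj_on x K" "x ` K \<subseteq> S2 - {north}" and y: "inj_on y K" "y ` K \<subseteq> S2 - {north}"
  obtains \<Theta> \<Theta>' where "homeomorphism S2 S2 \<Theta> \<Theta>'" "\<And>i. i \<in> K \<Longrightarrow> \<Theta> (x i) = y i"
proof -
  have inj: "inj_on to_plane (S2 - {north})" by (metis inj_on_inverseI of_plane_to_plane)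
  have tp: "to_plane (x i) \<noteq> to_plane (x j) \<and> to_plane (y i) \<noteq> to_plane (y j)" if "i \<in> K" "j \<in> K" "i \<noteq> j" for i j
  proof -
    have "x i \<noteq> x j" "y i \<noteq> y j" using that x(1) y(1) by (auto dest: inj_onD)
    then show ?thesis using inj_onD[OF inj, of "x i" "x j"] inj_onD[OF inj, of "y i" "y j"] that x(2) y(2) by blast
  qed
  have pw: "pairwise (\<lambda>i j. (to_plane (x i) \<noteq> to_plane (x j)) \<and> (to_plane (y i) \<noteq> to_plane (y j))) K"
    using tp unfolding pairwise_def by blast
  obtain F G where FG: "homeomorphism (UNIV :: complex set) UNIV F G" "\<forall>i\<in>K. F (to_plane (x i)) = to_plane (y i)"
    "bounded {z. \<not> (F z = z \<and> G z = z)}"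
  proof (rule homeomorphism_moving_points_exists[of "UNIV :: complex set" UNIV K "\<lambda>i. to_plane (x i)" "\<lambda>i. to_plane (y i)"])
    fix F G :: "complex \<Rightarrow> complex"
    assume 1: "homeomorphism (UNIV :: complex set) UNIV F G" "\<And>i. i \<in> K \<Longrightarrow> F (to_plane (x i)) = to_plane (y i)"
      "bounded {z. \<not> (F z = z \<and> G z = z)}"
    show thesis by (rule that[OF 1(1) _ 1(3)]) (use 1(2) in blast)
  qed (use K pw in auto)
  obtain R where R: "\<forall>z\<in>{z. \<not> (F z = z \<and> G z = z)}. norm z \<le> R" using FG(3) unfolding bounded_iff by blast
  then have far: "F z = z" "G z = z" if "norm z > R" for z using that by force+
  have GF: "G (F z) = z" "F (G z) = z" for z
    using homeomorphism_apply1[OF FG(1)] homeomorphism_apply2[OF FG(1)] by auto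
  show ?thesis
  proof (rule that[of "plane_extension F" "plane_extension G"])
    show "homeomorphism S2 S2 (plane_extension F) (plane_extension G)"
    proof (rule homeomorphismI)
      show "continuous_on S2 (plane_extension F)"
        by (rule continuous_plane_extension[OF homeomorphism_cont1[OF FG(1)] far(1)])
      show "continuous_on S2 (plane_extension G)"
        by (rule continuous_plane_extension[OF homeomorphism_cont2[OF FG(1)] far(2)])
    qed (use plane_extension_S2 plane_extension_inverse GF in \<open>blast+\<close>)
    fix i assume i: "i \<in> K"
    then have "x i \<noteq> north" "of_plane (to_plane (y i)) = y i" using x y of_plane_to_plane by blast+
    then show "plane_extension F (x i) = y i" using FG(2) i by (simp add: plane_extension_def)
  qed
qed

text \<open>A rotation brings some point away from all the given ones to the north pole.\<close>

lemma homeomorphism_moving_points_S2: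
  assumes K: "finite K" and x: "inj_on x K" "x ` K \<subseteq> S2" and y: "inj_on y K" "y ` K \<subseteq> S2"
  obtains \<Theta> \<Theta>' where "homeomorphism S2 S2 \<Theta> \<Theta>'" "\<And>i. i \<in> K \<Longrightarrow> \<Theta> (x i) = y i"
proof -
  have "infinite (S2 - (x ` K \<union> y ` K))" by (rule Diff_infinite_finite) (use K infinite_S2 in auto)
  then obtain q where q: "q \<in> S2" "q \<notin> x ` K" "q \<notin> y ` K" using infinite_imp_nonempty by blast
  then have "norm q = norm north" by simp
  then obtain T where T: "orthogonal_transformation T" "T q = north" by (rule orthogonal_transformation_exists)
  have bT: "bij T" by (rule orthogonal_transformation_bij[OF T(1)])
  have oT': "orthogonal_transformation (inv T)" by (rule orthogonal_transformation_inv[OF T(1)])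
  have nT: "norm (T v) = norm v" "norm (inv T v) = norm v" for v
    using T(1) oT' orthogonal_transformation_norm by blast+
  have iT: "inv T (T v) = v" "T (inv T v) = v" for v
    using bT by (simp_all add: bij_is_inj bij_is_surj surj_f_inv_f)
  have "continuous_on S2 T" "continuous_on S2 (inv T)"
    using T(1) oT' orthogonal_transformation_linear linear_continuous_on linear_conv_bounded_linear by blast+
  then have hT: "homeomorphism S2 S2 T (inv T)"
    by (rule homeomorphismI) (use nT iT in auto)
  have Tn: "T v \<in> S2 - {north}" if "v \<in> S2" "v \<noteq> q" for v
    using that nT(1) T(2) iT by auto (metis iT(1))
  have "\<exists>\<Phi> \<Phi>'. homeomorphism S2 S2 \<Phi> \<Phi>' \<and> (\<forall>i\<in>K. \<Phi> (T (x i)) = T (y i))"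
  proof (rule homeomorphism_moving_off_north[OF K, of "\<lambda>i. T (x i)" "\<lambda>i. T (y i)"])
    show "inj_on (\<lambda>i. T (x i)) K" "inj_on (\<lambda>i. T (y i)) K"
      using x(1) y(1) iT(1) unfolding inj_on_def by metis+
    show "(\<lambda>i. T (x i)) ` K \<subseteq> S2 - {north}" "(\<lambda>i. T (y i)) ` K \<subseteq> S2 - {north}"
      using q x(2) y(2) by (intro image_subsetI Tn; blast)+
  qed blast
  then obtain \<Phi> \<Phi>' where \<Phi>: "homeomorphism S2 S2 \<Phi> \<Phi>'" "\<forall>i\<in>K. \<Phi> (T (x i)) = T (y i)" by blast
  show ?thesis
  proof (rule that)
    show "homeomorphism S2 S2 (inv T \<circ> (\<Phi> \<circ> T)) ((inv T \<circ> \<Phi>') \<circ> T)"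
      by (rule homeomorphism_compose[OF homeomorphism_compose[OF hT \<Phi>(1)] homeomorphism_symD[OF hT]])
    show "(inv T \<circ> (\<Phi> \<circ> T)) (x i) = y i" if "i \<in> K" for i using \<Phi>(2) that iT by simp
  qed
qed

lemma power_model_homeomorphism:
  assumes h: "homeomorphism S2 S2 \<Theta> \<Theta>'" and x: "x \<in> S2"
  shows "power_model_at S2 S2 \<Theta> x 1"
proof -
  have hx: "\<Theta> x \<in> S2" using homeomorphism_image1[OF h] x by blast
  obtain A \<alpha> \<alpha>' where A: "plane_chart S2 x A \<alpha> \<alpha>'" by (rule plane_chart_S2[OF x])
  obtain B \<beta> \<beta>' where B: "plane_chart S2 (\<Theta> x) B \<beta> \<beta>'" by (rule plane_chart_S2[OF hx])
  show ?thesis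
  proof (rule power_model_injective[where f = \<Theta> and N = S2, OF A B])
    show "inj_on \<Theta> S2" by (rule inj_onI) (rule homeomorphism_injD[OF h])
  qed (use x homeomorphism_cont1[OF h] homeomorphism_image1[OF h] in auto)
qed

lemma locally_power_homeomorphism:
  assumes f: "locally_power f" and h: "homeomorphism S2 S2 \<Theta> \<Theta>'"
  shows "locally_power (\<lambda>u. \<Theta> (f u))"
    and "\<And>y. y \<in> S2 \<Longrightarrow> ldeg (\<lambda>u. \<Theta> (f u)) y = ldeg f y"
proof -
  have pm: "power_model_at S2 S2 (\<lambda>u. \<Theta> (f u)) y (ldeg f y)" if "y \<in> S2" for y
    using power_model_compose[OF locally_power_ldeg(1)[OF f that] power_model_homeomorphism[OF h locally_power_S2[OF f that]]]
    by simp
  have "continuous_on S2 (\<lambda>u. \<Theta> (f u))"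
    using f homeomorphism_cont1[OF h] unfolding locally_power_def by (intro continuous_on_compose2[of S2 \<Theta> S2 f]) auto
  moreover have "\<Theta> (f u) \<in> S2" if "u \<in> S2" for u
    using homeomorphism_image1[OF h] locally_power_S2[OF f that] by blast
  ultimately show "locally_power (\<lambda>u. \<Theta> (f u))" unfolding locally_power_def using pm by blast
  show "ldeg (\<lambda>u. \<Theta> (f u)) y = ldeg f y" if "y \<in> S2" for y
    using pm[OF that] by (rule local_degree_eq)
qed

lemma local_degrees_homeomorphism:
  assumes f: "locally_power f" and h: "homeomorphism S2 S2 \<Theta> \<Theta>'" and x: "x \<in> S2"
  shows "local_degrees S2 S2 (\<lambda>u. \<Theta> (f u)) (\<Theta> x) = local_degrees S2 S2 f x"
proof -
  have "\<Theta> (f u) = \<Theta> x \<longleftrightarrow> f u = x" if "u \<in> S2" for u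
    using homeomorphism_injD[OF h locally_power_S2[OF f that] x] by auto
  then have e: "{u \<in> S2. \<Theta> (f u) = \<Theta> x} = {u \<in> S2. f u = x}" by blast
  show ?thesis unfolding local_degrees_def e
    by (rule image_mset_cong) (use locally_power_homeomorphism(2)[OF f h] finite_fibre[OF f x] in auto)
qed

lemma branch_points_homeomorphism:
  assumes f: "locally_power f" and h: "homeomorphism S2 S2 \<Theta> \<Theta>'"
  shows "branch_points S2 S2 (\<lambda>u. \<Theta> (f u)) = \<Theta> ` branch_points S2 S2 f"
proof -
  have "branch_points S2 S2 F = F ` {y \<in> S2. ldeg F y > 1}" if "locally_power F" for F
    using locally_power_S2[OF that] unfolding branch_points_def by auto
  then have "branch_points S2 S2 (\<lambda>u. \<Theta> (f u)) = (\<lambda>u. \<Theta> (f u)) ` {y \<in> S2. ldeg (\<lambda>u. \<Theta> (f u)) y > 1}"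
    and e: "branch_points S2 S2 f = f ` {y \<in> S2. ldeg f y > 1}"
    using f locally_power_homeomorphism(1)[OF f h] by blast+
  moreover have "{y \<in> S2. ldeg (\<lambda>u. \<Theta> (f u)) y > 1} = {y \<in> S2. ldeg f y > 1}"
    using locally_power_homeomorphism(2)[OF f h] by auto
  ultimately show ?thesis by (simp only: e image_image)
qed

text \<open>In contrast to branching data, the partitions are attached to points. Some of them may be trivial, so
\<open>X\<close> may contain points that are not branch points.\<close>

definition located :: "(real ^ 3 \<Rightarrow> real ^ 3) \<Rightarrow> nat \<Rightarrow> (real ^ 3) set \<Rightarrow> (real ^ 3 \<Rightarrow> nat multiset) \<Rightarrow> bool" where
  "located f d X B \<longleftrightarrow> locally_power f \<and> (\<forall>x\<in>S2. weight f x = d) \<and> finite X \<and> X \<subseteq> S2 \<and>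
     branch_points S2 S2 f \<subseteq> X \<and> (\<forall>x\<in>X. local_degrees S2 S2 f x = B x)"

lemma set_local_degrees:
  assumes "locally_power f" "x \<in> S2"
  shows "set_mset (local_degrees S2 S2 f x) = ldeg f ` {y \<in> S2. f y = x}"
  unfolding local_degrees_def using finite_fibre[OF assms] by simp

lemma nontrivial_local_degrees:
  assumes "locally_power f" "x \<in> S2"
  shows "nontrivial (local_degrees S2 S2 f x) \<longleftrightarrow> x \<in> branch_points S2 S2 f"
  unfolding nontrivial_def branch_points_def set_local_degrees[OF assms] using assms(2) by auto

lemma filter_nontrivial_image:
  "finite X \<Longrightarrow> filter_mset nontrivial (image_mset B (mset_set X)) = image_mset B (mset_set {x \<in> X. nontrivial (B x)})"
  by (simp add: filter_mset_image_mset filter_mset_mset_set)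

lemma located_imp_data:
  assumes "located f d X B"
  shows "sphere_cover_with_data f d (image_mset B (mset_set X))"
proof -
  have f: "locally_power f" and w: "\<forall>x\<in>S2. weight f x = d" and X: "finite X" "X \<subseteq> S2"
    and bp: "branch_points S2 S2 f \<subseteq> X" and B: "\<And>x. x \<in> X \<Longrightarrow> local_degrees S2 S2 f x = B x"
    using assms unfolding located_def by auto
  have e: "{x \<in> X. nontrivial (B x)} = branch_points S2 S2 f"
  proof -
    have "nontrivial (B x) \<longleftrightarrow> x \<in> branch_points S2 S2 f" if "x \<in> X" for x
      using nontrivial_local_degrees[OF f, of x] B[OF that] X(2) that by (metis subsetD)
    then show ?thesis using bp by blast
  qed
  have "branching_data S2 S2 f = image_mset B (mset_set {x \<in> X. nontrivial (B x)})"
    unfolding branching_data_def e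
    by (rule image_mset_cong) (use finite_branch_points[OF f] bp B in auto)
  then show ?thesis
    unfolding sphere_cover_with_data_def branched_cover_iff has_cover_degree_iff[OF f] filter_nontrivial_image[OF X(1)]
    using f w by blast
qed

text \<open>Hence the local degrees over an unbranched point are determined by the degree alone.\<close>

lemma trivial_partition_eq:
  assumes "is_partition d A" "\<not> nontrivial A"
  shows "A = replicate_mset d 1"
proof -
  have "\<And>b. b \<in># A \<Longrightarrow> b = 1" using assms unfolding is_partition_def nontrivial_def by force
  then have A: "A = replicate_mset (size A) 1"
    by (intro set_mset_subset_singletonD) blast
  have "d = sum_mset A" using assms(1) is_partition_def by simp
  also have "\<dots> = size A" by (subst A) simp
  finally show ?thesis using A by simp
qed

lemma is_partition_local_degrees:
  assumes "locally_power f" "x \<in> S2" "weight f x = d"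
  shows "is_partition d (local_degrees S2 S2 f x)"
  unfolding is_partition_def set_local_degrees[OF assms(1,2)] sum_local_degrees
  using locally_power_ldeg(2)[OF assms(1)] assms(3) by auto

text \<open>Match the points of \<open>X\<close> having nontrivial partitions with the branch points of \<open>f\<close>, and the remaining
points with arbitrary unbranched points, then move the matched points to the points of \<open>X\<close> by a homeomorphism of the target.
Over an unbranched point the partition consists of ones, as a trivial partition does.\<close>

lemma data_imp_located:
  assumes c: "sphere_cover_with_data f d (image_mset B (mset_set X))"
    and X: "finite X" "X \<subseteq> S2" and part: "\<And>x. x \<in> X \<Longrightarrow> is_partition d (B x)"
  obtains f' where "located f' d X B"
proof -
  have f: "locally_power f" and hd: "has_cover_degree S2 S2 f d"
    and bd: "branching_data S2 S2 f = image_mset B (mset_set {x \<in> X. nontrivial (B x)})"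
    using c unfolding sphere_cover_with_data_def branched_cover_iff filter_nontrivial_image[OF X(1)] by auto
  have w: "\<forall>x\<in>S2. weight f x = d" using hd has_cover_degree_iff[OF f] by blast
  let ?BP = "branch_points S2 S2 f"
  have fBP: "finite ?BP" by (rule finite_branch_points[OF f])
  have BPS: "?BP \<subseteq> S2" by (auto simp: branch_points_def)
  define X1 where "X1 = {x \<in> X. nontrivial (B x)}"
  have e: "image_mset B (mset_set X1) = image_mset (local_degrees S2 S2 f) (mset_set ?BP)"
    using bd unfolding branching_data_def X1_def by simp
  have fX1: "finite X1" using X(1) by (simp add: X1_def)
  obtain h where h: "bij_betw h X1 ?BP" "\<forall>x\<in>X1. B x = local_degrees S2 S2 f (h x)"
    using image_mset_eq_imp_bij[OF fX1 fBP e] by blast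
  have "infinite (S2 - ?BP)" by (rule Diff_infinite_finite[OF fBP infinite_S2])
  then obtain Y where Y: "finite Y" "card Y = card (X - X1)" "Y \<subseteq> S2 - ?BP"
    using infinite_arbitrarily_large by blast
  obtain j where j: "bij_betw j (X - X1) Y"
    using finite_same_card_bij[of "X - X1" Y] X(1) Y by auto
  \<comment> \<open>Where the partition \<open>B x\<close> is found in the given cover.\<close>
  define \<tau> where "\<tau> x = (if x \<in> X1 then h x else j x)" for x
  have "bij_betw \<tau> (X1 \<union> (X - X1)) (?BP \<union> Y)"
  proof (rule bij_betw_combine)
    show "bij_betw \<tau> X1 ?BP" using h(1) by (subst bij_betw_cong[of _ \<tau> h]) (auto simp: \<tau>_def)
    show "bij_betw \<tau> (X - X1) Y" using j by (subst bij_betw_cong[of _ \<tau> j]) (auto simp: \<tau>_def)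
  qed (use Y(3) in auto)
  moreover have "X1 \<union> (X - X1) = X" by (auto simp: X1_def)
  ultimately have \<tau>: "inj_on \<tau> X" "\<tau> ` X = ?BP \<union> Y" unfolding bij_betw_def by auto
  have \<tau>S: "\<tau> ` X \<subseteq> S2" using \<tau>(2) Y(3) BPS by auto
  obtain \<Theta> \<Theta>' where \<Theta>: "homeomorphism S2 S2 \<Theta> \<Theta>'" "\<forall>x\<in>X. \<Theta> (\<tau> x) = x"
    by (rule homeomorphism_moving_points_S2[OF X(1) \<tau>(1) \<tau>S, of "\<lambda>x. x"]) (use X in auto)
  define F where "F u = \<Theta> (f u)" for u
  have F: "locally_power F" unfolding F_def by (rule locally_power_homeomorphism(1)[OF f \<Theta>(1)])
  have LF: "local_degrees S2 S2 F x = local_degrees S2 S2 f (\<tau> x)" if "x \<in> X" for x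
  proof -
    have "local_degrees S2 S2 F (\<Theta> (\<tau> x)) = local_degrees S2 S2 f (\<tau> x)"
      unfolding F_def by (rule local_degrees_homeomorphism[OF f \<Theta>(1)]) (use \<tau>S that in auto)
    then show ?thesis using \<Theta>(2) that by simp
  qed
  have wF: "weight F x = d" if "x \<in> S2" for x
  proof -
    have "\<Theta> north \<in> S2" using homeomorphism_image1[OF \<Theta>(1)] north_S2 by blast
    have "weight F (\<Theta> north) = weight f north"
      using local_degrees_homeomorphism[OF f \<Theta>(1) north_S2] unfolding F_def by (metis sum_local_degrees)
    then show ?thesis using weight_constant[OF F that \<open>\<Theta> north \<in> S2\<close>] w north_S2 by simp
  qed
  have "located F d X B"
    unfolding located_def
  proof (intro conjI ballI)
    show "branch_points S2 S2 F \<subseteq> X"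
    proof
      fix v assume "v \<in> branch_points S2 S2 F"
      then have "v \<in> \<Theta> ` ?BP" unfolding F_def branch_points_homeomorphism[OF f \<Theta>(1)] .
      then obtain b where b: "b \<in> ?BP" "v = \<Theta> b" by (elim imageE)
      have "b \<in> \<tau> ` X" unfolding \<tau>(2) using b(1) by (rule UnI1)
      then obtain x where "x \<in> X" "v = \<Theta> (\<tau> x)" using b(2) by (elim imageE) simp
      then show "v \<in> X" using \<Theta>(2) by simp
    qed
    fix x assume x: "x \<in> X"
    show "local_degrees S2 S2 F x = B x"
    proof (cases "x \<in> X1")
      case True
      then show ?thesis using LF[OF x] h(2) by (simp add: \<tau>_def)
    next
      case False
      then have "\<tau> x \<in> Y" using j x unfolding \<tau>_def bij_betw_def by auto
      then have t: "\<tau> x \<in> S2" "\<tau> x \<notin> ?BP" using Y(3) by auto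
      have "is_partition d (local_degrees S2 S2 f (\<tau> x))"
        by (rule is_partition_local_degrees[OF f t(1)]) (use w t(1) in blast)
      moreover have "\<not> nontrivial (local_degrees S2 S2 f (\<tau> x))" using nontrivial_local_degrees[OF f t(1)] t(2) by blast
      ultimately have "local_degrees S2 S2 f (\<tau> x) = replicate_mset d 1" by (rule trivial_partition_eq)
      moreover have "B x = replicate_mset d 1"
        by (rule trivial_partition_eq[OF part[OF x]]) (use False x in \<open>auto simp: X1_def\<close>)
      ultimately show ?thesis using LF[OF x] by simp
    qed
  qed (use F wF X in auto)
  then show ?thesis by (rule that)
qed

section \<open>Factoring out one power map\<close>

definition roots :: "nat \<Rightarrow> real ^ 3 \<Rightarrow> (real ^ 3) set" where
  "roots p x = {v \<in> S2. sphere_power p v = x}"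

lemma roots_north: "roots p north = {north}"
  using sphere_power_eq_north_iff north_S2 unfolding roots_def by auto

lemma roots_south: "p \<ge> 1 \<Longrightarrow> roots p south = {south}"
  using sphere_power_eq_south_iff[of p] unfolding roots_def by auto

lemma card_roots:
  assumes p: "p \<ge> 1" and x: "x \<in> S2" "x \<noteq> north" "x \<noteq> south"
  shows "finite (roots p x)" "card (roots p x) = p"
proof -
  obtain w where w: "x = of_plane w" using x(2) by (cases rule: S2_cases[OF x(1)]) auto
  have w0: "w \<noteq> 0" using x(3) w by auto
  have "roots p x = of_plane ` {z. z ^ p = w}"
  proof (intro equalityI subsetI)
    fix v assume "v \<in> roots p x"
    then have v: "v \<in> S2" "sphere_power p v = of_plane w" using w by (auto simp: roots_def)
    show "v \<in> of_plane ` {z. z ^ p = w}" using v(2) by (cases rule: S2_cases[OF v(1)]) auto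
  qed (use w in \<open>auto simp: roots_def\<close>)
  moreover have "inj_on of_plane {z. z ^ p = w}" by (rule inj_onI) simp
  moreover have "card {z. z ^ p = w} = p" using card_nth_roots[OF w0] p by simp
  ultimately show "card (roots p x) = p" by (simp add: card_image)
  then show "finite (roots p x)" using p by (intro card_ge_0_finite) simp
qed

text \<open>A branched cover \<open>f\<close> that factors through the power map by way of \<open>g\<close>. The equation is required only on the
sphere, so that \<open>f\<close> may be a given map or the composite itself.\<close>

locale sphere_factorization =
  fixes f g :: "real ^ 3 \<Rightarrow> real ^ 3" and p :: nat
  assumes p: "p \<ge> 1" and g: "locally_power g" and f: "locally_power f"
    and fg: "\<And>u. u \<in> S2 \<Longrightarrow> f u = sphere_power p (g u)"
begin

lemma ldeg_f:
  assumes y: "y \<in> S2"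
  shows "ldeg f y = ldeg g y * (if g y = north \<or> g y = south then p else 1)"
proof -
  have "power_model_at S2 S2 (\<lambda>u. sphere_power p (g u)) y (ldeg g y * (if g y = north \<or> g y = south then p else 1))"
    by (rule power_model_compose[OF locally_power_ldeg(1)[OF g y] power_model_sphere_power[OF p locally_power_S2[OF g y]]])
  then have "power_model_at S2 S2 f y (ldeg g y * (if g y = north \<or> g y = south then p else 1))"
    by (rule power_model_cong) (rule fg)
  then show ?thesis by (rule local_degree_eq)
qed

lemma fibre_f: "{y \<in> S2. f y = x} = (\<Union>v\<in>roots p x. {y \<in> S2. g y = v})"
  using fg locally_power_S2[OF g] unfolding roots_def by auto

lemma local_degrees_f_pole:
  assumes "x = north \<or> x = south"
  shows "local_degrees S2 S2 f x = image_mset (\<lambda>b. p * b) (local_degrees S2 S2 g x)"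
proof -
  have xS: "x \<in> S2" using assms north_S2 by auto
  have e: "{y \<in> S2. f y = x} = {y \<in> S2. g y = x}"
    unfolding fibre_f using assms roots_north roots_south[OF p] by auto
  have "image_mset (ldeg f) (mset_set {y \<in> S2. g y = x}) = image_mset (\<lambda>y. p * ldeg g y) (mset_set {y \<in> S2. g y = x})"
    by (rule image_mset_cong) (use ldeg_f assms finite_fibre[OF g xS] in auto)
  then show ?thesis unfolding local_degrees_def e by (simp add: image_mset.compositionality o_def)
qed

lemma local_degrees_f_generic:
  assumes x: "x \<in> S2" "x \<noteq> north" "x \<noteq> south"
  shows "local_degrees S2 S2 f x = \<Sum>\<^sub># (image_mset (local_degrees S2 S2 g) (mset_set (roots p x)))"
proof -
  have ns: "v \<noteq> north \<and> v \<noteq> south" if "v \<in> roots p x" for v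
    using that x p by (auto simp: roots_def power_0_left)
  have vS: "v \<in> S2" if "v \<in> roots p x" for v using that by (simp add: roots_def)
  have "local_degrees S2 S2 f x = image_mset (ldeg f) (mset_set (\<Union>v\<in>roots p x. {y \<in> S2. g y = v}))"
    unfolding local_degrees_def fibre_f ..
  also have "\<dots> = (\<Sum>v\<in>roots p x. image_mset (ldeg f) (mset_set {y \<in> S2. g y = v}))"
    by (rule image_mset_UN_disjoint) (use card_roots[OF p x] finite_fibre[OF g vS] in auto)
  also have "\<dots> = (\<Sum>v\<in>roots p x. local_degrees S2 S2 g v)"
  proof (rule sum.cong[OF refl])
    fix v assume v: "v \<in> roots p x"
    show "image_mset (ldeg f) (mset_set {y \<in> S2. g y = v}) = local_degrees S2 S2 g v"
      unfolding local_degrees_def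
      by (rule image_mset_cong) (use ldeg_f ns[OF v] finite_fibre[OF g vS[OF v]] in auto)
  qed
  finally show ?thesis by (simp add: sum_unfold_sum_mset)
qed

text \<open>The weights of \<open>f\<close> and \<open>g\<close> are constant, so they may be compared over the north pole, where every local degree
is multiplied by \<open>p\<close>.\<close>

lemma weight_f: "x \<in> S2 \<Longrightarrow> weight f x = p * weight g x"
proof -
  assume x: "x \<in> S2"
  have "weight f north = p * weight g north"
    using local_degrees_f_pole[of north] sum_mset_distrib_left[of p "\<lambda>b. b" "local_degrees S2 S2 g north"]
    by (simp flip: sum_local_degrees)
  then show ?thesis using weight_constant[OF f x north_S2] weight_constant[OF g x north_S2] by simp
qed

lemma branch_points_f:
  assumes "insert north (insert south X) \<subseteq> S2"
    and X': "X' = insert north (insert south (\<Union>x\<in>X. roots p x))"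
  shows "branch_points S2 S2 f \<subseteq> insert north (insert south X) \<longleftrightarrow> branch_points S2 S2 g \<subseteq> X'"
proof
  assume L: "branch_points S2 S2 f \<subseteq> insert north (insert south X)"
  show "branch_points S2 S2 g \<subseteq> X'"
  proof
    fix v assume "v \<in> branch_points S2 S2 g"
    then obtain y where y: "y \<in> S2" "g y = v" "ldeg g y > 1" "v \<in> S2" unfolding branch_points_def by blast
    have "ldeg f y > 1" using ldeg_f[OF y(1)] y(3) p by (auto intro: less_le_trans)
    then have "f y \<in> branch_points S2 S2 f" using y(1) locally_power_S2[OF f y(1)] unfolding branch_points_def by blast
    then have "f y \<in> insert north (insert south X)" using L by blast
    moreover have "v \<in> roots p (f y)" using fg[OF y(1)] y by (simp add: roots_def)
    ultimately show "v \<in> X'" unfolding X' using roots_north roots_south[OF p] by auto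
  qed
next
  assume R: "branch_points S2 S2 g \<subseteq> X'"
  show "branch_points S2 S2 f \<subseteq> insert north (insert south X)"
  proof
    fix v assume "v \<in> branch_points S2 S2 f"
    then obtain y where y: "y \<in> S2" "f y = v" "ldeg f y > 1" "v \<in> S2" unfolding branch_points_def by blast
    have gS: "g y \<in> S2" by (rule locally_power_S2[OF g y(1)])
    show "v \<in> insert north (insert south X)"
    proof (cases "g y = north \<or> g y = south")
      case True
      then show ?thesis using fg[OF y(1)] y(2) p by (auto simp: power_0_left)
    next
      case False
      then have "ldeg g y > 1" using ldeg_f[OF y(1)] y(3) by simp
      then have "g y \<in> branch_points S2 S2 g" using y(1) gS unfolding branch_points_def by blast
      then have "g y \<in> X'" using R by blast
      then obtain x where "x \<in> X" "g y \<in> roots p x" using False unfolding X' by blast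
      then show ?thesis using fg[OF y(1)] y(2) by (simp add: roots_def)
    qed
  qed
qed

end

text \<open>The multiset \<open>M\<close> of pairs records which
part of \<open>F\<close> comes from which member of \<open>E\<close>.\<close>

definition decomposes_each :: "nat \<Rightarrow> nat \<Rightarrow> nat multiset multiset \<Rightarrow> nat multiset multiset \<Rightarrow> bool" where
  "decomposes_each m e E F \<longleftrightarrow> (\<exists>M. image_mset fst M = E \<and> F = \<Sum>\<^sub># (image_mset snd M) \<and>
     (\<forall>q\<in>#M. decomposes_into (fst q) m e (snd q)))"

text \<open>Being the branching data of a branched cover of the sphere of degree \<open>d\<close>, up to trivial partitions.\<close>

definition realizable :: "nat \<Rightarrow> nat multiset multiset \<Rightarrow> bool" where
  "realizable d D \<longleftrightarrow> (\<exists>f. sphere_cover_with_data f d D)"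

lemma roots_disjoint: "x \<noteq> x' \<Longrightarrow> roots p x \<inter> roots p x' = {}"
  by (auto simp: roots_def)

lemma image_mset_poles_and_roots:
  assumes p: "p \<ge> 1" and X: "finite X" "X \<subseteq> S2 - {north, south}"
  shows "image_mset B (mset_set (insert north (insert south (\<Union>x\<in>X. roots p x)))) =
    {#B north, B south#} + (\<Sum>x\<in>X. image_mset B (mset_set (roots p x)))"
proof -
  have fr: "finite (roots p x)" if "x \<in> X" for x using card_roots(1)[OF p] X(2) that by blast
  have "north \<notin> (\<Union>x\<in>X. roots p x)" "south \<notin> (\<Union>x\<in>X. roots p x)"
    using X(2) p by (auto simp: roots_def power_0_left)
  moreover have "image_mset B (mset_set (\<Union>x\<in>X. roots p x)) = (\<Sum>x\<in>X. image_mset B (mset_set (roots p x)))"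
    by (rule image_mset_UN_disjoint) (use X fr roots_disjoint in auto)
  moreover have "finite (\<Union>x\<in>X. roots p x)" using X(1) fr by blast
  ultimately show ?thesis by (simp add: add_mset_commute)
qed

lemma infinite_S2_minus: "infinite (S2 - {north, south})"
  by (rule Diff_infinite_finite[OF _ infinite_S2]) simp

text \<open>Place the first two partitions over the poles. There all local degrees are divisible by \<open>p\<close>, so the cover lifts through the
power map, and the lift has the required data: over the poles the local degrees are divided by \<open>p\<close>, and
each other partition is distributed over the \<open>p\<close> roots of its branch point.\<close>

lemma realizable_power_imp:
  assumes p: "p \<ge> 1"
    and real: "realizable (p * e) ({#image_mset (\<lambda>b. p * b) C0, image_mset (\<lambda>b. p * b) C1#} + E)"
    and part: "\<forall>A\<in>#{#image_mset (\<lambda>b. p * b) C0, image_mset (\<lambda>b. p * b) C1#} + E. is_partition (p * e) A"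
  obtains F where "decomposes_each p e E F" "realizable e ({#C0, C1#} + F)"
proof -
  let ?m = "\<lambda>C. image_mset (\<lambda>b. p * b) C"
  obtain X0 B0 where X0: "finite X0" "X0 \<subseteq> S2 - {north, south}" "E = image_mset B0 (mset_set X0)"
    by (rule mset_as_image[OF infinite_S2_minus])
  define X where "X = insert north (insert south X0)"
  define B where "B = B0(north := ?m C0, south := ?m C1)"
  have nin: "north \<notin> X0" "south \<notin> X0" using X0(2) by auto
  have "image_mset B (mset_set X0) = image_mset B0 (mset_set X0)"
    by (rule image_mset_cong) (use nin X0(1) in \<open>auto simp: B_def\<close>)
  then have BX: "image_mset B (mset_set X) = {#?m C0, ?m C1#} + E"
    unfolding X_def using X0 nin by (simp add: B_def)
  have X: "finite X" "X \<subseteq> S2" unfolding X_def using X0 north_S2 by auto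
  obtain f0 where f0: "sphere_cover_with_data f0 (p * e) (image_mset B (mset_set X))"
    using real unfolding realizable_def BX by blast
  have "is_partition (p * e) (B x)" if "x \<in> X" for x
  proof -
    have "B x \<in># image_mset B (mset_set X)" using that X(1) by simp
    then show ?thesis using part unfolding BX by blast
  qed
  then obtain f where L: "located f (p * e) X B" by (rule data_imp_located[OF f0 X])
  have f: "locally_power f" and w: "\<forall>x\<in>S2. weight f x = p * e" and bp: "branch_points S2 S2 f \<subseteq> X"
    and B: "\<And>x. x \<in> X \<Longrightarrow> local_degrees S2 S2 f x = B x"
    using L unfolding located_def by auto
  have Bn: "local_degrees S2 S2 f north = ?m C0" "local_degrees S2 S2 f south = ?m C1"
    using B[of north] B[of "south"] by (auto simp: X_def B_def)
  have dv: "p dvd ldeg f y" if y: "y \<in> S2" "f y = north \<or> f y = south" for y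
  proof -
    have "ldeg f y \<in># local_degrees S2 S2 f (f y)" using y(1) by (subst set_local_degrees[OF f locally_power_S2[OF f y(1)]]) blast
    then show ?thesis using y(2) Bn by auto
  qed
  obtain g where g: "locally_power g" "\<forall>y\<in>S2. sphere_power p (g y) = f y"
    by (rule lift_exists[OF f p dv]) (use that in blast)+
  interpret sphere_factorization f g p
    by unfold_locales (use p g f in auto)
  have wg: "weight g x = e" if "x \<in> S2" for x using weight_f[OF that] w that p by simp
  have "inj (\<lambda>b. p * b)" using p by (auto simp: inj_def)
  then have inj: "C = D" if "?m C = ?m D" for C D :: "nat multiset"
    using multiset.inj_map that by (metis injD)
  have g0: "local_degrees S2 S2 g north = C0" "local_degrees S2 S2 g south = C1"
    using local_degrees_f_pole[of north] local_degrees_f_pole[of "south"] Bn inj by simp_all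
  define X' where "X' = insert north (insert south (\<Union>x\<in>X0. roots p x))"
  have fr: "finite (roots p x)" if "x \<in> X0" for x using card_roots(1)[OF p] X0(2) that by blast
  have fX': "finite X'" unfolding X'_def using X0(1) fr by auto
  have X'S: "X' \<subseteq> S2" unfolding X'_def using north_S2 by (auto simp: roots_def)
  have "branch_points S2 S2 g \<subseteq> X'" using branch_points_f[OF _ X'_def] bp X(2) unfolding X_def by blast
  then have "located g e X' (local_degrees S2 S2 g)"
    unfolding located_def using g(1) wg fX' X'S by blast
  from located_imp_data[OF this] have R: "realizable e (image_mset (local_degrees S2 S2 g) (mset_set X'))"
    unfolding realizable_def by blast
  define Q where "Q x = image_mset (local_degrees S2 S2 g) (mset_set (roots p x))" for x
  have mX': "image_mset (local_degrees S2 S2 g) (mset_set X') = {#C0, C1#} + (\<Sum>x\<in>X0. Q x)"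
    unfolding X'_def image_mset_poles_and_roots[OF p X0(1,2)] Q_def using g0 by simp
  have dec: "decomposes_into (B x) p e (Q x)" if x: "x \<in> X0" for x
  proof -
    have xS: "x \<in> S2" "x \<noteq> north" "x \<noteq> south" using X0(2) x by auto
    have "size (Q x) = p" using card_roots[OF p xS] by (simp add: Q_def)
    moreover have "\<forall>D\<in>#Q x. is_partition e D"
    proof
      fix D assume "D \<in># Q x"
      then obtain v where "v \<in> S2" "D = local_degrees S2 S2 g v"
        using card_roots(1)[OF p xS] unfolding Q_def by (auto simp: roots_def)
      then show "is_partition e D" using is_partition_local_degrees[OF g(1) _ wg] by blast
    qed
    moreover have "\<Sum>\<^sub># (Q x) = B x" using local_degrees_f_generic[OF xS] B[of x] x by (simp add: Q_def X_def)
    ultimately show ?thesis by (simp add: decomposes_into_def)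
  qed
  have "decomposes_each p e E (\<Sum>x\<in>X0. Q x)"
    unfolding decomposes_each_def
  proof (intro exI[of _ "image_mset (\<lambda>x. (B x, Q x)) (mset_set X0)"] conjI)
    show "image_mset fst (image_mset (\<lambda>x. (B x, Q x)) (mset_set X0)) = E"
      using \<open>image_mset B (mset_set X0) = image_mset B0 (mset_set X0)\<close> X0(3) by (simp add: image_mset.compositionality o_def)
  qed (use dec X0(1) in \<open>auto simp: image_mset.compositionality o_def sum_unfold_sum_mset\<close>)
  then show ?thesis using R that unfolding mX' by blast
qed

text \<open>Place \<open>C0\<close> and \<open>C1\<close> over the poles and the pieces of each other partition over the \<open>p\<close> roots of
one point; then compose with the power map.\<close>

lemma realizable_power_if:
  assumes p: "p \<ge> 1" and ref: "decomposes_each p e E F" and real: "realizable e ({#C0, C1#} + F)"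
    and C: "is_partition e C0" "is_partition e C1"
  shows "realizable (p * e) ({#image_mset (\<lambda>b. p * b) C0, image_mset (\<lambda>b. p * b) C1#} + E)"
proof -
  let ?m = "\<lambda>C. image_mset (\<lambda>b. p * b) C"
  obtain M where M: "image_mset fst M = E" "F = \<Sum>\<^sub># (image_mset snd M)" "\<forall>q\<in>#M. decomposes_into (fst q) p e (snd q)"
    using ref unfolding decomposes_each_def by blast
  obtain X0 \<beta> where X0: "finite X0" "X0 \<subseteq> S2 - {north, south}" "M = image_mset \<beta> (mset_set X0)"
    by (rule mset_as_image[OF infinite_S2_minus])
  have dec: "decomposes_into (fst (\<beta> x)) p e (snd (\<beta> x))" if "x \<in> X0" for x
    using M(3) that X0(1) unfolding X0(3) by simp
  have "\<exists>b. image_mset b (mset_set (roots p x)) = snd (\<beta> x)" if x: "x \<in> X0" for x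
  proof (rule mset_as_image_card)
    have xS: "x \<in> S2" "x \<noteq> north" "x \<noteq> south" using X0(2) x by auto
    show "finite (roots p x)" by (rule card_roots(1)[OF p xS])
    show "card (roots p x) = size (snd (\<beta> x))" using card_roots(2)[OF p xS] dec[OF x] by (simp add: decomposes_into_def)
  qed
  then obtain b where b: "\<And>x. x \<in> X0 \<Longrightarrow> image_mset (b x) (mset_set (roots p x)) = snd (\<beta> x)" by metis
  \<comment> \<open>A root \<open>v\<close> receives one of the pieces of the partition belonging to \<open>sphere_power p v\<close>.\<close>
  define B' where "B' v = (if v = north then C0 else if v = south then C1 else b (sphere_power p v) v)" for v
  define X' where "X' = insert north (insert south (\<Union>x\<in>X0. roots p x))"
  have fr: "finite (roots p x)" if "x \<in> X0" for x using card_roots(1)[OF p] X0(2) that by blast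
  have fX': "finite X'" unfolding X'_def using X0(1) fr by auto
  have X'S: "X' \<subseteq> S2" unfolding X'_def using north_S2 by (auto simp: roots_def)
  have B'r: "image_mset B' (mset_set (roots p x)) = snd (\<beta> x)" if x: "x \<in> X0" for x
  proof -
    have "image_mset B' (mset_set (roots p x)) = image_mset (b x) (mset_set (roots p x))"
    proof (rule image_mset_cong)
      fix v assume "v \<in># mset_set (roots p x)"
      then have "sphere_power p v = x" using fr[OF x] by (simp add: roots_def)
      moreover from this have "v \<noteq> north" "v \<noteq> south" using X0(2) x p by (auto simp: power_0_left)
      ultimately show "B' v = b x v" by (simp add: B'_def)
    qed
    then show ?thesis using b[OF x] by simp
  qed
  have "F = (\<Sum>x\<in>X0. image_mset B' (mset_set (roots p x)))"
  proof -
    have "(\<Sum>x\<in>X0. image_mset B' (mset_set (roots p x))) = (\<Sum>x\<in>X0. snd (\<beta> x))"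
      by (rule sum.cong) (use B'r in auto)
    then show ?thesis unfolding M(2) X0(3) by (simp add: image_mset.compositionality o_def sum_unfold_sum_mset)
  qed
  then have mX': "image_mset B' (mset_set X') = {#C0, C1#} + F"
    unfolding X'_def image_mset_poles_and_roots[OF p X0(1,2)] by (simp add: B'_def)
  obtain g0 where g0: "sphere_cover_with_data g0 e (image_mset B' (mset_set X'))"
    using real unfolding realizable_def mX' by blast
  have "is_partition e (B' v)" if v: "v \<in> X'" for v
  proof (cases "v = north \<or> v = south")
    case True then show ?thesis using C by (auto simp: B'_def)
  next
    case False
    then obtain x where x: "x \<in> X0" "v \<in> roots p x" using v unfolding X'_def by blast
    then have "B' v \<in># snd (\<beta> x)" using B'r[OF x(1)] fr[OF x(1)] by (metis finite_set_mset_mset_set image_eqI set_image_mset)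
    then show ?thesis using dec[OF x(1)] by (simp add: decomposes_into_def)
  qed
  then obtain g where L: "located g e X' B'" by (rule data_imp_located[OF g0 fX' X'S])
  have g: "locally_power g" and w: "\<forall>x\<in>S2. weight g x = e" and bp: "branch_points S2 S2 g \<subseteq> X'"
    and B': "\<And>x. x \<in> X' \<Longrightarrow> local_degrees S2 S2 g x = B' x"
    using L unfolding located_def by auto
  define f where "f u = sphere_power p (g u)" for u
  have f: "locally_power f"
    unfolding locally_power_def
  proof (intro conjI ballI)
    show "continuous_on S2 f" unfolding f_def
      using g by (intro continuous_on_compose2[OF continuous_on_sphere_power[OF p]]) (auto simp: locally_power_def)
    show "f ` S2 \<subseteq> S2" unfolding f_def by (intro image_subsetI sphere_power_S2 locally_power_S2[OF g])
    fix y assume y: "y \<in> S2"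
    show "\<exists>m. power_model_at S2 S2 f y m" unfolding f_def
      using power_model_compose[OF locally_power_ldeg(1)[OF g y] power_model_sphere_power[OF p locally_power_S2[OF g y]]] by blast
  qed
  interpret sphere_factorization f g p
    by unfold_locales (use p g f in \<open>auto simp: f_def\<close>)
  define X where "X = insert north (insert south X0)"
  define B where "B v = (if v = north then ?m C0 else if v = south then ?m C1 else fst (\<beta> v))" for v
  have nin: "north \<notin> X0" "south \<notin> X0" using X0(2) by auto
  have X: "finite X" "X \<subseteq> S2" unfolding X_def using X0 north_S2 by auto
  have Lf: "local_degrees S2 S2 f x = B x" if "x \<in> X" for x
  proof (cases "x = north \<or> x = south")
    case True
    then show ?thesis using local_degrees_f_pole[OF True] B'[of x] by (auto simp: B_def B'_def X'_def)
  next
    case False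
    then have x: "x \<in> X0" and xS: "x \<in> S2" "x \<noteq> north" "x \<noteq> south" using that X(2) unfolding X_def by auto
    have "image_mset (local_degrees S2 S2 g) (mset_set (roots p x)) = image_mset B' (mset_set (roots p x))"
      by (rule image_mset_cong) (use B' fr[OF x] x in \<open>auto simp: X'_def\<close>)
    then have "local_degrees S2 S2 f x = \<Sum>\<^sub># (snd (\<beta> x))"
      using local_degrees_f_generic[OF xS] B'r[OF x] by simp
    then show ?thesis using dec[OF x] False by (simp add: decomposes_into_def B_def)
  qed
  have "branch_points S2 S2 f \<subseteq> X" using branch_points_f[OF _ X'_def] bp X(2) unfolding X_def by blast
  then have "located f (p * e) X B"
    unfolding located_def using f weight_f w X Lf by auto
  from located_imp_data[OF this] have "realizable (p * e) (image_mset B (mset_set X))"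
    unfolding realizable_def by blast
  moreover have "image_mset B (mset_set X) = {#?m C0, ?m C1#} + E"
  proof -
    have "image_mset B (mset_set X0) = image_mset (\<lambda>x. fst (\<beta> x)) (mset_set X0)"
      by (rule image_mset_cong) (use nin X0(1) in \<open>auto simp: B_def\<close>)
    also have "\<dots> = E" using M(1) X0(3) by (simp add: image_mset.compositionality o_def)
    finally show ?thesis unfolding X_def using X0(1) nin by (simp add: B_def)
  qed
  ultimately show ?thesis by simp
qed

section \<open>Iterated decompositions of partitions\<close>

lemma decomposes_each_empty: "decomposes_each m e {#} {#}"
  unfolding decomposes_each_def by (intro exI[of _ "{#}"]) simp

lemma decomposes_each_add:
  assumes "decomposes_into A m e Q" "decomposes_each m e E F"
  shows "decomposes_each m e (add_mset A E) (Q + F)"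
proof -
  obtain M where "image_mset fst M = E" "F = \<Sum>\<^sub># (image_mset snd M)" "\<forall>q\<in>#M. decomposes_into (fst q) m e (snd q)"
    using assms(2) unfolding decomposes_each_def by blast
  then show ?thesis unfolding decomposes_each_def
    by (intro exI[of _ "add_mset (A, Q) M"]) (use assms(1) in auto)
qed

lemma decomposes_each_emptyD: "decomposes_each m e {#} F \<Longrightarrow> F = {#}"
  unfolding decomposes_each_def by auto

lemma decomposes_each_addE:
  assumes "decomposes_each m e (add_mset A E) F"
  obtains Q F' where "F = Q + F'" "decomposes_into A m e Q" "decomposes_each m e E F'"
proof -
  obtain M where M: "image_mset fst M = add_mset A E" "F = \<Sum>\<^sub># (image_mset snd M)"
    "\<forall>q\<in>#M. decomposes_into (fst q) m e (snd q)"
    using assms unfolding decomposes_each_def by blast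
  obtain q M' where q: "M = add_mset q M'" "fst q = A" "image_mset fst M' = E"
    using msed_map_invR[OF M(1)] by blast
  show ?thesis
  proof (rule that[of "snd q" "\<Sum>\<^sub># (image_mset snd M')"])
    show "decomposes_each m e E (\<Sum>\<^sub># (image_mset snd M'))"
      unfolding decomposes_each_def using M q by (intro exI[of _ M']) auto
  qed (use M q in auto)
qed

lemma decomposes_each_union:
  assumes "decomposes_each m e E F" "decomposes_each m e E' F'"
  shows "decomposes_each m e (E + E') (F + F')"
  using assms(1)
proof (induction E arbitrary: F)
  case empty
  then show ?case using assms(2) decomposes_each_emptyD by fastforce
next
  case (add A E)
  obtain Q F1 where 1: "F = Q + F1" "decomposes_into A m e Q" "decomposes_each m e E F1"
    by (rule decomposes_each_addE[OF add.prems])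
  show ?case using decomposes_each_add[OF 1(2) add.IH[OF 1(3)]] 1(1) by (simp add: add.assoc)
qed

lemma decomposes_each_unionE:
  assumes "decomposes_each m e (E + E') F"
  obtains F1 F2 where "F = F1 + F2" "decomposes_each m e E F1" "decomposes_each m e E' F2"
proof -
  have "\<exists>F1 F2. F = F1 + F2 \<and> decomposes_each m e E F1 \<and> decomposes_each m e E' F2"
    using assms
  proof (induction E arbitrary: F)
    case empty
    then show ?case using decomposes_each_empty by (intro exI[of _ "{#}"] exI[of _ F]) simp
  next
    case (add A E)
    have "decomposes_each m e (add_mset A (E + E')) F" using add.prems by simp
    then obtain Q F0 where 1: "F = Q + F0" "decomposes_into A m e Q" "decomposes_each m e (E + E') F0"
      by (rule decomposes_each_addE)
    obtain F1 F2 where 2: "F0 = F1 + F2" "decomposes_each m e E F1" "decomposes_each m e E' F2"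
      using add.IH[OF 1(3)] by blast
    have "F = (Q + F1) + F2" using 1(1) 2(1) by (simp add: add.assoc)
    then show ?case using decomposes_each_add[OF 1(2) 2(2)] 2(3) by blast
  qed
  then show ?thesis using that by blast
qed

lemma decomposes_eachD:
  assumes "decomposes_each m e E F"
  shows "size F = size E * m" "\<forall>B\<in>#F. is_partition e B" "\<Sum>\<^sub># F = \<Sum>\<^sub># E"
proof -
  have "size F = size E * m \<and> (\<forall>B\<in>#F. is_partition e B) \<and> \<Sum>\<^sub># F = \<Sum>\<^sub># E"
    using assms
  proof (induction E arbitrary: F)
    case empty
    then show ?case using decomposes_each_emptyD by fastforce
  next
    case (add A E)
    obtain Q F1 where 1: "F = Q + F1" "decomposes_into A m e Q" "decomposes_each m e E F1"
      by (rule decomposes_each_addE[OF add.prems])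
    show ?case using add.IH[OF 1(3)] 1(1,2) unfolding decomposes_into_def by auto
  qed
  then show "size F = size E * m" "\<forall>B\<in>#F. is_partition e B" "\<Sum>\<^sub># F = \<Sum>\<^sub># E" by auto
qed

lemma decomposes_into_refine:
  assumes "decomposes_into A m e' Q" "decomposes_each k e Q F"
  shows "decomposes_into A (m * k) e F"
  using assms(1) decomposes_eachD[OF assms(2)] unfolding decomposes_into_def by auto

lemma decomposes_each_refine:
  assumes "decomposes_each m e' E Q" "decomposes_each k e Q F"
  shows "decomposes_each (m * k) e E F"
  using assms
proof (induction E arbitrary: Q F)
  case empty
  then show ?case using decomposes_each_emptyD decomposes_each_empty by metis
next
  case (add A E)
  obtain Q1 Q2 where 1: "Q = Q1 + Q2" "decomposes_into A m e' Q1" "decomposes_each m e' E Q2"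
    by (rule decomposes_each_addE[OF add.prems(1)])
  obtain F1 F2 where 2: "F = F1 + F2" "decomposes_each k e Q1 F1" "decomposes_each k e Q2 F2"
    using decomposes_each_unionE[OF add.prems(2)[unfolded 1(1)]] by metis
  show ?case unfolding 2(1)
    by (rule decomposes_each_add[OF decomposes_into_refine[OF 1(2) 2(2)] add.IH[OF 1(3) 2(3)]])
qed

lemma split_mset_size:
  fixes P :: "'a multiset"
  assumes "size P = k + l"
  obtains P1 P2 where "P = P1 + P2" "size P1 = k" "size P2 = l"
proof -
  obtain xs where xs: "mset xs = P" using ex_mset by blast
  have "P = mset (take k xs) + mset (drop k xs)" using xs by (metis append_take_drop_id mset_append)
  moreover have "length xs = k + l" using assms size_mset[of xs] unfolding xs by simp
  then have "size (mset (take k xs)) = k" "size (mset (drop k xs)) = l" by simp_all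
  ultimately show ?thesis by (rule that)
qed

lemma is_partition_Sum:
  assumes "\<forall>B\<in>#P. is_partition e B"
  shows "is_partition (size P * e) (\<Sum>\<^sub># P)"
  using assms by (induction P) (auto simp: is_partition_def)

lemma decomposes_into_Sum: "\<forall>B\<in>#P. is_partition e B \<Longrightarrow> decomposes_into (\<Sum>\<^sub># P) (size P) e P"
  by (simp add: decomposes_into_def)

text \<open>Group the \<open>m * k\<close> pieces into \<open>m\<close> blocks of \<open>k\<close>; the blocks sum up to the members of \<open>Q\<close>.\<close>

lemma decomposes_into_split:
  assumes "decomposes_into A (m * k) e P"
  shows "\<exists>Q. decomposes_into A m (k * e) Q \<and> decomposes_each k e Q P"
  using assms
proof (induction m arbitrary: A P)
  case 0
  then show ?case using decomposes_each_empty by (intro exI[of _ "{#}"]) (auto simp: decomposes_into_def)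
next
  case (Suc m)
  have P: "size P = k + m * k" "\<forall>B\<in>#P. is_partition e B" "\<Sum>\<^sub># P = A" using Suc.prems by (auto simp: decomposes_into_def)
  obtain P1 P2 where 1: "P = P1 + P2" "size P1 = k" "size P2 = m * k" by (rule split_mset_size[OF P(1)])
  have "decomposes_into (\<Sum>\<^sub># P2) (m * k) e P2" using P 1 by (simp add: decomposes_into_def)
  then obtain Q where Q: "decomposes_into (\<Sum>\<^sub># P2) m (k * e) Q" "decomposes_each k e Q P2" using Suc.IH by blast
  have d: "decomposes_into (\<Sum>\<^sub># P1) k e P1" using P 1 by (simp add: decomposes_into_def)
  have "is_partition (k * e) (\<Sum>\<^sub># P1)" using is_partition_Sum[of P1 e] P 1 by simp
  then have "decomposes_into A (Suc m) (k * e) (add_mset (\<Sum>\<^sub># P1) Q)"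
    using Q(1) P(3) 1(1) by (auto simp: decomposes_into_def)
  moreover have "decomposes_each k e (add_mset (\<Sum>\<^sub># P1) Q) P"
    unfolding 1(1) by (rule decomposes_each_add[OF d Q(2)])
  ultimately show ?case by blast
qed

lemma decomposes_each_split:
  assumes "decomposes_each (m * k) e E P"
  shows "\<exists>Q. decomposes_each m (k * e) E Q \<and> decomposes_each k e Q P"
  using assms
proof (induction E arbitrary: P)
  case empty
  then show ?case using decomposes_each_emptyD decomposes_each_empty by metis
next
  case (add A E)
  obtain P1 P2 where 1: "P = P1 + P2" "decomposes_into A (m * k) e P1" "decomposes_each (m * k) e E P2"
    by (rule decomposes_each_addE[OF add.prems])
  obtain Q1 where Q1: "decomposes_into A m (k * e) Q1" "decomposes_each k e Q1 P1" using decomposes_into_split[OF 1(2)] by blast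
  obtain Q2 where Q2: "decomposes_each m (k * e) E Q2" "decomposes_each k e Q2 P2" using add.IH[OF 1(3)] by blast
  show ?case unfolding 1(1)
    using decomposes_each_add[OF Q1(1) Q2(1)] decomposes_each_union[OF Q1(2) Q2(2)] by blast
qed

lemma decomposes_each_indexed:
  assumes "finite I"
  shows "decomposes_each m e (image_mset A (mset_set I)) F \<longleftrightarrow>
    (\<exists>P. (\<forall>k\<in>I. decomposes_into (A k) m e (P k)) \<and> F = (\<Sum>k\<in>I. P k))"
  using assms
proof (induction I arbitrary: F rule: finite_induct)
  case empty
  then show ?case using decomposes_each_emptyD decomposes_each_empty by auto
next
  case (insert i I)
  have e: "image_mset A (mset_set (insert i I)) = add_mset (A i) (image_mset A (mset_set I))" using insert.hyps by simp
  show ?case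
  proof
    assume "decomposes_each m e (image_mset A (mset_set (insert i I))) F"
    then obtain Q F' where 1: "F = Q + F'" "decomposes_into (A i) m e Q" "decomposes_each m e (image_mset A (mset_set I)) F'"
      unfolding e by (rule decomposes_each_addE)
    then obtain P where P: "\<forall>k\<in>I. decomposes_into (A k) m e (P k)" "F' = (\<Sum>k\<in>I. P k)" using insert.IH by blast
    have "(\<Sum>k\<in>I. P k) = (\<Sum>k\<in>I. (P(i := Q)) k)" by (rule sum.cong) (use insert.hyps in auto)
    then have "F = (\<Sum>k\<in>insert i I. (P(i := Q)) k)" using 1(1) P(2) insert.hyps by simp
    moreover have "\<forall>k\<in>insert i I. decomposes_into (A k) m e ((P(i := Q)) k)" using P(1) 1(2) insert.hyps by auto
    ultimately show "\<exists>P. (\<forall>k\<in>insert i I. decomposes_into (A k) m e (P k)) \<and> F = (\<Sum>k\<in>insert i I. P k)" by blast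
  next
    assume "\<exists>P. (\<forall>k\<in>insert i I. decomposes_into (A k) m e (P k)) \<and> F = (\<Sum>k\<in>insert i I. P k)"
    then obtain P where P: "\<forall>k\<in>insert i I. decomposes_into (A k) m e (P k)" "F = (\<Sum>k\<in>insert i I. P k)" by blast
    have "decomposes_each m e (image_mset A (mset_set I)) (\<Sum>k\<in>I. P k)" using insert.IH P(1) by blast
    then show "decomposes_each m e (image_mset A (mset_set (insert i I))) F"
      unfolding e P(2) using decomposes_each_add P(1) insert.hyps by simp
  qed
qed

abbreviation scale :: "nat \<Rightarrow> nat multiset \<Rightarrow> nat multiset" where
  "scale c A \<equiv> image_mset (\<lambda>b. c * b) A"

lemma is_partition_scale: "c \<ge> 1 \<Longrightarrow> is_partition (c * e) (scale c A) \<longleftrightarrow> is_partition e A"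
  using sum_mset_distrib_left[of c "\<lambda>b. b" A] by (auto simp: is_partition_def Suc_le_eq)

lemma scale_Sum: "\<Sum>\<^sub># (image_mset (scale c) Q) = scale c (\<Sum>\<^sub># Q)"
  by (induction Q) auto

text \<open>Every submultiset of a multiset of multiples of \<open>c\<close> consists of multiples of \<open>c\<close>.\<close>

lemma unscale_Sum:
  assumes c: "c \<ge> 1" and "\<Sum>\<^sub># Q = scale c A"
  shows "\<exists>Q'. Q = image_mset (scale c) Q' \<and> \<Sum>\<^sub># Q' = A"
  using assms(2)
proof (induction Q arbitrary: A)
  case empty
  then show ?case by auto
next
  case (add B Q)
  then have "image_mset (\<lambda>b. c * b) A = B + \<Sum>\<^sub># Q" by simp
  then obtain A1 A2 where A: "A = A1 + A2" "B = scale c A1" "\<Sum>\<^sub># Q = scale c A2"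
    using image_mset_eq_plusD by metis
  obtain Q' where "Q = image_mset (scale c) Q'" "\<Sum>\<^sub># Q' = A2" using add.IH[OF A(3)] by blast
  then show ?case using A by (intro exI[of _ "add_mset A1 Q'"]) simp
qed

lemma decomposes_into_scale:
  assumes c: "c \<ge> 1"
  shows "decomposes_into (scale c A) m (c * e) Q \<longleftrightarrow> (\<exists>Q'. Q = image_mset (scale c) Q' \<and> decomposes_into A m e Q')"
proof
  assume L: "decomposes_into (scale c A) m (c * e) Q"
  then obtain Q' where Q': "Q = image_mset (scale c) Q'" "\<Sum>\<^sub># Q' = A"
    using unscale_Sum[OF c] unfolding decomposes_into_def by blast
  have "decomposes_into A m e Q'"
    using L Q' is_partition_scale[OF c] unfolding decomposes_into_def by auto
  then show "\<exists>Q'. Q = image_mset (scale c) Q' \<and> decomposes_into A m e Q'" using Q'(1) by blast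
next
  assume "\<exists>Q'. Q = image_mset (scale c) Q' \<and> decomposes_into A m e Q'"
  then show "decomposes_into (scale c A) m (c * e) Q"
    using is_partition_scale[OF c] scale_Sum unfolding decomposes_into_def by auto
qed

lemma size_mset_two:
  assumes "size M = 2" obtains a b where "M = {#a, b#}"
proof -
  obtain a N where N: "M = add_mset a N" using size_eq_Suc_imp_eq_union[of M 1] assms by auto
  then have "size N = 1" using assms by simp
  then obtain b where "N = {#b#}" using size_1_singleton_mset by blast
  then show ?thesis using that N by blast
qed

lemma size_mset_three:
  assumes "size M = 3" obtains a b c where "M = {#a, b, c#}"
proof -
  obtain a N where N: "M = add_mset a N" using size_eq_Suc_imp_eq_union[of M 2] assms by auto
  then have "size N = 2" using assms by simp
  then obtain b c where "N = {#b, c#}" by (rule size_mset_two)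
  then show ?thesis using that N by blast
qed

section \<open>The tetrahedral factorization\<close>

text \<open>The degrees run through \<open>12 * e\<close>, \<open>4 * e\<close>, \<open>2 * e\<close>, \<open>e\<close> as the power maps with exponents 3, 2 and 2 are split
off. The partition \<open>2 * a3\<close> becomes \<open>2 * b1\<close>, \<open>2 * b2\<close>, \<open>2 * b3\<close> after the cube. The first square is branched over the
points of the first two and breaks the third into \<open>2 * c1\<close> and \<open>2 * c2\<close>, over whose points the
second square is branched, while it breaks each of \<open>b1\<close> and \<open>b2\<close> into two. So \<open>a3\<close> ends up as \<open>c1\<close>, \<open>c2\<close> and
four pieces of \<open>b1\<close> and \<open>b2\<close>; the other partitions are decomposed by every map that is not
branched over their points.\<close>

lemma realizable_tetrahedral:
  fixes a1 a2 a3 :: "nat multiset" and E :: "nat multiset multiset"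
  assumes a: "is_partition (4 * e) a1" "is_partition (4 * e) a2" "is_partition (6 * e) a3"
    and E: "\<forall>A\<in>#E. is_partition (12 * e) A"
  shows "realizable (12 * e) ({#scale 3 a1, scale 3 a2#} + ({#scale 2 a3#} + E)) \<longleftrightarrow>
    (\<exists>P1 P2 P3 F. decomposes_into a1 4 e P1 \<and> decomposes_into a2 4 e P2 \<and> decomposes_into a3 6 e P3 \<and>
       decomposes_each 12 e E F \<and> realizable e (P1 + P2 + P3 + F))"
    (is "?L \<longleftrightarrow> ?R")
proof
  assume ?L
  then have L: "realizable (3 * (4 * e)) ({#scale 3 a1, scale 3 a2#} + ({#scale 2 a3#} + E))" by (simp add: mult.assoc)
  have "\<forall>A\<in>#{#scale 3 a1, scale 3 a2#} + ({#scale 2 a3#} + E). is_partition (3 * (4 * e)) A"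
    using a E is_partition_scale[of 3 "4 * e" a1] is_partition_scale[of 3 "4 * e" a2] is_partition_scale[of 2 "6 * e" a3]
    by (auto simp: mult.assoc[symmetric])
  then obtain F where F: "decomposes_each 3 (4 * e) ({#scale 2 a3#} + E) F" "realizable (4 * e) ({#a1, a2#} + F)"
    using realizable_power_imp[OF _ L] by auto
  obtain Q3 F1 where Q3: "F = Q3 + F1" "decomposes_into (scale 2 a3) 3 (4 * e) Q3" "decomposes_each 3 (4 * e) E F1"
    using F(1) by (auto elim: decomposes_each_addE)
  obtain Q where Q: "Q3 = image_mset (scale 2) Q" "decomposes_into a3 3 (2 * e) Q"
    using Q3(2) decomposes_into_scale[of 2 a3 3 "2 * e"] by (auto simp: mult.assoc[symmetric])
  obtain b1 b2 b3 where b: "Q = {#b1, b2, b3#}"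
    by (rule size_mset_three[of Q]) (use Q(2) in \<open>auto simp: decomposes_into_def\<close>)
  have bp: "is_partition (2 * e) b1" "is_partition (2 * e) b2" "is_partition (2 * e) b3" and bs: "a3 = b1 + b2 + b3"
    using Q(2) by (auto simp: b decomposes_into_def)
  have R2: "realizable (2 * (2 * e)) ({#scale 2 b1, scale 2 b2#} + ({#a1, a2, scale 2 b3#} + F1))"
    using F(2) by (simp add: Q3(1) Q(1) b add_mset_commute mult.assoc[symmetric])
  have "\<forall>A\<in>#{#scale 2 b1, scale 2 b2#} + ({#a1, a2, scale 2 b3#} + F1). is_partition (2 * (2 * e)) A"
    using a bp is_partition_scale[of 2 "2 * e"] decomposes_eachD(2)[OF Q3(3)] by (auto simp: mult.assoc[symmetric])
  then obtain G where G: "decomposes_each 2 (2 * e) ({#a1, a2, scale 2 b3#} + F1) G" "realizable (2 * e) ({#b1, b2#} + G)"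
    using realizable_power_imp[OF _ R2] by auto
  obtain R1 R2 U G1 where G1: "G = R1 + (R2 + (U + G1))" "decomposes_into a1 2 (2 * e) R1" "decomposes_into a2 2 (2 * e) R2"
     "decomposes_into (scale 2 b3) 2 (2 * e) U" "decomposes_each 2 (2 * e) F1 G1"
    using G(1) by (auto elim!: decomposes_each_addE)
  obtain V where V: "U = image_mset (scale 2) V" "decomposes_into b3 2 e V"
    using G1(4) decomposes_into_scale[of 2 b3 2 e] by auto
  obtain c1 c2 where c: "V = {#c1, c2#}"
    by (rule size_mset_two[of V]) (use V(2) in \<open>auto simp: decomposes_into_def\<close>)
  have cp: "is_partition e c1" "is_partition e c2" and cs: "b3 = c1 + c2"
    using V(2) by (auto simp: c decomposes_into_def)
  have R3: "realizable (2 * e) ({#scale 2 c1, scale 2 c2#} + ({#b1, b2#} + (R1 + (R2 + G1))))"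
    using G(2) by (simp add: G1(1) V(1) c add_mset_commute ac_simps)
  have "\<forall>A\<in>#{#scale 2 c1, scale 2 c2#} + ({#b1, b2#} + (R1 + (R2 + G1))). is_partition (2 * e) A"
    using bp cp is_partition_scale[of 2 e] decomposes_eachD(2)[OF G1(5)] G1(2,3) by (auto simp: decomposes_into_def)
  then obtain H where H: "decomposes_each 2 e ({#b1, b2#} + (R1 + (R2 + G1))) H" "realizable e ({#c1, c2#} + H)"
    using realizable_power_imp[OF _ R3] by auto
  obtain S1 S2 H0 where S: "H = S1 + (S2 + H0)" "decomposes_into b1 2 e S1" "decomposes_into b2 2 e S2"
    "decomposes_each 2 e (R1 + (R2 + G1)) H0"
    using H(1) by (auto elim!: decomposes_each_addE)
  obtain P1 H1 where P1: "H0 = P1 + H1" "decomposes_each 2 e R1 P1" "decomposes_each 2 e (R2 + G1) H1"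
    by (rule decomposes_each_unionE[OF S(4)])
  obtain P2 F' where P2: "H1 = P2 + F'" "decomposes_each 2 e R2 P2" "decomposes_each 2 e G1 F'"
    by (rule decomposes_each_unionE[OF P1(3)])
  have "decomposes_into a1 4 e P1" "decomposes_into a2 4 e P2"
    using decomposes_into_refine[OF G1(2) P1(2)] decomposes_into_refine[OF G1(3) P2(2)] by simp_all
  moreover have "decomposes_into a3 6 e ({#c1, c2#} + S1 + S2)"
    using S(2,3) cp bs cs by (auto simp: decomposes_into_def)
  moreover have "decomposes_each 12 e E F'"
    using decomposes_each_refine[OF Q3(3) decomposes_each_refine[OF G1(5) P2(3)]] by simp
  moreover have "realizable e (P1 + P2 + ({#c1, c2#} + S1 + S2) + F')"
    using H(2) by (simp add: S(1) P1(1) P2(1) ac_simps)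
  ultimately show ?R by blast
next
  assume ?R
  then obtain P1 P2 P3 F where P: "decomposes_into a1 4 e P1" "decomposes_into a2 4 e P2" "decomposes_into a3 6 e P3"
    and F: "decomposes_each 12 e E F" and R: "realizable e (P1 + P2 + P3 + F)" by blast
  have "size P3 = 2 + 4" using P(3) by (simp add: decomposes_into_def)
  then obtain C S where CS: "P3 = C + S" "size C = 2" "size S = 4" by (rule split_mset_size)
  have "size S = 2 + 2" using CS(3) by simp
  then obtain S1 S2 where S: "S = S1 + S2" "size S1 = 2" "size S2 = 2" by (rule split_mset_size)
  obtain c1 c2 where c: "C = {#c1, c2#}" by (rule size_mset_two[OF CS(2)])
  define b1 b2 b3 where "b1 = \<Sum>\<^sub># S1" and "b2 = \<Sum>\<^sub># S2" and "b3 = c1 + c2"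
  have pt: "\<forall>B\<in>#S1. is_partition e B" "\<forall>B\<in>#S2. is_partition e B" "is_partition e c1" "is_partition e c2"
    and a3: "a3 = b1 + b2 + b3"
    using P(3) by (auto simp: decomposes_into_def CS(1) S(1) c b1_def b2_def b3_def)
  have db: "decomposes_into b1 2 e S1" "decomposes_into b2 2 e S2" "decomposes_into b3 2 e {#c1, c2#}"
    using decomposes_into_Sum[OF pt(1)] decomposes_into_Sum[OF pt(2)] S(2,3) pt(3,4)
    by (auto simp: b1_def b2_def b3_def decomposes_into_def)
  have bp: "is_partition (2 * e) b1" "is_partition (2 * e) b2" "is_partition (2 * e) b3"
    using is_partition_Sum[OF pt(1)] is_partition_Sum[OF pt(2)] is_partition_Sum[of "{#c1, c2#}" e] pt(3,4) S(2,3)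
    by (auto simp: b1_def b2_def b3_def mult_2)
  obtain R1 where R1: "decomposes_into a1 2 (2 * e) R1" "decomposes_each 2 e R1 P1"
    using decomposes_into_split[of a1 2 2 e P1] P(1) by auto
  obtain R2 where R2: "decomposes_into a2 2 (2 * e) R2" "decomposes_each 2 e R2 P2"
    using decomposes_into_split[of a2 2 2 e P2] P(2) by auto
  obtain F1 where F1: "decomposes_each 3 (4 * e) E F1" "decomposes_each 4 e F1 F"
    using decomposes_each_split[of 3 4 e E F] F by auto
  obtain G1 where G1: "decomposes_each 2 (2 * e) F1 G1" "decomposes_each 2 e G1 F"
    using decomposes_each_split[of 2 2 e F1 F] F1(2) by auto
  have "decomposes_each 2 e ({#b1, b2#} + (R1 + (R2 + G1))) (S1 + (S2 + (P1 + (P2 + F))))"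
    using decomposes_each_add[OF db(1) decomposes_each_add[OF db(2)
      decomposes_each_union[OF R1(2) decomposes_each_union[OF R2(2) G1(2)]]]] by simp
  moreover have "realizable e ({#c1, c2#} + (S1 + (S2 + (P1 + (P2 + F)))))"
    using R by (simp add: CS(1) S(1) c ac_simps)
  ultimately have "realizable (2 * e) ({#scale 2 c1, scale 2 c2#} + ({#b1, b2#} + (R1 + (R2 + G1))))"
    by (intro realizable_power_if pt(3,4)) auto
  then have r2: "realizable (2 * e) ({#b1, b2#} + (R1 + (R2 + ({#scale 2 c1, scale 2 c2#} + G1))))"
    by (simp add: add_mset_commute ac_simps)
  have "decomposes_into (scale 2 b3) 2 (2 * e) {#scale 2 c1, scale 2 c2#}"
    using decomposes_into_scale[of 2 b3 2 e "{#scale 2 c1, scale 2 c2#}"] db(3) by (auto intro!: exI[of _ "{#c1, c2#}"])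
  from decomposes_each_add[OF R1(1) decomposes_each_add[OF R2(1) decomposes_each_add[OF this G1(1)]]]
  have "decomposes_each 2 (2 * e) ({#a1, a2, scale 2 b3#} + F1) (R1 + (R2 + ({#scale 2 c1, scale 2 c2#} + G1)))" by simp
  from realizable_power_if[OF _ this r2 bp(1,2)]
  have "realizable (2 * (2 * e)) ({#scale 2 b1, scale 2 b2#} + ({#a1, a2, scale 2 b3#} + F1))" by simp
  then have r3: "realizable (4 * e) ({#a1, a2#} + ({#scale 2 b1, scale 2 b2, scale 2 b3#} + F1))"
    by (simp add: add_mset_commute mult.assoc[symmetric])
  have "decomposes_into a3 3 (2 * e) {#b1, b2, b3#}" using bp by (simp add: decomposes_into_def a3 ac_simps)
  then have "decomposes_into (scale 2 a3) 3 (2 * (2 * e)) {#scale 2 b1, scale 2 b2, scale 2 b3#}"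
    using decomposes_into_scale[of 2 a3 3 "2 * e"] by (auto intro!: exI[of _ "{#b1, b2, b3#}"])
  then have "decomposes_into (scale 2 a3) 3 (4 * e) {#scale 2 b1, scale 2 b2, scale 2 b3#}" by (simp add: mult.assoc[symmetric])
  from decomposes_each_add[OF this F1(1)]
  have "decomposes_each 3 (4 * e) ({#scale 2 a3#} + E) ({#scale 2 b1, scale 2 b2, scale 2 b3#} + F1)" by simp
  from realizable_power_if[OF _ this r3 a(1,2)] show ?L by (simp add: mult.assoc[symmetric])
qed

theorem theorem1p3:
  fixes d' n :: nat
    and A a :: "nat \<Rightarrow> nat multiset"
  assumes "d' \<ge> 4" and "n \<ge> 3" and "4 dvd d'"
    and "\<forall>k\<in>{1..n}. is_partition (3 * d') (A k) \<and> nontrivial (A k)"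
    and "\<forall>k\<in>{1..n}. \<forall>b\<in>#a k. b \<ge> 1"
    and "A 1 = image_mset (\<lambda>b. 3 * b) (a 1)"
    and "A 2 = image_mset (\<lambda>b. 3 * b) (a 2)"
    and "A 3 = image_mset (\<lambda>b. 2 * b) (a 3)"
    and "\<forall>k\<in>{4..n}. A k = a k"
    and "(\<Sum>k=1..n. size (a k)) = 3 * (n - 2) * d' + 2"
  shows "(\<exists>f. sphere_cover_with_data f (3 * d') (image_mset A (mset_set {1..n})))
    \<longleftrightarrow> (\<exists>P :: nat \<Rightarrow> nat multiset multiset.
          decomposes_into (a 3) 6 (d' div 4) (P 3) \<and>
          decomposes_into (a 1) 4 (d' div 4) (P 1) \<and>
          decomposes_into (a 2) 4 (d' div 4) (P 2) \<and>
          (\<forall>k\<in>{4..n}. decomposes_into (A k) 12 (d' div 4) (P k)) \<and>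
          (\<exists>g. sphere_cover_with_data g (d' div 4) (\<Sum>k=1..n. P k)))"
proof -
  define e where "e = d' div 4"
  have d': "d' = 4 * e" using assms(3) by (simp add: e_def)
  have split: "{1..n} = insert 1 (insert 2 (insert 3 {4..n}))" using assms(2) by auto
  define E where "E = image_mset A (mset_set {4..n})"
  have D: "image_mset A (mset_set {1..n}) = {#scale 3 (a 1), scale 3 (a 2)#} + ({#scale 2 (a 3)#} + E)"
    unfolding split E_def using assms(6-8) by simp
  have sums: "(\<Sum>k=1..n. P k) = P 1 + P 2 + P 3 + (\<Sum>k=4..n. P k)" for P :: "nat \<Rightarrow> nat multiset multiset"
    unfolding split by (simp add: ac_simps)
  have part: "is_partition (12 * e) (A k)" if "k \<in> {1..n}" for k using assms(4) that by (simp add: d')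
  have "is_partition (3 * (4 * e)) (scale 3 (a 1))" "is_partition (3 * (4 * e)) (scale 3 (a 2))" "is_partition (2 * (6 * e)) (scale 2 (a 3))"
    using part[of 1] part[of 2] part[of 3] assms(2,6-8) by simp_all
  then have a: "is_partition (4 * e) (a 1)" "is_partition (4 * e) (a 2)" "is_partition (6 * e) (a 3)"
    using is_partition_scale[of 3 "4 * e"] is_partition_scale[of 2 "6 * e"] by simp_all
  have E: "\<forall>B\<in>#E. is_partition (12 * e) B" unfolding E_def using part by auto
  have "(\<exists>f. sphere_cover_with_data f (3 * d') (image_mset A (mset_set {1..n}))) \<longleftrightarrow>
     realizable (12 * e) ({#scale 3 (a 1), scale 3 (a 2)#} + ({#scale 2 (a 3)#} + E))"
    unfolding realizable_def D by (simp add: d')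
  also have "\<dots> \<longleftrightarrow> (\<exists>P1 P2 P3 F. decomposes_into (a 1) 4 e P1 \<and> decomposes_into (a 2) 4 e P2 \<and>
      decomposes_into (a 3) 6 e P3 \<and> decomposes_each 12 e E F \<and> realizable e (P1 + P2 + P3 + F))"
    by (rule realizable_tetrahedral[OF a E])
  also have "\<dots> \<longleftrightarrow> (\<exists>P. decomposes_into (a 3) 6 e (P 3) \<and> decomposes_into (a 1) 4 e (P 1) \<and>
      decomposes_into (a 2) 4 e (P 2) \<and> (\<forall>k\<in>{4..n}. decomposes_into (A k) 12 e (P k)) \<and>
      realizable e (\<Sum>k=1..n. P k))" (is "?L \<longleftrightarrow> ?R")
  proof
    assume ?L
    then obtain P1 P2 P3 F where 1: "decomposes_into (a 1) 4 e P1" "decomposes_into (a 2) 4 e P2" "decomposes_into (a 3) 6 e P3"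
      "decomposes_each 12 e E F" "realizable e (P1 + P2 + P3 + F)" by blast
    obtain P where P: "\<forall>k\<in>{4..n}. decomposes_into (A k) 12 e (P k)" "F = (\<Sum>k=4..n. P k)"
      using 1(4) decomposes_each_indexed[of "{4..n}"] unfolding E_def by auto
    define P' where "P' = P(1 := P1, 2 := P2, 3 := P3)"
    have P': "P' 1 = P1" "P' 2 = P2" "P' 3 = P3" "\<And>k. k \<in> {4..n} \<Longrightarrow> P' k = P k" by (auto simp: P'_def)
    have "(\<Sum>k=1..n. P' k) = P1 + P2 + P3 + F" unfolding sums P(2) P'(1-3) using P'(4) by simp
    then show ?R using 1 P(1) P' by (intro exI[of _ P']) simp
  next
    assume ?R
    then obtain P where P: "decomposes_into (a 3) 6 e (P 3)" "decomposes_into (a 1) 4 e (P 1)" "decomposes_into (a 2) 4 e (P 2)"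
      "\<forall>k\<in>{4..n}. decomposes_into (A k) 12 e (P k)" "realizable e (\<Sum>k=1..n. P k)" by blast
    have "decomposes_each 12 e E (\<Sum>k=4..n. P k)" unfolding E_def using P(4) decomposes_each_indexed[of "{4..n}"] by blast
    then show ?L using P unfolding sums by blast
  qed
  finally show ?thesis unfolding realizable_def e_def .
qed

end
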